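(* Let $\eta,\omega,\rho$ be real numbers which are algebraically independent over $\mathbb{Q}$, and put $$b_1:=\frac{\rho^2-\eta^2}{\omega^2-\eta^2}+\frac{\eta^2-\omega^2}{4},\qquad B(x):=(x+b_1)^2-\eta^2,\qquad C(x):=2(x+b_1)+\omega^2-\eta^2-1 .$$ Assume $\omega>1+|\eta|$, $\ \omega^2-\eta^2>2\omega$ and $b_1>1+\frac{\omega^2-\eta^2}{2}$. Then the polynomial $$P(x^2,y^2):=(y^2+1)\bigl(y^2+C(x^2)\bigr)\bigl(y^4+(1+C(x^2))y^2+B(x^2)\bigr)\in\mathbb{R}[x,y]$$ is positive but is not a sum of three squares in $\mathbb{R}(x,y)$.
   Context: A polynomial in $\mathbb{R}[x,y]$ is called positive if it takes values $\geq 0$ at every point of $\mathbb{R}^2$. "Sum of three squares in $\mathbb{R}(x,y)$" means a sum of squares of three rational functions. *)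

theory Defs
  imports Complex_Main "HOL-Computational_Algebra.Computational_Algebra"
begin

text \<open>
  \<open>K[x,y]\<close> is rendered as \<open>K poly poly\<close>: the inner variable is \<open>x\<close>, the outer one is \<open>y\<close>.
  Likewise \<open>K[x,y,z]\<close> is \<open>K poly poly poly\<close>, with \<open>z\<close> outermost.
\<close>

definition eval2 :: "'a::comm_semiring_1 poly poly \<Rightarrow> 'a \<Rightarrow> 'a \<Rightarrow> 'a" where
  "eval2 p a b = poly (poly p [:b:]) a"

definition eval3 :: "'a::comm_semiring_1 poly poly poly \<Rightarrow> 'a \<Rightarrow> 'a \<Rightarrow> 'a \<Rightarrow> 'a" where
  "eval3 p a b c = eval2 (poly p [:[:c:]:]) a b"

definition rat_alg_indep3 :: "'a::field_char_0 \<Rightarrow> 'a \<Rightarrow> 'a \<Rightarrow> bool" where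
  "rat_alg_indep3 a b c \<longleftrightarrow>
     (\<forall>p :: rat poly poly poly.
        eval3 (map_poly (map_poly (map_poly of_rat)) p) a b c = 0 \<longrightarrow> p = 0)"

definition positive_poly2 :: "real poly poly \<Rightarrow> bool" where
  "positive_poly2 p \<longleftrightarrow> (\<forall>a b. eval2 p a b \<ge> 0)"

definition sum_of_three_squares :: "'a::comm_semiring_1 \<Rightarrow> bool" where
  "sum_of_three_squares u \<longleftrightarrow> (\<exists>f g h. u = f\<^sup>2 + g\<^sup>2 + h\<^sup>2)"

definition b1 :: "real \<Rightarrow> real \<Rightarrow> real \<Rightarrow> real" where
  "b1 \<eta> \<omega> \<rho> = (\<rho>\<^sup>2 - \<eta>\<^sup>2) / (\<omega>\<^sup>2 - \<eta>\<^sup>2) + (\<eta>\<^sup>2 - \<omega>\<^sup>2) / 4"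

definition B :: "real \<Rightarrow> real \<Rightarrow> real \<Rightarrow> real poly" where
  "B \<eta> \<omega> \<rho> = ([:0, 1:] + [:b1 \<eta> \<omega> \<rho>:])\<^sup>2 - [:\<eta>\<^sup>2:]"

definition C :: "real \<Rightarrow> real \<Rightarrow> real \<Rightarrow> real poly" where
  "C \<eta> \<omega> \<rho> = 2 * ([:0, 1:] + [:b1 \<eta> \<omega> \<rho>:]) + [:\<omega>\<^sup>2 - \<eta>\<^sup>2 - 1:]"

text \<open>
  The polynomial \<open>P(x\<^sup>2, y\<^sup>2)\<close>. Composing with \<open>[:0, 0, 1:]\<close> substitutes \<open>x\<^sup>2\<close> for \<open>x\<close>, and
  \<open>[:q:]\<close> embeds \<open>q \<in> \<real>[x]\<close> into \<open>\<real>[x,y]\<close>.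
\<close>
definition P_sq :: "real \<Rightarrow> real \<Rightarrow> real \<Rightarrow> real poly poly" where
  "P_sq \<eta> \<omega> \<rho> =
     (let y = [:0, 1:];
          Bx2 = [:pcompose (B \<eta> \<omega> \<rho>) [:0, 0, 1:]:];
          Cx2 = [:pcompose (C \<eta> \<omega> \<rho>) [:0, 0, 1:]:]
      in (y\<^sup>2 + 1) * (y\<^sup>2 + Cx2) * (y ^ 4 + (1 + Cx2) * y\<^sup>2 + Bx2))"

lemma eval2_P_sq:
  "eval2 (P_sq \<eta> \<omega> \<rho>) x y =
     (let B' = (x\<^sup>2 + b1 \<eta> \<omega> \<rho>)\<^sup>2 - \<eta>\<^sup>2;
          C' = 2 * (x\<^sup>2 + b1 \<eta> \<omega> \<rho>) + \<omega>\<^sup>2 - \<eta>\<^sup>2 - 1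
      in (y\<^sup>2 + 1) * (y\<^sup>2 + C') * (y ^ 4 + (1 + C') * y\<^sup>2 + B'))"
  by (simp add: eval2_def P_sq_def B_def C_def Let_def poly_pcompose power2_eq_square algebra_simps)

end

theory Submission
  imports Defs "HOL-Computational_Algebra.Field_as_Ring"
begin

text \<open>
  Put \<open>g = \<omega>\<^sup>2 - \<eta>\<^sup>2\<close> and rescale \<open>x, y\<close> by \<open>\<surd>g\<close>. Up to a constant the polynomial becomes
  \<open>P(\<xi>) = T (2 \<xi> + T + 1 + 2 \<beta>) ((\<xi> + T + \<beta>)\<^sup>2 + T - \<kappa>\<^sup>2)\<close> with \<open>\<xi> = x\<^sup>2\<close>, \<open>T = y\<^sup>2 + \<theta>\<close>, where
  \<open>\<theta>, \<kappa>, \<beta>\<close> are again algebraically independent. Hence \<open>\<real>\<close> has a derivation \<open>D\<close> with \<open>D \<theta> = 1\<close> that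
  kills \<open>\<kappa>\<close> and \<open>\<beta>\<close>, and \<open>\<delta> = 2 y D - d/dy\<close> is a derivation of \<open>k = \<real>(y)\<close> killing \<open>T\<close>.

  A Wronskian argument with degrees shows that \<open>-P(\<xi>)\<close> or \<open>-\<xi> P(\<xi>)\<close> can be a square in \<open>k\<close> only
  if \<open>\<delta> \<xi> = 0\<close>. By Cassels--Pfister a sum of three squares is the squared length of a vector
  \<open>a\<^sub>0 + c\<^sub>0 x + a\<^sub>1 x\<^sup>2 + c\<^sub>1 x\<^sup>3\<close> over \<open>k\<close>; its Gram data produce such points, so they are algebraic over
  the constants of \<open>\<delta>\<close>, hence constant, hence rational functions of \<open>T\<close>. This gives
  \<open>P(x\<^sup>2) = 2 T f\<^sup>2 + d (g\<^sup>2 + 2 T h\<^sup>2)\<close> over \<open>\<real>(T)\<close>; a descent removes the positive zeros of \<open>d\<close>, so \<open>d\<close> has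
  the form \<open>\<alpha>\<^sup>2 + T \<gamma>\<^sup>2\<close> and \<open>P/T = u\<^sup>2 + v\<^sup>2 + T w\<^sup>2\<close>.

  A second use of Cassels--Pfister, over \<open>\<real>(x)\<close>, makes \<open>u, v, w\<close> linear in \<open>T\<close>. The root \<open>t\<close> of \<open>u + i v\<close>
  then makes \<open>t (P/T)(t)\<close> a square in \<open>\<complex>(x)\<close>, and the same Wronskian argument with a derivation
  sending \<open>\<beta>\<close> to \<open>1\<close> shows that \<open>t\<close> is a rational function of \<open>X = x\<^sup>2 + \<beta>\<close>. Then
  \<open>4 \<bar>t\<bar>\<^sup>2 \<bar>t + a\<bar>\<^sup>2 = a\<^sup>2 (X\<^sup>2 - \<kappa>\<^sup>2)\<close> with \<open>a = 2 X + 1\<close>, which is absurd at real \<open>X\<close> with \<open>0 < X < \<kappa>\<close>.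
\<close>

section \<open>Extension of derivations\<close>

text \<open>The graph of a derivation on a subring. Relations instead of partial functions let
  Zorn's lemma work with plain inclusion; closure under subtraction reduces single-valuedness to the
  value at 0.\<close>

definition deriv_graph :: "('a::field_char_0 \<times> 'a) set \<Rightarrow> bool" where
  "deriv_graph G \<longleftrightarrow> (1, 0) \<in> G \<and>
     (\<forall>a a' b b'. (a, a') \<in> G \<longrightarrow> (b, b') \<in> G \<longrightarrow> (a - b, a' - b') \<in> G \<and> (a * b, a * b' + a' * b) \<in> G) \<and>
     (\<forall>c. (0, c) \<in> G \<longrightarrow> c = 0)"

text \<open>The extension to the ring generated by the domain and \<open>x\<close> that sends
  \<open>x\<close> to \<open>d\<close>. \<open>F'\<close> is the derivation applied to the
  coefficients of \<open>F\<close>, not its formal derivative.\<close>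

definition adjoin :: "('a::field_char_0 \<times> 'a) set \<Rightarrow> 'a \<Rightarrow> 'a \<Rightarrow> ('a \<times> 'a) set" where
  "adjoin G x d = {(poly F x, poly F' x + poly (pderiv F) x * d) |F F'. \<forall>i. (coeff F i, coeff F' i) \<in> G}"

definition derivation :: "('a::comm_ring_1 \<Rightarrow> 'a) \<Rightarrow> bool" where
  "derivation D \<longleftrightarrow> (\<forall>a b. D (a + b) = D a + D b) \<and> (\<forall>a b. D (a * b) = a * D b + D a * b)"

context
  fixes G :: "('a::field_char_0 \<times> 'a) set"
  assumes G: "deriv_graph G"
begin

lemma graph_one: "(1, 0) \<in> G"
  and graph_diff: "(a, a') \<in> G \<Longrightarrow> (b, b') \<in> G \<Longrightarrow> (a - b, a' - b') \<in> G"
  and graph_mult: "(a, a') \<in> G \<Longrightarrow> (b, b') \<in> G \<Longrightarrow> (a * b, a * b' + a' * b) \<in> G"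
  and graph_unique0: "(0, c) \<in> G \<Longrightarrow> c = 0"
  using G unfolding deriv_graph_def by blast+

lemma graph_zero: "(0, 0) \<in> G"
  using graph_diff[OF graph_one graph_one] by simp

lemma graph_uminus: "(a, a') \<in> G \<Longrightarrow> (- a, - a') \<in> G"
  using graph_diff[OF graph_zero] by fastforce

lemma graph_add: "(a, a') \<in> G \<Longrightarrow> (b, b') \<in> G \<Longrightarrow> (a + b, a' + b') \<in> G"
  using graph_diff[OF _ graph_uminus, of a a' b b'] by simp

lemma graph_sum:
  "finite A \<Longrightarrow> (\<And>i. i \<in> A \<Longrightarrow> (f i, f' i) \<in> G) \<Longrightarrow> (sum f A, sum f' A) \<in> G"
  by (induction A rule: finite_induct) (auto intro: graph_zero graph_add)

lemma graph_of_nat: "(a, a') \<in> G \<Longrightarrow> (of_nat n * a, of_nat n * a') \<in> G"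
  by (induction n) (auto intro: graph_zero graph_add simp: distrib_right)

lemma graph_unique: "(a, b) \<in> G \<Longrightarrow> (a, c) \<in> G \<Longrightarrow> b = c"
  using graph_diff[of a b a c] graph_unique0 by fastforce

lemma poly_graph_mult:
  assumes "\<And>i. (coeff F i, coeff F' i) \<in> G" "\<And>i. (coeff H i, coeff H' i) \<in> G"
  shows "(coeff (F * H) i, coeff (F * H' + F' * H) i) \<in> G"
proof -
  have "((\<Sum>j\<le>i. coeff F j * coeff H (i - j)), (\<Sum>j\<le>i. coeff F j * coeff H' (i - j) + coeff F' j * coeff H (i - j))) \<in> G"
    by (rule graph_sum) (auto intro: graph_mult assms)
  then show ?thesis by (simp add: coeff_mult sum.distrib)
qed

lemma poly_graph_pderiv:
  assumes "\<And>i. (coeff F i, coeff F' i) \<in> G"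
  shows "(coeff (pderiv F) i, coeff (pderiv F') i) \<in> G"
  using graph_of_nat[OF assms[of "Suc i"], of "Suc i"] by (simp add: coeff_pderiv)

lemma poly_graph_const_mult:
  assumes "(c, c') \<in> G" "\<And>i. (coeff F i, coeff F' i) \<in> G"
  shows "(coeff (monom c k * F) i, coeff (monom c k * F' + monom c' k * F) i) \<in> G"
  by (rule poly_graph_mult) (use assms graph_zero in auto)

text \<open>Assumption \<open>C\<close> is well-definedness: two polynomials representing the same
  element of the larger ring differ by one that vanishes at \<open>x\<close>, and such a polynomial
  must be sent to 0.\<close>

lemma deriv_graph_adjoin:
  assumes C: "\<And>F F'. (\<And>i. (coeff F i, coeff F' i) \<in> G) \<Longrightarrow> poly F x = 0 \<Longrightarrow>
                 poly F' x + poly (pderiv F) x * d = 0"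
  shows "deriv_graph (adjoin G x d)" "G \<subseteq> adjoin G x d" "(x, d) \<in> adjoin G x d"
proof -
  have I: "(poly F x, poly F' x + poly (pderiv F) x * d) \<in> adjoin G x d"
    if "\<And>i. (coeff F i, coeff F' i) \<in> G" for F F'
    using that unfolding adjoin_def by blast
  have one: "(1, 0) \<in> adjoin G x d"
    using I[of 1 0] graph_zero graph_one by (auto simp: one_pCons coeff_pCons pderiv_pCons split: nat.splits)
  show "G \<subseteq> adjoin G x d"
  proof
    fix z assume "z \<in> G"
    then show "z \<in> adjoin G x d"
      using I[of "[:fst z:]" "[:snd z:]"] graph_zero
      by (cases z) (auto simp: coeff_pCons pderiv_pCons split: nat.splits)
  qed
  show "(x, d) \<in> adjoin G x d"
    using I[of "[:0, 1:]" 0] graph_zero graph_one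
    by (auto simp: coeff_pCons pderiv_pCons split: nat.splits)
  have "(a - b, a' - b') \<in> adjoin G x d \<and> (a * b, a * b' + a' * b) \<in> adjoin G x d"
    if "(a, a') \<in> adjoin G x d" "(b, b') \<in> adjoin G x d" for a a' b b'
  proof -
    from that obtain F F' H H' where
      F: "\<And>i. (coeff F i, coeff F' i) \<in> G" "a = poly F x" "a' = poly F' x + poly (pderiv F) x * d"
      and H: "\<And>i. (coeff H i, coeff H' i) \<in> G" "b = poly H x" "b' = poly H' x + poly (pderiv H) x * d"
      unfolding adjoin_def by blast
    have "(a - b, a' - b') \<in> adjoin G x d"
      using I[of "F - H" "F' - H'"] F H graph_diff by (simp add: pderiv_diff algebra_simps)
    moreover have "(a * b, a * b' + a' * b) \<in> adjoin G x d"
      using I[of "F * H" "F * H' + F' * H", OF poly_graph_mult[OF F(1) H(1)]] F H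
      by (simp add: pderiv_mult algebra_simps)
    ultimately show ?thesis by blast
  qed
  moreover have "c = 0" if "(0, c) \<in> adjoin G x d" for c
    using that C unfolding adjoin_def by auto
  ultimately show "deriv_graph (adjoin G x d)"
    unfolding deriv_graph_def using one by blast
qed

text \<open>If no nonzero \<open>F\<close> over the domain vanishes at \<open>x\<close>, any
  \<open>d\<close> works. Otherwise a vanishing \<open>M\<close> of least degree dictates
  \<open>d\<close>; in characteristic 0 minimality makes the formal derivative of \<open>M\<close>
  nonzero at \<open>x\<close>.\<close>

lemma ex_deriv_value:
  "\<exists>d. \<forall>F F'. (\<forall>i. (coeff F i, coeff F' i) \<in> G) \<longrightarrow> poly F x = 0 \<longrightarrow> poly F' x + poly (pderiv F) x * d = 0"
proof (cases "\<exists>F F'. (\<forall>i. (coeff F i, coeff F' i) \<in> G) \<and> poly F x = 0 \<and> F \<noteq> 0")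
  case False
  show ?thesis
  proof (intro exI[of _ 0] allI impI)
    fix F F' assume *: "\<forall>i. (coeff F i, coeff F' i) \<in> G" "poly F x = 0"
    then have "F = 0" using False by blast
    with * have "coeff F' i = 0" for i using graph_unique0 by (metis coeff_0)
    then have "F' = 0" by (simp add: poly_eq_iff)
    then show "poly F' x + poly (pderiv F) x * 0 = 0" by simp
  qed
next
  case True
  define Pr where "Pr F = (\<exists>F'. (\<forall>i. (coeff F i, coeff F' i) \<in> G) \<and> poly F x = 0 \<and> F \<noteq> 0)" for F
  obtain M where "Pr M" and Mmin: "\<And>F. Pr F \<Longrightarrow> degree M \<le> degree F"
    using True ex_has_least_nat[of Pr _ degree] unfolding Pr_def by metis
  then obtain M' where M: "\<And>i. (coeff M i, coeff M' i) \<in> G" "poly M x = 0" "M \<noteq> 0"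
    unfolding Pr_def by blast
  have degM: "degree M \<noteq> 0"
    using M(2,3) by (metis degree_eq_zeroE pCons_0_0 poly_const_conv)
  have dM: "poly (pderiv M) x \<noteq> 0"
  proof
    assume "poly (pderiv M) x = 0"
    moreover have "pderiv M \<noteq> 0" using degM by (simp add: pderiv_eq_0_iff)
    ultimately have "Pr (pderiv M)" unfolding Pr_def using poly_graph_pderiv[OF M(1)] by blast
    from Mmin[OF this] show False using degM by (simp add: degree_pderiv)
  qed
  define d where "d = - poly M' x / poly (pderiv M) x"
  have Md: "poly M' x + poly (pderiv M) x * d = 0" using dM by (simp add: d_def)
  have "poly F' x + poly (pderiv F) x * d = 0"
    if "\<And>i. (coeff F i, coeff F' i) \<in> G" "poly F x = 0" for F F'
    using that
  proof (induction "degree F" arbitrary: F F' rule: less_induct)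
    case less
    show ?case
    proof (cases "F = 0")
      case True
      then have "coeff F' i = 0" for i using less.prems(1)[of i] graph_unique0 by simp
      then have "F' = 0" by (simp add: poly_eq_iff)
      with True show ?thesis by simp
    next
      case False
      with less.prems have "Pr F" unfolding Pr_def by blast
      then have le: "degree M \<le> degree F" by (rule Mmin)
      define n where "n = degree F - degree M"
      define a where "a = lead_coeff M" define a' where "a' = coeff M' (degree M)"
      define b where "b = lead_coeff F" define b' where "b' = coeff F' (degree F)"
      \<comment> \<open>Pseudo-division: the domain of \<open>G\<close> is only a ring, so leading
        terms are cancelled by cross-multiplying with the leading coefficients. \<open>H'\<close> is
        the coefficientwise derivative of \<open>H\<close>.\<close>
      define H where "H = monom a 0 * F - monom b n * M"
      define H' where "H' = (monom a 0 * F' + monom a' 0 * F) - (monom b n * M' + monom b' n * M)"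
      have ab: "(a, a') \<in> G" "(b, b') \<in> G" using M(1) less.prems(1) by (auto simp: a_def a'_def b_def b'_def)
      have HG: "(coeff H i, coeff H' i) \<in> G" for i
        unfolding H_def H'_def coeff_diff
        by (rule graph_diff) (rule poly_graph_const_mult; use ab M(1) less.prems(1) in auto)+
      have Hx: "poly H x = 0" using less.prems(2) M(2) by (simp add: H_def)
      have a0: "a \<noteq> 0" using M(3) by (simp add: a_def)
      have F0: "degree F \<noteq> 0" using le degM by linarith
      have "degree H < degree F \<or> H = 0"
      proof -
        have "degree H \<le> degree F"
          unfolding H_def using le degree_mult_le[of "monom b n" M] degree_mult_le[of "monom a 0" F]
            degree_monom_le[of b n] degree_monom_le[of a 0]
          by (intro degree_diff_le) (auto simp: n_def)
        moreover have "coeff H (degree F) = 0"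
          using le by (simp add: H_def n_def a_def b_def coeff_monom_mult)
        ultimately show ?thesis
          by (metis eq_zero_or_degree_less)
      qed
      then have "degree H < degree F" using F0 by auto
      from less.hyps[OF this HG Hx]
      have "poly H' x + poly (pderiv H) x * d = 0" .
      moreover have "poly H' x + poly (pderiv H) x * d = a * (poly F' x + poly (pderiv F) x * d)
          - poly (monom b n) x * (poly M' x + poly (pderiv M) x * d)"
        using less.prems(2) M(2)
        by (simp add: H_def H'_def pderiv_diff pderiv_mult pderiv_monom poly_monom algebra_simps)
      ultimately show ?thesis using Md a0 by simp
    qed
  qed
  then show ?thesis by (intro exI[of _ d]) simp
qed

end

lemma deriv_graph_Union:
  assumes "subset.chain A \<C>" "\<C> \<noteq> {}" "\<And>G. G \<in> \<C> \<Longrightarrow> deriv_graph G"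
  shows "deriv_graph (\<Union>\<C>)"
proof -
  have two: "\<exists>G\<in>\<C>. u \<in> G \<and> v \<in> G" if uv: "u \<in> \<Union>\<C>" "v \<in> \<Union>\<C>" for u v
  proof -
    from uv obtain X Y where XY: "X \<in> \<C>" "Y \<in> \<C>" "u \<in> X" "v \<in> Y" by blast
    with assms(1) have "X \<subseteq> Y \<or> Y \<subseteq> X" by (auto simp: subset_chain_def)
    with XY show ?thesis by blast
  qed
  have "(a - b, a' - b') \<in> \<Union>\<C> \<and> (a * b, a * b' + a' * b) \<in> \<Union>\<C>"
    if ab: "(a, a') \<in> \<Union>\<C>" "(b, b') \<in> \<Union>\<C>" for a a' b b'
  proof -
    from two[OF ab] obtain G where "G \<in> \<C>" "(a, a') \<in> G" "(b, b') \<in> G" by blast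
    with graph_diff[OF assms(3)] graph_mult[OF assms(3)] show ?thesis by blast
  qed
  moreover have "(1, 0) \<in> \<Union>\<C>" using assms(2,3) graph_one by blast
  moreover have "c = 0" if "(0, c) \<in> \<Union>\<C>" for c using that assms(3) graph_unique0 by blast
  ultimately show ?thesis unfolding deriv_graph_def by blast
qed

text \<open>Zorn's lemma gives a maximal graph above \<open>G\<close>. It is defined everywhere,
  because a value at a missing point could be adjoined.\<close>

theorem derivation_extension:
  assumes "deriv_graph G"
  obtains D where "derivation D" "\<And>a a'. (a, a') \<in> G \<Longrightarrow> D a = a'"
proof -
  define \<A> where "\<A> = {H. deriv_graph H \<and> G \<subseteq> H}"
  have "\<exists>M\<in>\<A>. \<forall>X\<in>\<A>. M \<subseteq> X \<longrightarrow> X = M"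
  proof (rule subset_Zorn_nonempty)
    show "\<A> \<noteq> {}" using assms by (auto simp: \<A>_def)
    fix \<C> assume "\<C> \<noteq> {}" "subset.chain \<A> \<C>"
    then have "deriv_graph (\<Union>\<C>)"
      by (intro deriv_graph_Union[of \<A>]) (auto simp: \<A>_def subset_chain_def)
    moreover have "G \<subseteq> \<Union>\<C>"
      using \<open>\<C> \<noteq> {}\<close> \<open>subset.chain \<A> \<C>\<close> by (fastforce simp: \<A>_def subset_chain_def)
    ultimately show "\<Union>\<C> \<in> \<A>" by (simp add: \<A>_def)
  qed
  then obtain M where "M \<in> \<A>" and M_max: "\<forall>X\<in>\<A>. M \<subseteq> X \<longrightarrow> X = M"
    by (elim bexE)
  then have M: "deriv_graph M" "G \<subseteq> M" by (auto simp: \<A>_def)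
  then have max: "X = M" if "deriv_graph X" "M \<subseteq> X" for X
    using that M_max by (auto simp: \<A>_def)
  have total: "\<exists>d. (x, d) \<in> M" for x
  proof -
    obtain d where "\<forall>F F'. (\<forall>i. (coeff F i, coeff F' i) \<in> M) \<longrightarrow> poly F x = 0 \<longrightarrow> poly F' x + poly (pderiv F) x * d = 0"
      using ex_deriv_value[OF M(1)] by blast
    then have "deriv_graph (adjoin M x d)" "M \<subseteq> adjoin M x d" "(x, d) \<in> adjoin M x d"
      using deriv_graph_adjoin[OF M(1), of x d] by blast+
    with max show ?thesis by blast
  qed
  define D where "D x = (THE d. (x, d) \<in> M)" for x
  have D: "D x = d \<longleftrightarrow> (x, d) \<in> M" for x d
    unfolding D_def using total graph_unique[OF M(1)] by (metis the_equality)
  have DM: "(x, D x) \<in> M" for x using D by blast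
  have "derivation D"
    unfolding derivation_def using graph_add[OF M(1) DM DM] graph_mult[OF M(1) DM DM] by (simp add: D)
  moreover have "D a = a'" if "(a, a') \<in> G" for a a' using that M(2) D by blast
  ultimately show thesis using that by blast
qed

section \<open>Derivations of the reals with prescribed values at independent numbers\<close>

lemma ex_map_poly:
  assumes "ev 0 = 0" "\<And>i. coeff F i \<in> range ev"
  shows "\<exists>f. F = map_poly ev f"
  using assms(2)
proof (induction F)
  case 0
  then show ?case by (intro exI[of _ 0]) simp
next
  case (pCons a F)
  from pCons.prems[of 0] obtain c where c: "ev c = a" by auto
  have "coeff F i \<in> range ev" for i using pCons.prems[of "Suc i"] by simp
  with pCons.IH obtain f where "F = map_poly ev f" by blast
  with c show ?case by (intro exI[of _ "pCons c f"]) (simp add: map_poly_pCons assms(1))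
qed

text \<open>For transcendental \<open>x\<close> well-definedness is vacuous, so \<open>d\<close> is
  arbitrary. The last conclusion has the same shape as the assumption on \<open>Domain G\<close>,
  which lets the lemma be iterated.\<close>

lemma adjoin_transcendental:
  fixes ev :: "'c::comm_ring_1 \<Rightarrow> 'a::field_char_0"
  assumes G: "deriv_graph G" and ev: "ev 0 = 0" and dom: "Domain G \<subseteq> range ev"
    and trans: "\<And>f. poly (map_poly ev f) x = 0 \<Longrightarrow> f = 0"
  shows "deriv_graph (adjoin G x d)" "G \<subseteq> adjoin G x d" "(x, d) \<in> adjoin G x d"
    "Domain (adjoin G x d) \<subseteq> range (\<lambda>f. poly (map_poly ev f) x)"
proof -
  have ex: "\<exists>f. F = map_poly ev f" if "\<And>i. (coeff F i, coeff F' i) \<in> G" for F F'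
    by (rule ex_map_poly) (use that dom ev in blast)+
  have "poly F' x + poly (pderiv F) x * d = 0"
    if *: "\<And>i. (coeff F i, coeff F' i) \<in> G" "poly F x = 0" for F F'
  proof -
    from ex[OF *(1)] obtain f where f: "F = map_poly ev f" by blast
    with *(2) trans have "f = 0" by blast
    with f have F: "F = 0" by simp
    have "coeff F' i = 0" for i using *(1)[of i] graph_unique0[OF G] F by simp
    then have "F' = 0" by (simp add: poly_eq_iff)
    with F show ?thesis by simp
  qed
  from deriv_graph_adjoin[OF G this]
  show "deriv_graph (adjoin G x d)" "G \<subseteq> adjoin G x d" "(x, d) \<in> adjoin G x d" by blast+
  show "Domain (adjoin G x d) \<subseteq> range (\<lambda>f. poly (map_poly ev f) x)"
    unfolding adjoin_def using ex by blast
qed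

lemma poly_poly_const: "poly (poly q [:b:]) a = poly (map_poly (\<lambda>s. poly s a) q) b"
  by (induction q) (simp_all add: map_poly_pCons)

lemma eval2_poly_const: "eval2 (poly p [:[:c:]:]) a b = poly (map_poly (\<lambda>r. eval2 r a b) p) c"
  by (induction p) (simp_all add: map_poly_pCons eval2_def)

text \<open>Starting from the zero derivation on the rationals, \<open>a\<close>, \<open>b\<close>,
  \<open>c\<close> are adjoined one after another with free values; the result then extends to all
  reals.\<close>

theorem ex_derivation_real:
  fixes a b c :: real
  assumes ind: "rat_alg_indep3 a b c"
  obtains D :: "real \<Rightarrow> real" where "derivation D" "D a = a'" "D b = b'" "D c = c'"
proof -
  \<comment> \<open>Successive evaluations at \<open>a\<close>, \<open>b\<close>, \<open>c\<close>.
    Constant polynomials turn joint independence into the three transcendence facts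
    \<open>t3\<close>, \<open>t2\<close>, \<open>t1\<close>.\<close>
  define e1 where "e1 = (\<lambda>f. poly (map_poly of_rat f) a)"
  define e2 where "e2 = (\<lambda>f. poly (map_poly e1 f) b)"
  define e3 where "e3 = (\<lambda>f. poly (map_poly e2 f) c)"
  have e1_0: "e1 0 = 0" and e2_0: "e2 0 = 0" by (simp_all add: e1_def e2_def)
  have e2: "eval2 (map_poly (map_poly of_rat) f) a b = e2 f" for f
    unfolding eval2_def poly_poly_const e2_def e1_def by (simp add: map_poly_map_poly o_def)
  have e3: "eval3 (map_poly (map_poly (map_poly of_rat)) f) a b c = e3 f" for f
    unfolding eval3_def eval2_poly_const e3_def by (simp add: map_poly_map_poly o_def e2 e2_0 eval2_def[of 0])
  have t3: "f = 0" if "e3 f = 0" for f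
    using ind that e3 unfolding rat_alg_indep3_def by metis
  have t2: "f = 0" if "e2 f = 0" for f
  proof -
    have "e3 [:f:] = 0" using that by (simp add: e3_def map_poly_pCons e2_0)
    from t3[OF this] show ?thesis by simp
  qed
  have t1: "f = 0" if "e1 f = 0" for f
  proof -
    have "e2 [:f:] = 0" using that by (simp add: e2_def map_poly_pCons e1_0)
    from t2[OF this] show ?thesis by simp
  qed
  define G0 :: "(real \<times> real) set" where "G0 = {(of_rat r, 0) |r. True}"
  have "(of_rat r - of_rat s, 0) \<in> G0" "(of_rat r * of_rat s, 0) \<in> G0" "(1, 0) \<in> G0" for r s
    unfolding G0_def by (auto simp flip: of_rat_diff of_rat_mult intro: exI[of _ 1])
  then have G0: "deriv_graph G0"
    unfolding deriv_graph_def by (auto simp: G0_def)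
  have "Domain G0 \<subseteq> range of_rat" by (auto simp: G0_def)
  note s1 = adjoin_transcendental[where ev = of_rat and x = a and d = a', OF G0 of_rat_0 this t1[unfolded e1_def], folded e1_def]
  note s2 = adjoin_transcendental[where ev = e1 and x = b and d = b', OF s1(1) e1_0 s1(4) t2[unfolded e2_def], folded e2_def]
  note s3 = adjoin_transcendental[where ev = e2 and x = c and d = c', OF s2(1) e2_0 s2(4) t3[unfolded e3_def], folded e3_def]
  obtain D where D: "derivation D" "\<And>u u'. (u, u') \<in> adjoin (adjoin (adjoin G0 a a') b b') c c' \<Longrightarrow> D u = u'"
    using derivation_extension[OF s3(1)] by blast
  show thesis using that[OF D(1)] D(2) s1(3) s2(2,3) s3(2,3) by blast
qed

section \<open>The Cassels--Pfister theorem\<close>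

lemma degree_less_double:
  fixes r :: "'k::field poly"
  assumes "r = 0 \<or> degree r < n" "degree c \<le> 1" "0 < n"
  shows "degree (c * r\<^sup>2) < 2 * n"
proof (cases "r = 0")
  case False
  with assms have "degree r < n" by blast
  moreover have "degree (c * r\<^sup>2) \<le> 1 + 2 * degree r"
    using degree_mult_le[of c "r\<^sup>2"] degree_power_le[of r 2] assms(2) by linarith
  ultimately show ?thesis by linarith
qed (use assms in simp)

text \<open>The second intersection of the quadric with the line through \<open>(u, v, w) / d\<close> and its integral
  part has a denominator of smaller degree.\<close>
theorem cassels_pfister:
  fixes c N d u v w :: "'k::field poly"
  assumes c: "degree c \<le> 1"
    and aniso: "\<And>u v w. u\<^sup>2 + v\<^sup>2 + c * w\<^sup>2 = 0 \<Longrightarrow> u = 0 \<and> v = 0 \<and> w = 0"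
    and "d \<noteq> 0" "d\<^sup>2 * N = u\<^sup>2 + v\<^sup>2 + c * w\<^sup>2"
  shows "\<exists>u v w. N = u\<^sup>2 + v\<^sup>2 + c * w\<^sup>2"
  using assms(3,4)
proof (induction "degree d" arbitrary: d u v w rule: less_induct)
  case less
  define q1 q2 q3 r1 r2 r3 where qr: "q1 = u div d" "q2 = v div d" "q3 = w div d"
    "r1 = u mod d" "r2 = v mod d" "r3 = w mod d"
  have u: "u = d * q1 + r1" and v: "v = d * q2 + r2" and w: "w = d * q3 + r3"
    by (simp_all add: qr)
  define fq where "fq = q1\<^sup>2 + q2\<^sup>2 + c * q3\<^sup>2"
  define bq where "bq = q1 * r1 + q2 * r2 + c * (q3 * r3)"
  define fr where "fr = r1\<^sup>2 + r2\<^sup>2 + c * r3\<^sup>2"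
  \<comment> \<open>The new denominator. Here \<open>fq\<close>, \<open>fr\<close> are the values of
    the form at the integral and remainder parts and \<open>bq\<close> is its polar value; the
    equation makes \<open>fr\<close> equal to \<open>d * d'\<close>.\<close>
  define d' where "d' = d * (N - fq) - 2 * bq"
  have eq: "d\<^sup>2 * N = d\<^sup>2 * fq + 2 * d * bq + fr"
    using less.prems(2) unfolding u v w fq_def bq_def fr_def by (simp add: algebra_simps power2_eq_square)
  then have fr: "fr = d * d'" by (simp add: d'_def algebra_simps power2_eq_square)
  show ?case
  proof (cases "r1 = 0 \<and> r2 = 0 \<and> r3 = 0")
    case True
    then have "d\<^sup>2 * N = d\<^sup>2 * fq" using eq by (simp add: bq_def fr_def)
    then show ?thesis using less.prems(1) unfolding fq_def by auto
  next
    case False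
    then have "fr \<noteq> 0" using aniso[of r1 r2 r3] unfolding fr_def by blast
    with fr have d': "d' \<noteq> 0" by auto
    have rdeg: "r = 0 \<or> degree r < degree d" if "r \<in> {r1, r2, r3}" for r
      using that degree_mod_less[OF less.prems(1)] unfolding qr by blast
    have "\<not> is_unit d" using False unfolding qr by (auto simp: unit_imp_mod_eq_0)
    then have pos: "0 < degree d" using less.prems(1) is_unit_iff_degree by blast
    \<comment> \<open>This is where \<open>degree c \<le> 1\<close> enters: the remainders have
      degree at most \<open>degree d - 1\<close>, so \<open>fr\<close> has degree below
      \<open>2 * degree d\<close>.\<close>
    have "degree (1 * r1\<^sup>2) < 2 * degree d" "degree (1 * r2\<^sup>2) < 2 * degree d" "degree (c * r3\<^sup>2) < 2 * degree d"
      by (rule degree_less_double; use rdeg pos c in simp)+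
    then have "degree fr < 2 * degree d"
      unfolding fr_def by (simp add: degree_add_less)
    moreover have "degree fr = degree d + degree d'"
      using fr less.prems(1) d' by (simp add: degree_mult_eq)
    ultimately have lt: "degree d' < degree d" by linarith
    \<comment> \<open>Numerators of the second intersection point; the factor \<open>d'\<close>
      splits off twice because \<open>fr = d * d'\<close>.\<close>
    have "(d' * q1 + (fq - N) * r1)\<^sup>2 + (d' * q2 + (fq - N) * r2)\<^sup>2 + c * (d' * q3 + (fq - N) * r3)\<^sup>2
        = d'\<^sup>2 * fq + 2 * d' * (fq - N) * bq + (fq - N)\<^sup>2 * fr"
      by (simp add: fq_def bq_def fr_def algebra_simps power2_eq_square)
    also have "\<dots> = d' * (d' * fq + (fq - N) * (2 * bq + d * (fq - N)))"
      by (simp add: fr algebra_simps power2_eq_square)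
    also have "2 * bq + d * (fq - N) = - d'" by (simp add: d'_def algebra_simps)
    also have "d' * (d' * fq + (fq - N) * - d') = d'\<^sup>2 * N" by (simp add: algebra_simps power2_eq_square)
    finally show ?thesis using less.hyps[OF lt d'] by metis
  qed
qed

section \<open>Derivations and prime multiplicities\<close>

context
  fixes D :: "'a::comm_ring_1 \<Rightarrow> 'a"
  assumes D: "derivation D"
begin

lemma der_add: "D (a + b) = D a + D b"
  and der_mult: "D (a * b) = a * D b + D a * b"
  using D unfolding derivation_def by blast+

lemma der_0: "D 0 = 0"
  using der_add[of 0 0] by simp

lemma der_1: "D 1 = 0"
  using der_mult[of 1 1] by simp

lemma der_minus: "D (- a) = - D a"
  using der_add[of a "- a"] der_0 by (simp add: eq_neg_iff_add_eq_0 add.commute)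

lemma der_diff: "D (a - b) = D a - D b"
  using der_add[of a "- b"] der_minus by simp

lemma der_of_nat: "D (of_nat n) = 0"
  by (induction n) (simp_all add: der_0 der_1 der_add)

lemma der_numeral: "D (numeral n) = 0"
  using der_of_nat[of "numeral n"] by simp

lemma der_sum: "D (sum f A) = (\<Sum>x\<in>A. D (f x))"
  by (induction A rule: infinite_finite_induct) (simp_all add: der_0 der_add)

lemma der_power: "D (a ^ n) = of_nat n * a ^ (n - 1) * D a"
proof (induction n)
  case (Suc n)
  then show ?case by (cases n) (simp_all add: der_mult algebra_simps)
qed (simp add: der_1)

lemma der_power2: "D (a\<^sup>2) = 2 * a * D a"
  using der_power[of a 2] by simp

lemma power_dvd_der:
  assumes "\<pi> ^ e dvd f"
  shows "\<pi> ^ (e - 1) dvd D f"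
proof -
  from assms obtain k where f: "f = \<pi> ^ e * k" by blast
  have "\<pi> ^ (e - 1) dvd \<pi> ^ e" by (rule le_imp_power_dvd) simp
  then show ?thesis unfolding f der_mult der_power by (intro dvd_add) (simp_all add: dvd_mult2)
qed

text \<open>When \<pi> divides its own derivative, the term from differentiating the power keeps all
  factors, so no multiplicity is lost.\<close>

lemma power_dvd_der_special:
  assumes "\<pi> ^ e dvd f" "\<pi> dvd D \<pi>"
  shows "\<pi> ^ e dvd D f"
proof (cases e)
  case (Suc n)
  from assms obtain k l where f: "f = \<pi> ^ e * k" and l: "D \<pi> = \<pi> * l" by blast
  have "D f = \<pi> ^ e * (D k + of_nat e * l * k)"
    unfolding f der_mult der_power l by (simp add: Suc algebra_simps)
  then show ?thesis by simp
qed simp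

end

text \<open>Differentiating \<open>c = \<pi> ^ j * k\<close> with \<open>k\<close> prime to \<pi>
  shows that \<pi> divides \<open>j * \<Delta> \<pi> * k\<close>; in characteristic 0 the number
  \<open>j\<close> is a unit.\<close>

lemma special_primeI:
  fixes \<Delta> :: "'a::{field_char_0,field_gcd} poly \<Rightarrow> 'a poly"
  assumes \<Delta>: "derivation \<Delta>" and c: "\<Delta> c = 0" "c \<noteq> 0" and \<pi>: "prime \<pi>" "\<pi> dvd c"
  shows "\<pi> dvd \<Delta> \<pi>"
proof -
  have "\<not> is_unit \<pi>" using \<pi>(1) by auto
  obtain k where k: "c = \<pi> ^ multiplicity \<pi> c * k" "\<not> \<pi> dvd k"
    using multiplicity_decompose'[OF c(2) \<open>\<not> is_unit \<pi>\<close>] by blast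
  define j where "j = multiplicity \<pi> c"
  have "j \<noteq> 0" using \<pi> c(2) by (simp add: j_def prime_multiplicity_gt_zero_iff)
  then obtain i where j: "j = Suc i" by (cases j) auto
  have "0 = \<Delta> (\<pi> ^ j * k)" using c(1) k(1) by (simp add: j_def)
  also have "\<dots> = \<pi> ^ i * (\<pi> * \<Delta> k + of_nat j * \<Delta> \<pi> * k)"
    unfolding der_mult[OF \<Delta>] der_power[OF \<Delta>] by (simp add: j algebra_simps)
  finally have "\<pi> * \<Delta> k + of_nat j * \<Delta> \<pi> * k = 0" using \<pi>(1) by auto
  then have "\<pi> dvd of_nat j * \<Delta> \<pi> * k"
    by (metis add.commute add_eq_0_iff dvd_minus_iff dvd_triv_left)
  then have "\<pi> dvd of_nat j \<or> \<pi> dvd \<Delta> \<pi> \<or> \<pi> dvd k"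
    using \<pi>(1) by (meson prime_dvd_multD)
  moreover have "\<not> \<pi> dvd of_nat j"
  proof
    assume "\<pi> dvd of_nat j"
    moreover have "is_unit (of_nat j :: 'a poly)"
      using \<open>j \<noteq> 0\<close> by (simp add: of_nat_poly is_unit_const_poly_iff dvd_field_iff)
    ultimately show False using dvd_unit_imp_unit \<open>\<not> is_unit \<pi>\<close> by blast
  qed
  ultimately show ?thesis using k(2) by blast
qed

text \<open>Each prime divides at most two of the factors \<open>f1, f2, f3\<close>, so its multiplicity in \<open>r\<close> is at
  most the larger of their two multiplicities, and \<open>W\<close> inherits the latter from the factor.\<close>
lemma root_dvd:
  fixes r t f1 f2 f3 h W :: "'a::{field_char_0,field_gcd} poly"
  assumes r0: "r \<noteq> 0" and r: "r\<^sup>2 = t * f1 * f2 * f3"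
    and sp: "\<And>\<pi>. S \<pi> \<Longrightarrow> prime \<pi>"
    and R1: "\<And>\<pi> e. prime \<pi> \<Longrightarrow> \<pi> ^ e dvd f1 \<Longrightarrow> \<pi> ^ (e - 1) dvd W"
    and S1: "\<And>\<pi> e. S \<pi> \<Longrightarrow> \<pi> ^ e dvd f1 \<Longrightarrow> \<pi> ^ e dvd W"
    and R2: "\<And>\<pi> e. prime \<pi> \<Longrightarrow> \<pi> ^ e dvd f2 \<Longrightarrow> \<pi> ^ (e - 1) dvd W"
    and S2: "\<And>\<pi> e. S \<pi> \<Longrightarrow> \<pi> ^ e dvd f2 \<Longrightarrow> \<pi> ^ e dvd W"
    and R3: "\<And>\<pi> e. prime \<pi> \<Longrightarrow> \<not> \<pi> dvd h \<Longrightarrow> \<pi> ^ e dvd f3 \<Longrightarrow> \<pi> ^ (e - 1) dvd W"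
    and S3: "\<And>\<pi> e. S \<pi> \<Longrightarrow> \<not> \<pi> dvd h \<Longrightarrow> \<pi> ^ e dvd f3 \<Longrightarrow> \<pi> ^ e dvd W"
    and Ht: "\<And>\<pi>. prime \<pi> \<Longrightarrow> \<pi> dvd t \<Longrightarrow> S \<pi> \<and> \<not> \<pi>\<^sup>2 dvd t \<and>
               \<not> (\<pi> dvd f1 \<and> \<pi> dvd f2) \<and> \<not> (\<pi> dvd f1 \<and> \<pi> dvd f3) \<and> \<not> (\<pi> dvd f2 \<and> \<pi> dvd f3)"
    and H12: "\<And>\<pi>. prime \<pi> \<Longrightarrow> \<pi> dvd f1 \<Longrightarrow> \<pi> dvd f2 \<Longrightarrow> S \<pi> \<and> \<not> \<pi> dvd f3"
    and H13: "\<And>\<pi>. prime \<pi> \<Longrightarrow> \<pi> dvd f1 \<Longrightarrow> \<pi> dvd f3 \<Longrightarrow> S \<pi> \<and> \<not> \<pi> dvd f2"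
    and H23: "\<And>\<pi>. prime \<pi> \<Longrightarrow> \<pi> dvd f2 \<Longrightarrow> \<pi> dvd f3 \<Longrightarrow> S \<pi> \<and> \<not> \<pi> dvd f1"
    and Hh: "\<And>\<pi>. prime \<pi> \<Longrightarrow> \<pi> dvd f3 \<Longrightarrow> \<pi> dvd h \<Longrightarrow>
               \<not> \<pi> dvd t \<and> \<not> \<pi> dvd f1 \<and> \<not> \<pi> dvd f2 \<and> \<not> \<pi>\<^sup>2 dvd f3"
  shows "r dvd W"
proof (cases "W = 0")
  case False
  have nz: "t \<noteq> 0" "f1 \<noteq> 0" "f2 \<noteq> 0" "f3 \<noteq> 0" using r r0 by auto
  show ?thesis
  proof (rule multiplicity_le_imp_dvd[OF r0])
    fix \<pi> :: "'a poly" assume \<pi>: "prime \<pi>"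
    then have nu: "\<not> is_unit \<pi>" and pe: "prime_elem \<pi>" by auto
    define n where "n = multiplicity \<pi> r"
    define k where "k f = multiplicity \<pi> f" for f
    have "multiplicity \<pi> (r\<^sup>2) = k t + k f1 + k f2 + k f3"
      unfolding r k_def using nz pe by (simp add: prime_elem_multiplicity_mult_distrib)
    then have n: "2 * n = k t + k f1 + k f2 + k f3"
      using pe r0 by (simp add: n_def prime_elem_multiplicity_power_distrib)
    have "\<not> \<pi> dvd f \<Longrightarrow> k f = 0" for f by (simp add: k_def not_dvd_imp_multiplicity_0)
    note k0 = this[of t] this[of f1] this[of f2] this[of f3]
    have k1: "f \<noteq> 0 \<Longrightarrow> \<not> \<pi>\<^sup>2 dvd f \<Longrightarrow> k f \<le> 1" for f
      using power_dvd_iff_le_multiplicity[of f \<pi> 2] nu by (auto simp: k_def)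
    have kd: "\<pi> ^ k f dvd f" for f by (simp add: k_def multiplicity_dvd)
    have "\<exists>i. \<pi> ^ i dvd W \<and> n \<le> i"
    proof (cases "n = 0")
      case True
      then show ?thesis by (intro exI[of _ 0]) simp
    next
      case n0: False
      \<comment> \<open>With two of \<open>f1, f2, f3\<close> divisible, \<open>n\<close> is at most
        the larger multiplicity and \<open>S\<close> loses nothing. With one, its multiplicity is
        \<open>2 * n\<close>, which leaves room to lose one. If \<pi> divides \<open>t\<close>, the
        single extra factor is absorbed since \<open>n > 0\<close>.\<close>
      consider "\<pi> dvd t" | "\<not> \<pi> dvd t" "\<pi> dvd f1" "\<pi> dvd f2" | "\<not> \<pi> dvd t" "\<pi> dvd f1" "\<pi> dvd f3"
        | "\<not> \<pi> dvd t" "\<pi> dvd f2" "\<pi> dvd f3" | "\<not> \<pi> dvd t" "\<not> \<pi> dvd f2" "\<not> \<pi> dvd f3"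
        | "\<not> \<pi> dvd t" "\<not> \<pi> dvd f1" "\<not> \<pi> dvd f3" | "\<not> \<pi> dvd t" "\<not> \<pi> dvd f1" "\<not> \<pi> dvd f2"
        by blast
      then show ?thesis
      proof cases
        case 1
        note H = Ht[OF \<pi> 1]
        then have kt: "k t \<le> 1" using k1 nz by blast
        have nh: "\<not> (\<pi> dvd f3 \<and> \<pi> dvd h)" using Hh[OF \<pi>] 1 by blast
        consider "k f2 = 0" "k f3 = 0" | "k f1 = 0" "k f3 = 0" | "k f1 = 0" "k f2 = 0"
          using H k0 by auto
        then show ?thesis
        proof cases
          case 1
          then show ?thesis using S1[OF _ kd] H n kt n0 by (intro exI[of _ "k f1"]) auto
        next
          case 2
          then show ?thesis using S2[OF _ kd] H n kt n0 by (intro exI[of _ "k f2"]) auto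
        next
          case 3
          then have "k f3 \<noteq> 0" using n kt n0 by linarith
          then have "\<not> \<pi> dvd h" using nh k0 by auto
          with 3 show ?thesis using S3[OF _ _ kd] H n kt n0 by (intro exI[of _ "k f3"]) auto
        qed
      next
        case 2
        note H = H12[OF \<pi> 2(2,3)]
        then have "2 * n \<le> 2 * max (k f1) (k f2)" using n k0 2 by auto
        moreover have "\<pi> ^ max (k f1) (k f2) dvd W" using S1[OF _ kd] S2[OF _ kd] H by (simp add: max_def)
        ultimately show ?thesis by auto
      next
        case 3
        note H = H13[OF \<pi> 3(2,3)]
        then have "\<not> \<pi> dvd h" using Hh[OF \<pi>] 3 by blast
        moreover have "2 * n \<le> 2 * max (k f1) (k f3)" using n k0 3 H by auto
        moreover have "\<pi> ^ max (k f1) (k f3) dvd W" using S1[OF _ kd] S3[OF _ _ kd] H calculation(1) by (simp add: max_def)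
        ultimately show ?thesis by auto
      next
        case 4
        note H = H23[OF \<pi> 4(2,3)]
        then have "\<not> \<pi> dvd h" using Hh[OF \<pi>] 4 by blast
        moreover have "2 * n \<le> 2 * max (k f2) (k f3)" using n k0 4 H by auto
        moreover have "\<pi> ^ max (k f2) (k f3) dvd W" using S2[OF _ kd] S3[OF _ _ kd] H calculation(1) by (simp add: max_def)
        ultimately show ?thesis by auto
      next
        case 5
        then show ?thesis using R1[OF \<pi> kd] n k0 n0 by (intro exI[of _ "k f1 - 1"]) auto
      next
        case 6
        then show ?thesis using R2[OF \<pi> kd] n k0 n0 by (intro exI[of _ "k f2 - 1"]) auto
      next
        case 7
        then have n3: "2 * n = k f3" using n k0 by auto
        have "\<not> \<pi> dvd h"
        proof
          assume "\<pi> dvd h"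
          moreover have "\<pi> dvd f3" using n3 n0 k0 by auto
          ultimately have "k f3 \<le> 1" using Hh[OF \<pi>] k1 nz by blast
          with n3 n0 show False by linarith
        qed
        then show ?thesis using R3[OF \<pi> _ kd] n3 n0 by (intro exI[of _ "k f3 - 1"]) auto
      qed
    qed
    then obtain i where "\<pi> ^ i dvd W" "n \<le> i" by blast
    then have "\<pi> ^ n dvd W" by (meson dvd_trans le_imp_power_dvd)
    then show "multiplicity \<pi> r \<le> multiplicity \<pi> W"
      using False nu by (simp add: n_def multiplicity_geI)
  qed
qed simp

section \<open>The derivation \<open>2 y D - d/dy\<close> on polynomials in \<open>y\<close> and its
  Wronskian\<close>

locale var_derivation =
  fixes D :: "'a::{field_char_0,field_gcd} \<Rightarrow> 'a" and \<theta> :: 'a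
  assumes D: "derivation D" and D_theta: "D \<theta> = 1"
begin

text \<open>Since \<open>D \<theta> = 1\<close>, the two terms cancel on
  \<open>y^2 + \<theta>\<close>, so polynomials in \<open>T\<close> with coefficients killed by
  \<open>D\<close> are constants.\<close>

definition del :: "'a poly \<Rightarrow> 'a poly" where
  "del p = [:0, 2:] * map_poly D p - pderiv p"

definition T :: "'a poly" where
  "T = [:\<theta>, 0, 1:]"

lemma map_poly_D_add: "map_poly D (p + q) = map_poly D p + map_poly D q"
  by (intro poly_eqI) (simp add: coeff_map_poly der_0[OF D] der_add[OF D])

lemma map_poly_D_mult: "map_poly D (p * q) = p * map_poly D q + map_poly D p * q"
  by (intro poly_eqI)
    (simp add: coeff_map_poly coeff_mult der_0[OF D] der_sum[OF D] der_mult[OF D] sum.distrib)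

lemma derivation_del: "derivation del"
  unfolding derivation_def del_def map_poly_D_add map_poly_D_mult
  by (simp add: pderiv_add pderiv_mult algebra_simps)

lemmas del_add = der_add[OF derivation_del]
  and del_mult = der_mult[OF derivation_del]
  and del_diff = der_diff[OF derivation_del]
  and del_minus = der_minus[OF derivation_del]
  and del_power2 = der_power2[OF derivation_del]
  and del_numeral = der_numeral[OF derivation_del]
  and del_0 = der_0[OF derivation_del]
  and del_1 = der_1[OF derivation_del]

lemma degree_del: "degree (del p) \<le> degree p + 1"
proof -
  have "degree ([:0, 2:] * map_poly D p) \<le> degree p + 1"
    using degree_mult_le[of "[:0, 2:]" "map_poly D p"] map_poly_degree_leq[of D p] by simp
  moreover have "degree (pderiv p) \<le> degree p + 1" by (simp add: degree_pderiv)
  ultimately show ?thesis unfolding del_def by (rule degree_diff_le)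
qed

text \<open>\<open>D\<close> kills the leading coefficient 1, so the factor \<open>y\<close> in
  \<open>del\<close> cannot raise the degree.\<close>

lemma degree_del_monic:
  assumes "lead_coeff q = 1"
  shows "degree (del q) \<le> degree q"
proof (rule degree_le, intro allI impI)
  fix i assume i: "degree q < i"
  then obtain j where j: "i = Suc j" "degree q \<le> j" by (cases i) auto
  have "coeff (map_poly D q) j = 0"
    using assms j(2) by (cases "j = degree q") (simp_all add: coeff_map_poly der_0[OF D] der_1[OF D] coeff_eq_0)
  moreover have "coeff (pderiv q) i = 0" using i by (simp add: coeff_pderiv coeff_eq_0)
  ultimately show "coeff (del q) i = 0" by (simp add: del_def j(1))
qed

lemma special_prime:
  assumes "del c = 0" "c \<noteq> 0" "prime \<pi>" "\<pi> dvd c"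
  shows "prime \<pi> \<and> \<pi> dvd del \<pi>"
  using special_primeI[OF derivation_del assms] assms(3) by blast

lemmas del_power_dvd = power_dvd_der[OF derivation_del]
  and del_power_dvd_special = power_dvd_der_special[OF derivation_del]

text \<open>The Wronskian, \<open>q^2\<close> times the derivative of \<open>p / q\<close>; it
  vanishes exactly when that fraction is constant.\<close>

definition W :: "'a poly \<Rightarrow> 'a poly \<Rightarrow> 'a poly" where
  "W p q = q * del p - p * del q"

lemma W_form: "del a = 0 \<Longrightarrow> W p q = q * del (p + a * q) - (p + a * q) * del q"
  by (simp add: W_def del_add del_mult algebra_simps)

text \<open>Transfers divisibility from the quadratic form to \<open>W\<close>, except at primes
  dividing the centre \<open>p + b * q\<close>. Those primes are the role of \<open>h\<close> in
  \<open>root_dvd\<close>.\<close>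

lemma W_quadratic:
  assumes "del b = 0" "del n = 0"
  shows "2 * ((p + b * q) * W p q) = q * del ((p + b * q)\<^sup>2 - n * q\<^sup>2) - 2 * (((p + b * q)\<^sup>2 - n * q\<^sup>2) * del q)"
proof -
  define h where "h = p + b * q"
  have "2 * (h * W p q) = q * del (h\<^sup>2 - n * q\<^sup>2) - 2 * ((h\<^sup>2 - n * q\<^sup>2) * del q)"
    unfolding W_form[OF assms(1), of p q] h_def[symmetric] del_diff del_power2 del_mult assms(2)
    by (simp add: algebra_simps power2_eq_square)
  then show ?thesis unfolding h_def .
qed

lemma W_form_dvd:
  assumes "del a = 0" "\<pi> ^ e dvd p + a * q"
  shows "\<pi> ^ (e - 1) dvd W p q" "\<pi> dvd del \<pi> \<Longrightarrow> \<pi> ^ e dvd W p q"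
proof -
  have "\<pi> ^ (e - 1) dvd \<pi> ^ e" by (rule le_imp_power_dvd) simp
  then have "\<pi> ^ (e - 1) dvd p + a * q" using assms(2) by (rule dvd_trans)
  then show "\<pi> ^ (e - 1) dvd W p q"
    unfolding W_form[OF assms(1), of p q] using del_power_dvd[OF assms(2)] by (simp add: dvd_mult dvd_mult2)
  assume "\<pi> dvd del \<pi>"
  then show "\<pi> ^ e dvd W p q"
    unfolding W_form[OF assms(1), of p q] using del_power_dvd_special[OF assms(2)] assms(2)
    by (simp add: dvd_mult dvd_mult2)
qed

lemma W_p_dvd:
  assumes "\<pi> ^ e dvd p"
  shows "\<pi> ^ (e - 1) dvd W p q" "\<pi> dvd del \<pi> \<Longrightarrow> \<pi> ^ e dvd W p q"
  using W_form_dvd[of 0 \<pi> e p q] assms by (simp_all add: del_0)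

lemma W_q_dvd:
  assumes "\<pi> ^ e dvd q"
  shows "\<pi> ^ (e - 1) dvd W p q" "\<pi> dvd del \<pi> \<Longrightarrow> \<pi> ^ e dvd W p q"
proof -
  have "W p q = - W q p" by (simp add: W_def)
  then show "\<pi> ^ (e - 1) dvd W p q" "\<pi> dvd del \<pi> \<Longrightarrow> \<pi> ^ e dvd W p q"
    using W_p_dvd[OF assms, of p] by simp_all
qed

lemma dvd_of_mult_prime_power:
  assumes "prime \<pi>" "\<not> \<pi> dvd h" "\<pi> ^ e dvd 2 * (h * w :: 'a poly)"
  shows "\<pi> ^ e dvd w"
proof -
  have "2 * (h * w) = smult 2 (h * w)" by (simp add: numeral_poly)
  then have "\<pi> ^ e dvd h * w" using assms(3) dvd_smult_cancel[of "\<pi> ^ e" "2 :: 'a" "h * w"] by auto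
  moreover have "coprime (\<pi> ^ e) h"
    using assms(1,2) by (simp add: prime_imp_coprime)
  ultimately show ?thesis by (simp add: coprime_dvd_mult_right_iff)
qed

lemma W_quadratic_dvd:
  assumes dz: "del b = 0" "del n = 0" and \<pi>: "prime \<pi>" "\<not> \<pi> dvd p + b * q"
    and d: "\<pi> ^ e dvd (p + b * q)\<^sup>2 - n * q\<^sup>2"
  shows "\<pi> ^ (e - 1) dvd W p q" "\<pi> dvd del \<pi> \<Longrightarrow> \<pi> ^ e dvd W p q"
proof -
  have "\<pi> ^ (e - 1) dvd \<pi> ^ e" by (rule le_imp_power_dvd) simp
  then have "\<pi> ^ (e - 1) dvd (p + b * q)\<^sup>2 - n * q\<^sup>2" using d by (rule dvd_trans)
  then have "\<pi> ^ (e - 1) dvd 2 * ((p + b * q) * W p q)"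
    unfolding W_quadratic[OF dz] using del_power_dvd[OF d] by (simp add: dvd_mult dvd_mult2)
  then show "\<pi> ^ (e - 1) dvd W p q" by (rule dvd_of_mult_prime_power[OF \<pi>])
  assume "\<pi> dvd del \<pi>"
  then have "\<pi> ^ e dvd 2 * ((p + b * q) * W p q)"
    unfolding W_quadratic[OF dz] using del_power_dvd_special[OF d] d by (simp add: dvd_mult dvd_mult2)
  then show "\<pi> ^ e dvd W p q" by (rule dvd_of_mult_prime_power[OF \<pi>])
qed

section \<open>Common prime divisors of the linear and quadratic forms in \<open>p\<close> and
  \<open>q\<close>\<close>

definition apart :: "'a poly \<Rightarrow> 'a poly \<Rightarrow> bool" where
  "apart x y \<longleftrightarrow> (\<exists>u v c. c \<noteq> 0 \<and> u * x + v * y = [:c:])"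

lemma apartI: "u * x + v * y = [:c:] \<Longrightarrow> c \<noteq> 0 \<Longrightarrow> apart x y"
  unfolding apart_def by blast

lemma apartD: "apart x y \<Longrightarrow> prime \<pi> \<Longrightarrow> \<pi> dvd x \<Longrightarrow> \<pi> dvd y \<Longrightarrow> False"
proof -
  assume "apart x y" and \<pi>: "prime \<pi>" "\<pi> dvd x" "\<pi> dvd y"
  then obtain u v c where c: "c \<noteq> 0" "u * x + v * y = [:c:]" unfolding apart_def by blast
  then have "\<pi> dvd [:c:]" using \<pi> by (metis dvd_add dvd_mult)
  moreover have "is_unit [:c:]" using c(1) by (simp add: is_unit_const_poly_iff dvd_field_iff)
  ultimately show False using \<pi>(1) by (meson dvd_unit_imp_unit not_prime_unit)
qed

lemma not_square_dvd:
  fixes c s :: 'a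
  assumes "c \<noteq> 0" "s \<noteq> 0" "prime \<pi>"
  shows "\<not> \<pi>\<^sup>2 dvd [:c, 0, s:]"
proof
  assume "\<pi>\<^sup>2 dvd [:c, 0, s:]"
  then obtain k where k: "[:c, 0, s:] = \<pi> * (\<pi> * k)" unfolding power2_eq_square mult.assoc[symmetric] by (rule dvdE)
  then have 1: "\<pi> dvd [:c, 0, s:]" by simp
  have "pderiv [:c, 0, s:] = \<pi> * pderiv (\<pi> * k) + \<pi> * k * pderiv \<pi>"
    unfolding k pderiv_mult by (simp add: algebra_simps)
  then have 2: "\<pi> dvd pderiv [:c, 0, s:]" by simp
  have "apart [:c, 0, s:] (pderiv [:c, 0, s:])"
    \<comment> \<open>Subtracting \<open>y / 2\<close> times the derivative removes the quadratic
      term and leaves \<open>c\<close>.\<close>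
    by (rule apartI[of 1 _ "[:0, - 1 / 2:]" _ c]) (use assms in \<open>simp_all add: pderiv_pCons\<close>)
  from apartD[OF this assms(3) 1 2] show False .
qed

lemma linear_form_coprime:
  fixes p q :: "'a poly"
  assumes "coprime p q" "prime \<pi>" "\<pi> dvd p + a * q" shows "\<not> \<pi> dvd q"
proof
  assume q: "\<pi> dvd q"
  then have "\<pi> dvd p" using assms(3) by (metis dvd_add_left_iff dvd_mult)
  with q assms(1,2) show False by (meson coprime_common_divisor not_prime_unit)
qed

lemma dvd_cancel_q:
  fixes p q :: "'a poly"
  assumes "coprime p q" "prime \<pi>" "\<pi> dvd p + a * q" "\<pi> dvd g * q ^ k"
  shows "\<pi> dvd g"
  using linear_form_coprime[OF assms(1-3)] assms(2,4) prime_dvd_multD prime_dvd_power by blast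

lemma two_linear_dvd:
  fixes p q :: "'a poly"
  assumes "coprime p q" "prime \<pi>" "\<pi> dvd p + a * q" "\<pi> dvd p + b * q"
  shows "\<pi> dvd a - b"
proof (rule dvd_cancel_q[OF assms(1-3), of _ 1])
  have "(a - b) * q ^ 1 = (p + a * q) - (p + b * q)" by (simp add: algebra_simps)
  then show "\<pi> dvd (a - b) * q ^ 1" using assms(3,4) by (metis dvd_diff)
qed

text \<open>Substituting \<open>p = - a * q\<close> in the quadratic gives
  \<open>(b - a)^2 - n\<close> times \<open>q^2\<close>; this is the resultant of the two
  forms.\<close>

lemma linear_quadratic_dvd:
  fixes p q :: "'a poly"
  assumes "coprime p q" "prime \<pi>" "\<pi> dvd p + a * q" "\<pi> dvd (p + b * q)\<^sup>2 - n * q\<^sup>2"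
  shows "\<pi> dvd (b - a)\<^sup>2 - n"
proof (rule dvd_cancel_q[OF assms(1-3), of _ 2])
  have "((b - a)\<^sup>2 - n) * q\<^sup>2 = ((p + b * q)\<^sup>2 - n * q\<^sup>2) - (p + a * q) * (p + a * q + 2 * (b - a) * q)"
    by (simp add: algebra_simps power2_eq_square)
  then show "\<pi> dvd ((b - a)\<^sup>2 - n) * q\<^sup>2" using assms(3,4) by (metis dvd_diff dvd_mult2)
qed

lemma quadratic_q_dvd:
  fixes p q :: "'a poly"
  assumes "coprime p q" "prime \<pi>" "\<pi> dvd (p + b * q)\<^sup>2 - n * q\<^sup>2"
  shows "\<not> \<pi> dvd q"
proof
  assume q: "\<pi> dvd q"
  have "(p + b * q)\<^sup>2 = ((p + b * q)\<^sup>2 - n * q\<^sup>2) + (n * q) * q" by (simp add: power2_eq_square)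
  then have "\<pi> dvd (p + b * q)\<^sup>2" using q assms(3) by (metis dvd_add dvd_mult)
  then have "\<pi> dvd p + b * q" using assms(2) prime_dvd_power by blast
  with linear_form_coprime[OF assms(1,2)] q show False by blast
qed

lemma center_quadratic_dvd:
  fixes p q :: "'a poly"
  assumes "coprime p q" "prime \<pi>" "\<pi> dvd p + b * q" "\<pi> dvd (p + b * q)\<^sup>2 - n * q\<^sup>2"
  shows "\<pi> dvd n"
  using linear_quadratic_dvd[OF assms] by simp

text \<open>Modulo \<open>\<pi>^2\<close> the square of the centre disappears and only
  \<open>n * q^2\<close> remains, with \<open>q\<close> prime to \<pi>.\<close>

lemma center_quadratic_not_square_dvd:
  fixes p q :: "'a poly"
  assumes pq: "coprime p q" and \<pi>: "prime \<pi>" "\<pi> dvd p + b * q" and n: "\<not> \<pi>\<^sup>2 dvd n"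
  shows "\<not> \<pi>\<^sup>2 dvd (p + b * q)\<^sup>2 - n * q\<^sup>2"
proof
  assume d: "\<pi>\<^sup>2 dvd (p + b * q)\<^sup>2 - n * q\<^sup>2"
  moreover have "\<pi>\<^sup>2 dvd (p + b * q)\<^sup>2" using \<pi>(2) by (rule dvd_power_same)
  ultimately have "\<pi>\<^sup>2 dvd n * q\<^sup>2" using dvd_diff[of "\<pi>\<^sup>2" "(p + b * q)\<^sup>2" "(p + b * q)\<^sup>2 - n * q\<^sup>2"] by simp
  moreover have "coprime (\<pi>\<^sup>2) (q\<^sup>2)"
    using linear_form_coprime[OF pq \<pi>] \<pi>(1) by (simp add: prime_imp_coprime)
  ultimately have "\<pi>\<^sup>2 dvd n" by (simp add: coprime_dvd_mult_left_iff)
  with n show False by blast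
qed

text \<open>\<open>root_dvd\<close> with \<open>S\<close> the primes dividing their own derivative
  and \<open>h\<close> the centre. A prime common to the linear and the quadratic form divides the
  constant \<open>(b - a)^2 - n\<close>, hence lies in \<open>S\<close>; \<open>q\<close> is prime
  to both forms.\<close>

lemma W_root_dvd_q:
  assumes pq: "coprime p q" and r0: "r \<noteq> 0"
    and dz: "del a = 0" "del b = 0" "del n = 0" "del t = 0"
    and r: "r\<^sup>2 = t * q * (p + a * q) * ((p + b * q)\<^sup>2 - n * q\<^sup>2)"
    and t2: "\<And>\<pi>. prime \<pi> \<Longrightarrow> \<not> \<pi>\<^sup>2 dvd t" and n2: "\<And>\<pi>. prime \<pi> \<Longrightarrow> \<not> \<pi>\<^sup>2 dvd n"
    and ap: "apart t ((b - a)\<^sup>2 - n)" "apart t n" "apart n ((b - a)\<^sup>2 - n)"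
    and nz: "(b - a)\<^sup>2 - n \<noteq> 0"
  shows "r dvd W p q"
proof (rule root_dvd[OF r0 r, where S = "\<lambda>\<pi>. prime \<pi> \<and> \<pi> dvd del \<pi>" and h = "p + b * q"])
  have t0: "t \<noteq> 0" using r r0 by auto
  fix \<pi> :: "'a poly" assume \<pi>: "prime \<pi>"
  note lc = linear_form_coprime[OF pq \<pi>]
  note lq = linear_quadratic_dvd[OF pq \<pi>]
  note qq = quadratic_q_dvd[OF pq \<pi>]
  show "(prime \<pi> \<and> \<pi> dvd del \<pi>) \<and> \<not> \<pi>\<^sup>2 dvd t \<and> \<not> (\<pi> dvd q \<and> \<pi> dvd p + a * q) \<and>
      \<not> (\<pi> dvd q \<and> \<pi> dvd (p + b * q)\<^sup>2 - n * q\<^sup>2) \<and>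
      \<not> (\<pi> dvd p + a * q \<and> \<pi> dvd (p + b * q)\<^sup>2 - n * q\<^sup>2)" if "\<pi> dvd t"
    using special_prime[OF dz(4) t0 \<pi> that] t2[OF \<pi>] lc qq lq apartD[OF ap(1) \<pi> that] by blast
  show "(prime \<pi> \<and> \<pi> dvd del \<pi>) \<and> \<not> \<pi> dvd (p + b * q)\<^sup>2 - n * q\<^sup>2" if "\<pi> dvd q" "\<pi> dvd p + a * q"
    using that lc by blast
  show "(prime \<pi> \<and> \<pi> dvd del \<pi>) \<and> \<not> \<pi> dvd p + a * q" if "\<pi> dvd q" "\<pi> dvd (p + b * q)\<^sup>2 - n * q\<^sup>2"
    using that qq by blast
  show "(prime \<pi> \<and> \<pi> dvd del \<pi>) \<and> \<not> \<pi> dvd q" if "\<pi> dvd p + a * q" "\<pi> dvd (p + b * q)\<^sup>2 - n * q\<^sup>2"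
    using lq[OF that] special_prime[OF _ nz \<pi>] lc[OF that(1)] by (simp add: del_diff del_power2 dz)
  show "\<not> \<pi> dvd t \<and> \<not> \<pi> dvd q \<and> \<not> \<pi> dvd p + a * q \<and> \<not> \<pi>\<^sup>2 dvd (p + b * q)\<^sup>2 - n * q\<^sup>2"
    if h: "\<pi> dvd (p + b * q)\<^sup>2 - n * q\<^sup>2" "\<pi> dvd p + b * q"
  proof -
    have "\<pi> dvd n" by (rule center_quadratic_dvd[OF pq \<pi> h(2,1)])
    then show ?thesis
      using apartD[OF ap(2) \<pi>] apartD[OF ap(3) \<pi>] lc[OF h(2)] lq[OF _ h(1)]
        center_quadratic_not_square_dvd[OF pq \<pi> h(2) n2[OF \<pi>]] by blast
  qed
qed ((erule conjE)?, ((rule W_q_dvd W_form_dvd[OF dz(1)] W_quadratic_dvd[OF dz(2,3)]; assumption) | assumption))+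

text \<open>Now all three pairs of factors may share primes. Each shared prime divides one of the
  constants \<open>a\<close>, \<open>b^2 - n\<close>, \<open>(b - a)^2 - n\<close>, and the
  apartness hypotheses keep it away from the third factor.\<close>

lemma W_root_dvd_linear:
  assumes pq: "coprime p q" and r0: "r \<noteq> 0"
    and dz: "del a = 0" "del b = 0" "del n = 0" "del t = 0"
    and r: "r\<^sup>2 = t * p * (p + a * q) * ((p + b * q)\<^sup>2 - n * q\<^sup>2)"
    and t2: "\<And>\<pi>. prime \<pi> \<Longrightarrow> \<not> \<pi>\<^sup>2 dvd t" and n2: "\<And>\<pi>. prime \<pi> \<Longrightarrow> \<not> \<pi>\<^sup>2 dvd n"
    and ap: "apart t a" "apart t (b\<^sup>2 - n)" "apart t ((b - a)\<^sup>2 - n)" "apart t n"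
      "apart n (b\<^sup>2 - n)" "apart n ((b - a)\<^sup>2 - n)" "apart a (b\<^sup>2 - n)" "apart a ((b - a)\<^sup>2 - n)"
    and nz: "a \<noteq> 0" "b\<^sup>2 - n \<noteq> 0" "(b - a)\<^sup>2 - n \<noteq> 0"
  shows "r dvd W p q"
proof (rule root_dvd[OF r0 r, where S = "\<lambda>\<pi>. prime \<pi> \<and> \<pi> dvd del \<pi>" and h = "p + b * q"])
  have t0: "t \<noteq> 0" using r r0 by auto
  fix \<pi> :: "'a poly" assume \<pi>: "prime \<pi>"
  note lq = linear_quadratic_dvd[OF pq \<pi>]
  have lq0: "\<pi> dvd b\<^sup>2 - n" if "\<pi> dvd p" "\<pi> dvd (p + b * q)\<^sup>2 - n * q\<^sup>2"
    using lq[of 0 b n] that by simp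
  have ll: "\<pi> dvd a" if "\<pi> dvd p" "\<pi> dvd p + a * q"
    using two_linear_dvd[OF pq \<pi>, of a 0] that by simp
  have sp: "del g = 0 \<Longrightarrow> g \<noteq> 0 \<Longrightarrow> \<pi> dvd g \<Longrightarrow> prime \<pi> \<and> \<pi> dvd del \<pi>" for g
    using special_prime[OF _ _ \<pi>] by blast
  note ad = apartD[OF ap(1) \<pi>] apartD[OF ap(2) \<pi>] apartD[OF ap(3) \<pi>] apartD[OF ap(4) \<pi>]
    apartD[OF ap(5) \<pi>] apartD[OF ap(6) \<pi>] apartD[OF ap(7) \<pi>] apartD[OF ap(8) \<pi>]
  show "(prime \<pi> \<and> \<pi> dvd del \<pi>) \<and> \<not> \<pi>\<^sup>2 dvd t \<and> \<not> (\<pi> dvd p \<and> \<pi> dvd p + a * q) \<and>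
      \<not> (\<pi> dvd p \<and> \<pi> dvd (p + b * q)\<^sup>2 - n * q\<^sup>2) \<and>
      \<not> (\<pi> dvd p + a * q \<and> \<pi> dvd (p + b * q)\<^sup>2 - n * q\<^sup>2)" if "\<pi> dvd t"
    using special_prime[OF dz(4) t0 \<pi> that] t2[OF \<pi>] ll lq lq0 ad(1-3)[OF that] by blast
  show "(prime \<pi> \<and> \<pi> dvd del \<pi>) \<and> \<not> \<pi> dvd (p + b * q)\<^sup>2 - n * q\<^sup>2" if "\<pi> dvd p" "\<pi> dvd p + a * q"
    using sp[OF dz(1) nz(1) ll[OF that]] lq0[OF that(1)] ad(7)[OF ll[OF that]] by blast
  show "(prime \<pi> \<and> \<pi> dvd del \<pi>) \<and> \<not> \<pi> dvd p + a * q" if "\<pi> dvd p" "\<pi> dvd (p + b * q)\<^sup>2 - n * q\<^sup>2"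
    using sp[OF _ nz(2) lq0[OF that]] ll[OF that(1)] ad(7)[OF _ lq0[OF that]]
    by (auto simp add: del_diff del_power2 dz)
  show "(prime \<pi> \<and> \<pi> dvd del \<pi>) \<and> \<not> \<pi> dvd p" if "\<pi> dvd p + a * q" "\<pi> dvd (p + b * q)\<^sup>2 - n * q\<^sup>2"
    using sp[OF _ nz(3) lq[OF that]] ll[OF _ that(1)] ad(8)[OF _ lq[OF that]]
    by (auto simp add: del_diff del_power2 dz)
  show "\<not> \<pi> dvd t \<and> \<not> \<pi> dvd p \<and> \<not> \<pi> dvd p + a * q \<and> \<not> \<pi>\<^sup>2 dvd (p + b * q)\<^sup>2 - n * q\<^sup>2"
    if h: "\<pi> dvd (p + b * q)\<^sup>2 - n * q\<^sup>2" "\<pi> dvd p + b * q"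
  proof -
    have "\<pi> dvd n" by (rule center_quadratic_dvd[OF pq \<pi> h(2,1)])
    then show ?thesis
      using ad(4)[of] ad(5,6)[OF \<open>\<pi> dvd n\<close>] lq[OF _ h(1)] lq0[OF _ h(1)]
        center_quadratic_not_square_dvd[OF pq \<pi> h(2) n2[OF \<pi>]] by blast
  qed
qed ((erule conjE)?, ((rule W_p_dvd W_form_dvd[OF dz(1)] W_quadratic_dvd[OF dz(2,3)]; assumption) | assumption))+

text \<open>Adding a constant multiple of \<open>q\<close> to \<open>p\<close> does not change
  \<open>W\<close>, so \<open>W\<close> can be bounded through whichever linear form has the
  smallest degree.\<close>

lemma degree_W_le: "del a = 0 \<Longrightarrow> degree (W p q) \<le> degree (p + a * q) + degree q + 1"
proof -
  assume a: "del a = 0"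
  have "degree (q * del (p + a * q)) \<le> degree (p + a * q) + degree q + 1"
    using degree_mult_le[of q "del (p + a * q)"] degree_del[of "p + a * q"] by linarith
  moreover have "degree ((p + a * q) * del q) \<le> degree (p + a * q) + degree q + 1"
    using degree_mult_le[of "p + a * q" "del q"] degree_del[of q] by linarith
  ultimately show ?thesis unfolding W_form[OF a, of p q] by (rule degree_diff_le)
qed

text \<open>The two forms differ by \<open>(a - b) * q\<close>, of degree
  \<open>degree q + 2\<close>; the cases compare this with their own degrees.\<close>

lemma degree_linear_forms:
  fixes a b p q :: "'a poly"
  assumes "degree (a - b) = 2" "q \<noteq> 0"
  shows "degree (p + a * q) = degree (p + b * q) \<and> degree q + 2 \<le> degree (p + a * q) \<or>
         degree (p + a * q) < degree (p + b * q) \<and> degree (p + b * q) = degree q + 2 \<or>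
         degree (p + b * q) < degree (p + a * q) \<and> degree (p + a * q) = degree q + 2"
proof -
  have eq: "(p + a * q) - (p + b * q) = (a - b) * q" by (simp add: algebra_simps)
  have d: "degree ((a - b) * q) = degree q + 2"
    using assms degree_mult_eq[of "a - b" q] by (cases "a - b = 0") auto
  consider "degree (p + a * q) = degree (p + b * q)" | "degree (p + a * q) < degree (p + b * q)"
    | "degree (p + b * q) < degree (p + a * q)" by linarith
  then show ?thesis
  proof cases
    case 1
    then have "degree ((p + a * q) - (p + b * q)) \<le> degree (p + a * q)" by (intro degree_diff_le) auto
    with 1 d eq show ?thesis by simp
  next
    case 2
    then have "degree ((p + a * q) - (p + b * q)) = degree (p + b * q)"
      using degree_add_eq_right[of "p + a * q" "- (p + b * q)"] by (simp only: degree_minus diff_conv_add_uminus)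
    with 2 d eq show ?thesis by simp
  next
    case 3
    then have "degree ((p + a * q) - (p + b * q)) = degree (p + a * q)"
      using degree_add_eq_left[of "- (p + b * q)" "p + a * q"] by (simp only: degree_minus diff_conv_add_uminus)
    with 3 d eq show ?thesis by simp
  qed
qed

end

section \<open>Square values force constancy\<close>

context var_derivation
begin

lemma W_eq_0_form: "del a = 0 \<Longrightarrow> p + a * q = 0 \<Longrightarrow> W p q = 0"
  by (simp add: W_form del_0)

lemma W_eq_0_quadratic:
  assumes "del b = 0" "del n = 0" "(p + b * q)\<^sup>2 - n * q\<^sup>2 = 0"
  shows "W p q = 0"
proof -
  have "(p + b * q) * W p q = 0" using W_quadratic[OF assms(1,2), of p q] assms(3) by (simp add: del_0)
  then show ?thesis using W_eq_0_form[OF assms(1)] by auto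
qed

lemma del_pCons2: "D s = 0 \<Longrightarrow> D c = s \<Longrightarrow> del [:c, 0, s:] = 0"
  by (simp add: del_def map_poly_pCons der_0[OF D] pderiv_pCons)

end

lemma degree_add_nonneg:
  fixes f g :: "'a::linordered_idom poly"
  assumes "lead_coeff f \<ge> 0" "lead_coeff g \<ge> 0"
  shows "degree f \<le> degree (f + g)" "degree g \<le> degree (f + g)"
proof -
  have "degree f \<le> degree (f + g) \<and> degree g \<le> degree (f + g)"
  proof (cases "degree f = degree g")
    case False
    then show ?thesis
      using degree_add_eq_left[of g f] degree_add_eq_right[of f g] by linarith
  next
    case True
    show ?thesis
    proof (cases "lead_coeff f + lead_coeff g = 0")
      case True
      then have "lead_coeff f = 0 \<and> lead_coeff g = 0" using assms by linarith
      then show ?thesis by simp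
    next
      case False
      then have "coeff (f + g) (degree f) \<noteq> 0" using True by simp
      then show ?thesis using True le_degree by metis
    qed
  qed
  then show "degree f \<le> degree (f + g)" "degree g \<le> degree (f + g)" by auto
qed

section \<open>Square values over the reals, with \<open>T = y^2 + \<theta>\<close>\<close>

locale real_case = var_derivation D \<theta> for D :: "real \<Rightarrow> real" and \<theta> +
  fixes \<kappa> \<beta> :: real
  assumes D_kappa: "D \<kappa> = 0" and D_beta: "D \<beta> = 0"
    and kappa: "0 < \<kappa>" "\<kappa> < 1 / 2" and beta: "1 / 2 < \<beta>"
begin

text \<open>The polynomial in \<open>\<xi>\<close> is \<open>- rt (\<xi> + ra) ((\<xi> + rb)\<^sup>2 - rn)\<close>; in terms of \<open>T\<close> the coefficients are
  \<open>rt = - 2 T\<close>, \<open>ra = (T + 1) / 2 + \<beta>\<close>, \<open>rb = T + \<beta>\<close>, \<open>rn = \<kappa>\<^sup>2 - T\<close>.\<close>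
definition "ra = [:(\<theta> + 1) / 2 + \<beta>, 0, 1 / 2:]"
definition "rb = [:\<theta> + \<beta>, 0, 1:]"
definition "rn = [:\<kappa>\<^sup>2 - \<theta>, 0, - 1:]"
definition "rt = [:- 2 * \<theta>, 0, - 2:]"

lemma D_half: "D (x / 2) = D x / 2"
  using der_mult[OF D, of 2 "x / 2"] der_numeral[OF D, of "num.Bit0 num.One"] by simp

lemma del_ra: "del ra = 0" and del_rb: "del rb = 0" and del_rn: "del rn = 0" and del_rt: "del rt = 0"
  unfolding ra_def rb_def rn_def rt_def
  by (rule del_pCons2; simp add: der_mult[OF D] D_half der_add[OF D] der_diff[OF D] der_1[OF D]
      der_minus[OF D] der_numeral[OF D] der_power2[OF D] D_kappa D_beta D_theta)+

text \<open>A number with nonzero derivative is nonzero.\<close>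

lemma theta_ne: "\<theta> \<noteq> 0" "\<kappa>\<^sup>2 - \<theta> \<noteq> 0"
proof -
  show "\<theta> \<noteq> 0" using D_theta der_0[OF D] by auto
  have "D (\<kappa>\<^sup>2 - \<theta>) \<noteq> 0" by (simp add: der_diff[OF D] der_power2[OF D] D_kappa D_theta)
  then show "\<kappa>\<^sup>2 - \<theta> \<noteq> 0" using der_0[OF D] by auto
qed

lemma kappa_bounds: "\<kappa>\<^sup>2 < 1 / 4" "\<kappa>\<^sup>2 < \<beta>\<^sup>2" "0 < \<kappa>\<^sup>2"
proof -
  show "\<kappa>\<^sup>2 < 1 / 4" using power_strict_mono[of \<kappa> "1/2" 2] kappa by (simp add: power2_eq_square)
  show "\<kappa>\<^sup>2 < \<beta>\<^sup>2" using power_strict_mono[of \<kappa> \<beta> 2] kappa beta by simp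
  show "0 < \<kappa>\<^sup>2" using kappa by simp
qed

text \<open>In this and the following Bezout identities all entries are polynomials in
  \<open>T\<close>. The constant is a nonzero multiple of the second entry at the root of the first;
  the bounds on \<kappa> and \<beta> keep it nonzero.\<close>

lemma apart_t_n: "apart rt rn"
  by (rule apartI[of 1 _ "[:-2:]" _ "- 2 * \<kappa>\<^sup>2"])
    (use kappa in \<open>simp_all add: rt_def rn_def\<close>)

lemma apart_t_g23: "apart rt ((rb - ra)\<^sup>2 - rn)"
  by (rule apartI[of "[:1 + \<theta> / 2, 0, 1 / 2:]" _ "[:4:]" _ "1 - 4 * \<kappa>\<^sup>2"])
    (use kappa_bounds in \<open>simp_all add: rt_def rn_def ra_def rb_def power2_eq_square field_simps\<close>)

lemma Bezout_ne: "(\<kappa>\<^sup>2 - 1)\<^sup>2 / 4 \<noteq> 0" "(\<kappa>\<^sup>2 + \<beta>)\<^sup>2 \<noteq> 0"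
  using kappa_bounds beta by (simp_all add: add_pos_pos less_imp_neq[symmetric])

lemma apart_n_g23: "apart rn ((rb - ra)\<^sup>2 - rn)"
  by (rule apartI[of "[:(\<theta> + \<kappa>\<^sup>2 + 2) / 4, 0, 1 / 4:]" _ "[:1:]" _ "(\<kappa>\<^sup>2 - 1)\<^sup>2 / 4"])
    (fact Bezout_ne | simp add: rn_def ra_def rb_def power2_eq_square field_simps)+

lemma apart_t_a: "apart rt ra"
  by (rule apartI[of "[:1 / 2:]" _ "[:2:]" _ "1 + 2 * \<beta>"])
    (use beta in \<open>simp_all add: rt_def ra_def field_simps\<close>)

lemma apart_t_g13: "apart rt (rb\<^sup>2 - rn)"
  by (rule apartI[of "[:(\<theta> + 2 * \<beta> + 1) / 2, 0, 1 / 2:]" _ "[:1:]" _ "\<beta>\<^sup>2 - \<kappa>\<^sup>2"])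
    (use kappa_bounds in \<open>simp_all add: rt_def rn_def rb_def power2_eq_square field_simps\<close>)

lemma apart_n_g13: "apart rn (rb\<^sup>2 - rn)"
  by (rule apartI[of "[:\<theta> + \<kappa>\<^sup>2 + 2 * \<beta> + 1, 0, 1:]" _ "[:1:]" _ "(\<kappa>\<^sup>2 + \<beta>)\<^sup>2"])
    (fact Bezout_ne | simp add: rn_def rb_def power2_eq_square field_simps)+

lemma apart_a_g13: "apart ra (rb\<^sup>2 - rn)"
  by (rule apartI[of "[:-2 * \<theta>, 0, -2:]" _ "[:1:]" _ "\<beta>\<^sup>2 - \<kappa>\<^sup>2"])
    (use kappa_bounds beta in \<open>simp_all add: rn_def ra_def rb_def power2_eq_square field_simps\<close>)

lemma apart_a_g23: "apart ra ((rb - ra)\<^sup>2 - rn)"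
  by (rule apartI[of "[:(2 * \<beta> - 1 - \<theta>) / 2, 0, -1 / 2:]" _ "[:1:]" _ "\<beta>\<^sup>2 - \<kappa>\<^sup>2"])
    (use kappa_bounds beta in \<open>simp_all add: rn_def ra_def rb_def power2_eq_square field_simps\<close>)

lemma rt_rn_square_free: "prime \<pi> \<Longrightarrow> \<not> \<pi>\<^sup>2 dvd rt" "prime \<pi> \<Longrightarrow> \<not> \<pi>\<^sup>2 dvd rn"
  unfolding rt_def rn_def by (rule not_square_dvd; use theta_ne in simp)+

lemma degree_parameters: "degree rt = 2" "degree ra = 2" "degree rb = 2" "degree (rb - ra) = 2" "degree (ra - rb) = 2"
  by (simp_all add: rt_def ra_def rb_def)

lemma g_ne_0: "ra \<noteq> 0" "rb\<^sup>2 - rn \<noteq> 0" "(rb - ra)\<^sup>2 - rn \<noteq> 0"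
  by (simp_all add: rt_def ra_def rb_def rn_def power2_eq_square)

text \<open>\<open>- rn = T - \<kappa>^2\<close> has leading coefficient 1, so the quadratic form is
  a sum of two terms with nonnegative leading coefficients, which cannot cancel.\<close>

lemma degree_quadratic:
  "degree (p + b * q) * 2 \<le> degree ((p + b * q)\<^sup>2 - rn * q\<^sup>2)"
  "q \<noteq> 0 \<Longrightarrow> degree q * 2 + 2 \<le> degree ((p + b * q)\<^sup>2 - rn * q\<^sup>2)"
proof -
  have eq: "(p + b * q)\<^sup>2 - rn * q\<^sup>2 = (p + b * q)\<^sup>2 + [:\<theta> - \<kappa>\<^sup>2, 0, 1:] * q\<^sup>2"
  proof -
    have "[:\<theta> - \<kappa>\<^sup>2, 0, 1:] = - rn" by (simp add: rn_def)
    then show ?thesis by simp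
  qed
  have l: "lead_coeff ((p + b * q)\<^sup>2) \<ge> 0" "lead_coeff ([:\<theta> - \<kappa>\<^sup>2, 0, 1:] * q\<^sup>2) \<ge> 0"
    unfolding lead_coeff_mult lead_coeff_power by simp_all
  show "degree (p + b * q) * 2 \<le> degree ((p + b * q)\<^sup>2 - rn * q\<^sup>2)"
    unfolding eq using degree_add_nonneg(1)[OF l] by (cases "p + b * q = 0") (simp_all add: degree_power_eq)
  assume "q \<noteq> 0"
  then have "degree ([:\<theta> - \<kappa>\<^sup>2, 0, 1:] * q\<^sup>2) = degree q * 2 + 2"
    by (subst degree_mult_eq) (simp_all add: degree_power_eq)
  then show "degree q * 2 + 2 \<le> degree ((p + b * q)\<^sup>2 - rn * q\<^sup>2)"
    unfolding eq using degree_add_nonneg(2)[OF l] by simp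
qed

text \<open>If \<open>W\<close> is nonzero, \<open>r\<close> divides it, so
  \<open>2 * degree r\<close> is at most \<open>2 * degree (W p q)\<close>. Summing the degrees of
  the factors of \<open>r^2\<close> gives strictly more, whichever linear form has the smaller
  degree.\<close>

lemma W_eq_0_first:
  assumes pq: "coprime p q" "q \<noteq> 0"
    and r: "r\<^sup>2 = rt * q * (p + ra * q) * ((p + rb * q)\<^sup>2 - rn * q\<^sup>2)"
  shows "W p q = 0"
proof (rule ccontr)
  assume W: "W p q \<noteq> 0"
  have rt0: "rt \<noteq> 0" by (simp add: rt_def)
  have L: "p + ra * q \<noteq> 0" using W_eq_0_form[OF del_ra] W by blast
  have M: "(p + rb * q)\<^sup>2 - rn * q\<^sup>2 \<noteq> 0" using W_eq_0_quadratic[OF del_rb del_rn] W by blast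
  have r0: "r \<noteq> 0" using r rt0 pq(2) L M by auto
  have "r dvd W p q"
    by (rule W_root_dvd_q[OF pq(1) r0 del_ra del_rb del_rn del_rt r])
      (fact rt_rn_square_free apart_t_n apart_t_g23 apart_n_g23 g_ne_0)+
  then have le: "degree r \<le> degree (W p q)" using W by (rule dvd_imp_degree_le)
  have "2 * degree r = degree (r\<^sup>2)" by (simp add: degree_power_eq r0)
  also have "\<dots> = 2 + degree q + degree (p + ra * q) + degree ((p + rb * q)\<^sup>2 - rn * q\<^sup>2)"
    unfolding r using rt0 pq(2) L M by (simp only: degree_mult_eq mult_eq_0_iff degree_parameters simp_thms)
  finally show False
    using le degree_W_le[OF del_ra, of p q] degree_W_le[OF del_rb, of p q] degree_W_le[OF del_0, of p q]
      degree_quadratic[of p rb q] degree_linear_forms[OF degree_parameters(5) pq(2), of p] pq(2)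
    by auto
qed

text \<open>The same degree count; \<open>p\<close> itself is now a third linear form to be compared
  with the other two.\<close>

lemma W_eq_0_second:
  assumes pq: "coprime p q" "q \<noteq> 0"
    and r: "r\<^sup>2 = rt * p * (p + ra * q) * ((p + rb * q)\<^sup>2 - rn * q\<^sup>2)"
  shows "W p q = 0"
proof (rule ccontr)
  assume W: "W p q \<noteq> 0"
  have rt0: "rt \<noteq> 0" by (simp add: rt_def)
  have p0: "p \<noteq> 0" using W_eq_0_form[OF del_0] W by auto
  have L: "p + ra * q \<noteq> 0" using W_eq_0_form[OF del_ra] W by blast
  have M: "(p + rb * q)\<^sup>2 - rn * q\<^sup>2 \<noteq> 0" using W_eq_0_quadratic[OF del_rb del_rn] W by blast
  have r0: "r \<noteq> 0" using r rt0 p0 L M by auto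
  have "r dvd W p q"
    by (rule W_root_dvd_linear[OF pq(1) r0 del_ra del_rb del_rn del_rt r])
      (fact rt_rn_square_free apart_t_a apart_t_g13 apart_t_g23 apart_t_n apart_n_g13 apart_n_g23
        apart_a_g13 apart_a_g23 g_ne_0)+
  then have le: "degree r \<le> degree (W p q)" using W by (rule dvd_imp_degree_le)
  have "2 * degree r = degree (r\<^sup>2)" by (simp add: degree_power_eq r0)
  also have "\<dots> = 2 + degree p + degree (p + ra * q) + degree ((p + rb * q)\<^sup>2 - rn * q\<^sup>2)"
    unfolding r using rt0 p0 L M by (simp only: degree_mult_eq mult_eq_0_iff degree_parameters simp_thms)
  finally show False
    using le degree_W_le[OF del_ra, of p q] degree_W_le[OF del_rb, of p q] degree_W_le[OF del_0, of p q]
      degree_quadratic[of p rb q] degree_linear_forms[OF degree_parameters(5) pq(2), of p]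
      degree_linear_forms[of ra 0 q p] degree_linear_forms[of rb 0 q p] pq(2)
    by (auto simp: degree_parameters)
qed

end

section \<open>Square values over the complex numbers\<close>

locale complex_case = var_derivation D \<theta> for D :: "complex \<Rightarrow> complex" and \<theta> +
  fixes \<kappa> :: complex
  assumes D_kappa: "D \<kappa> = 0" and kappa: "4 * \<kappa>\<^sup>2 \<noteq> 1"
begin

text \<open>Here \<open>T\<close> plays the part of \<open>X = x\<^sup>2 + \<beta>\<close>: \<open>ca = 2 X + 1\<close>, \<open>cb = ca / 2\<close> and \<open>cb\<^sup>2 - cn = X\<^sup>2 - \<kappa>\<^sup>2\<close>.\<close>
definition "ca = [:2 * \<theta> + 1, 0, 2:]"
definition "cb = [:\<theta> + 1 / 2, 0, 1:]"
definition "cn = [:\<theta> + 1 / 4 + \<kappa>\<^sup>2, 0, 1:]"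

lemma D_quarter: "D (1 / 2) = 0" "D (1 / 4) = 0"
  using der_mult[OF D, of 2 "1 / 2"] der_mult[OF D, of 4 "1 / 4"]
  by (simp_all add: der_numeral[OF D] der_1[OF D])

lemma del_ca: "del ca = 0" and del_cb: "del cb = 0" and del_cn: "del cn = 0"
  unfolding ca_def cb_def cn_def
  by (rule del_pCons2; simp add: der_mult[OF D] D_quarter der_add[OF D] der_1[OF D]
      der_numeral[OF D] der_power2[OF D] D_kappa D_theta)+

lemma cn_square_free: "prime \<pi> \<Longrightarrow> \<not> \<pi>\<^sup>2 dvd cn"
proof -
  have "D (\<theta> + 1 / 4 + \<kappa>\<^sup>2) = 1"
    by (simp add: der_add[OF D] der_power2[OF D] D_kappa D_theta D_quarter)
  then have "\<theta> + 1 / 4 + \<kappa>\<^sup>2 \<noteq> 0" using der_0[OF D] by auto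
  then show "prime \<pi> \<Longrightarrow> \<not> \<pi>\<^sup>2 dvd cn" unfolding cn_def by (rule not_square_dvd) simp_all
qed

text \<open>\<open>p\<close> and \<open>p + ca * q\<close> lie symmetrically about the centre, so
  both have the same resultant with the quadratic form.\<close>

lemma cb_cn: "(cb - ca)\<^sup>2 - cn = cb\<^sup>2 - cn"
proof -
  have "cb - ca = - cb" by (simp add: ca_def cb_def)
  then show ?thesis by (simp only: power2_minus)
qed

lemma apart_ca: "apart ca (cb\<^sup>2 - cn)"
  by (rule apartI[of "[:(1 - 2 * \<theta>) / 4, 0, - 1 / 2:]" _ "[:1:]" _ "1 / 4 - \<kappa>\<^sup>2"])
    (use kappa in \<open>simp_all add: ca_def cb_def cn_def power2_eq_square algebra_simps add_divide_distrib diff_divide_distrib\<close>)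

lemma apart_cn: "apart cn (cb\<^sup>2 - cn)"
proof (rule apartI[of "[:1 / 4 + \<kappa>\<^sup>2 - \<theta>, 0, - 1:]" _ "[:1:]" _ "(1 / 4 - \<kappa>\<^sup>2)\<^sup>2"])
  show "(1 / 4 - \<kappa>\<^sup>2)\<^sup>2 \<noteq> 0" using kappa by (auto simp: mult.commute)
qed (simp add: cb_def cn_def power2_eq_square algebra_simps add_divide_distrib diff_divide_distrib)

lemma apart_1: "apart 1 x"
  by (rule apartI[of 1 _ 0 _ 1]) simp_all

lemma degree_c: "degree ca = 2" "degree cb = 2" "degree (cb - ca) = 2" "degree (ca - cb) = 2"
  by (simp_all add: ca_def cb_def)

lemma c_ne_0: "ca \<noteq> 0" "cb\<^sup>2 - cn \<noteq> 0"
  by (simp_all add: ca_def cb_def cn_def power2_eq_square)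

lemma degree_cn: "q \<noteq> 0 \<Longrightarrow> degree (cn * q\<^sup>2) = 2 * degree q + 2"
  by (subst degree_mult_eq) (simp_all add: degree_power_eq cn_def)

text \<open>Without an order, the leading terms of \<open>(p + cb * q)^2\<close> and
  \<open>cn * q^2\<close> may cancel when their degrees agree. In that case \<open>W\<close> is
  bounded through the identity for the quadratic form.\<close>

lemma degree_W_quadratic:
  assumes "p + cb * q \<noteq> 0" "degree (p + cb * q) = degree q + 1" "W p q \<noteq> 0"
  shows "degree (W p q) \<le> degree ((p + cb * q)\<^sup>2 - cn * q\<^sup>2)"
proof -
  define M where "M = (p + cb * q)\<^sup>2 - cn * q\<^sup>2"
  have "degree (2 * ((p + cb * q) * W p q)) \<le> degree M + degree q + 1"
  proof -
    have "degree (q * del M) \<le> degree M + degree q + 1"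
      using degree_mult_le[of q "del M"] degree_del[of M] by linarith
    moreover have "degree (2 * (M * del q)) \<le> degree M + degree q + 1"
      using degree_mult_le[of M "del q"] degree_del[of q] degree_mult_le[of 2 "M * del q"] by simp
    ultimately show ?thesis unfolding W_quadratic[OF del_cb del_cn] M_def[symmetric] by (rule degree_diff_le)
  qed
  also have "degree (2 * ((p + cb * q) * W p q)) = degree q + 1 + degree (W p q)"
    using assms by (simp add: degree_mult_eq)
  finally show ?thesis unfolding M_def by simp
qed

lemma W_eq_0:
  assumes pq: "coprime p q" "q \<noteq> 0"
    and r: "r\<^sup>2 = p * (p + ca * q) * ((p + cb * q)\<^sup>2 - cn * q\<^sup>2)"
  shows "W p q = 0"
proof (rule ccontr)
  assume W: "W p q \<noteq> 0"
  define M where "M = (p + cb * q)\<^sup>2 - cn * q\<^sup>2"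
  have p0: "p \<noteq> 0" using W_eq_0_form[OF del_0] W by auto
  have L: "p + ca * q \<noteq> 0" using W_eq_0_form[OF del_ca] W by blast
  have h: "p + cb * q \<noteq> 0" using W_eq_0_form[OF del_cb] W by blast
  have M: "M \<noteq> 0" using W_eq_0_quadratic[OF del_cb del_cn] W by (auto simp: M_def)
  have r0: "r \<noteq> 0" using r p0 L M by (auto simp: M_def)
  have "r dvd W p q"
    by (rule W_root_dvd_linear[OF pq(1) r0 del_ca del_cb del_cn del_1, unfolded cb_cn])
      (use r cn_square_free apart_1 apart_cn apart_ca c_ne_0 in \<open>auto simp: power2_eq_square\<close>)
  then have le: "degree r \<le> degree (W p q)" using W by (rule dvd_imp_degree_le)
  have "2 * degree r = degree (r\<^sup>2)" by (simp add: degree_power_eq r0)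
  also have "\<dots> = degree p + degree (p + ca * q) + degree M"
    unfolding r M_def[symmetric] using p0 L M by (simp only: degree_mult_eq mult_eq_0_iff simp_thms)
  finally have d: "2 * degree r = degree p + degree (p + ca * q) + degree M" .
  have dh: "degree ((p + cb * q)\<^sup>2) = 2 * degree (p + cb * q)" by (simp add: degree_power_eq h)
  have M1: "degree M = 2 * degree (p + cb * q)" if "degree q + 2 \<le> degree (p + cb * q)"
    using that degree_add_eq_left[of "- (cn * q\<^sup>2)" "(p + cb * q)\<^sup>2"] dh degree_cn[OF pq(2)] by (simp add: M_def)
  have M2: "degree M = 2 * degree q + 2" if "degree (p + cb * q) \<le> degree q"
    using that degree_add_eq_right[of "(p + cb * q)\<^sup>2" "- (cn * q\<^sup>2)"] dh degree_cn[OF pq(2)] by (simp add: M_def)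
  have M3: "degree (W p q) \<le> degree M" if "degree (p + cb * q) = degree q + 1"
    using degree_W_quadratic[OF h that W] by (simp add: M_def)
  \<comment> \<open>In the middle case \<open>p\<close> and \<open>p + ca * q\<close> both have
    degree \<open>degree q + 2\<close>. One copy of \<open>degree (W p q)\<close> is bounded by
    \<open>degree M\<close>, the other by \<open>2 * degree q + 2\<close>.\<close>
  consider "degree (p + cb * q) \<le> degree q" | "degree (p + cb * q) = degree q + 1"
    | "degree q + 2 \<le> degree (p + cb * q)" by linarith
  then show False
    using le d M1 M2 M3 degree_W_le[OF del_ca, of p q] degree_W_le[OF del_cb, of p q]
      degree_W_le[OF del_0, of p q] degree_linear_forms[OF degree_c(4) pq(2), of p]
      degree_linear_forms[of ca 0 q p] degree_linear_forms[of cb 0 q p] pq(2)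
    by cases (auto simp: degree_c)
qed

end

section \<open>Constants of the derivation as fractions in \<open>T\<close>\<close>

definition even_poly :: "'a::zero poly \<Rightarrow> bool" where
  "even_poly p \<longleftrightarrow> (\<forall>i. odd i \<longrightarrow> coeff p i = 0)"

lemma even_poly_pcompose:
  fixes p :: "'a::comm_ring_1 poly"
  assumes "even_poly p"
  obtains h where "p = pcompose h [:\<theta>, 0, 1:]"
proof -
  have "\<exists>h. p = pcompose h [:0, 0, 1:]" using assms
  proof (induction "degree p" arbitrary: p rule: less_induct)
    case less
    show ?case
    proof (cases "degree p = 0")
      case True
      then obtain c where "p = [:c:]" by (rule degree_eq_zeroE)
      then show ?thesis by (intro exI[of _ "[:c:]"]) simp
    next
      case False
      obtain c d q where p: "p = pCons c (pCons d q)" by (metis pCons_cases)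
      have "d = 0" using less.prems by (auto simp: even_poly_def p dest: spec[of _ "Suc 0"])
      then have q0: "q \<noteq> 0" using False p by auto
      have "even_poly q" unfolding even_poly_def
      proof (intro allI impI)
        fix i :: nat assume "odd i"
        then have "coeff p (Suc (Suc i)) = 0" using less.prems by (auto simp: even_poly_def)
        then show "coeff q i = 0" by (simp add: p)
      qed
      moreover have "degree q < degree p" using q0 by (simp add: p)
      ultimately obtain h where "q = pcompose h [:0, 0, 1:]" using less.hyps by blast
      then have "p = pcompose (pCons c h) [:0, 0, 1:]" using \<open>d = 0\<close> by (simp add: p pcompose_pCons)
      then show ?thesis by blast
    qed
  qed
  then obtain h where "p = pcompose h [:0, 0, 1:]" by blast
  also have "\<dots> = pcompose (pcompose h [:- \<theta>, 1:]) [:\<theta>, 0, 1:]"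
    by (simp add: pcompose_assoc[symmetric] pcompose_pCons)
  finally show ?thesis by (rule that)
qed

context var_derivation
begin

text \<open>Comparing coefficients makes the linear coefficient 0 and expresses each coefficient
  through \<open>D\<close> of the one two places below.\<close>

lemma even_poly_of_del:
  assumes "del p = 0"
  shows "even_poly p"
proof -
  have rec: "coeff p (Suc (Suc j)) * of_nat (Suc (Suc j)) = 2 * D (coeff p j)" for j
  proof -
    have "coeff (del p) (Suc j) = 0" by (simp add: assms)
    then show ?thesis by (simp add: del_def coeff_map_poly der_0[OF D] coeff_pderiv algebra_simps)
  qed
  have "coeff p (Suc (2 * k)) = 0" for k
  proof (induction k)
    case 0
    have "coeff (del p) 0 = 0" by (simp add: assms)
    then show ?case by (simp add: del_def coeff_pderiv)
  next
    case (Suc k)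
    then show ?case using rec[of "Suc (2 * k)"] der_0[OF D] by (simp del: of_nat_Suc)
  qed
  then show ?thesis unfolding even_poly_def by (auto elim!: oddE)
qed

text \<open>Both the factor \<open>y\<close> and \<open>d/dy\<close> change sign under
  \<open>y \<mapsto> - y\<close>.\<close>

lemma del_reflect: "del (pcompose p [:0, - 1:]) = - pcompose (del p) [:0, - 1:]"
proof -
  have "map_poly D (pcompose p [:0, - 1:]) = pcompose (map_poly D p) [:0, - 1:]"
  proof (rule poly_eqI)
    fix i
    have "D ((- 1) ^ i) = 0" by (cases "even i") (simp_all add: der_1[OF D] der_minus[OF D])
    then show "coeff (map_poly D (pcompose p [:0, - 1:])) i = coeff (pcompose (map_poly D p) [:0, - 1:]) i"
      by (simp add: coeff_map_poly der_0[OF D] coeff_pcompose_linear der_mult[OF D])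
  qed
  then show ?thesis
    by (simp add: del_def pderiv_pcompose pcompose_diff pcompose_mult pcompose_smult pderiv_pCons pcompose_pCons)
qed

text \<open>If \<open>p / q\<close> is constant, then \<open>del\<close> multiplies \<open>p\<close> and \<open>q\<close> by the same factor, and it multiplies
  \<open>q(- y)\<close> by the negative of that factor; so \<open>p q(- y)\<close> and \<open>q q(- y)\<close> are constant, hence even.\<close>
lemma even_fraction:
  assumes pq: "coprime p q" "q \<noteq> 0" and W: "W p q = 0"
  obtains g n where "n \<noteq> 0" "p * n = g * q" "even_poly g" "even_poly n"
proof -
  \<comment> \<open>Making \<open>q\<close> monic keeps \<open>del\<close> from raising its degree,
    so the cofactor \<open>k\<close> below is a scalar and is unaffected by
    \<open>y \<mapsto> - y\<close>.\<close>
  define c where "c = inverse (lead_coeff q)"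
  have c0: "c \<noteq> 0" using pq(2) by (simp add: c_def)
  have "q * del p = p * del q" using W by (simp add: W_def)
  then have "q dvd p * del q" by (metis dvd_triv_left)
  then have "q dvd del q" using pq(1) by (simp add: coprime_commute coprime_dvd_mult_right_iff)
  define q' p' where "q' = [:c:] * q" and "p' = [:c:] * p"
  have q': "lead_coeff q' = 1" "q' \<noteq> 0" using c0 pq(2) by (auto simp: q'_def c_def)
  have "q' dvd del q'"
  proof -
    have "q dvd del q'" unfolding q'_def del_mult using \<open>q dvd del q\<close> by (simp add: dvd_smult)
    then show ?thesis using c0 by (simp add: q'_def smult_dvd_iff)
  qed
  then obtain k where k: "del q' = q' * k" by (rule dvdE)
  have "degree k = 0"
  proof (cases "k = 0")
    case False
    have "degree q' + degree k = degree (del q')" unfolding k using q'(2) False by (simp add: degree_mult_eq)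
    then show ?thesis using degree_del_monic[OF q'(1)] by linarith
  qed simp
  have "q' * del p' = p' * del q'"
    using \<open>q * del p = p * del q\<close> unfolding q'_def p'_def del_mult by algebra
  then have "q' * (del p' - p' * k) = 0" by (simp add: k algebra_simps)
  then have kp: "del p' = p' * k" using q'(2) by simp
  define m where "m = pcompose q' [:0, - 1:]"
  have m0: "m \<noteq> 0" using q'(2) by (simp add: m_def pcompose_eq_0_iff)
  have "pcompose k [:0, - 1:] = k" using \<open>degree k = 0\<close> by (auto elim!: degree_eq_zeroE)
  then have km: "del m = - (m * k)" unfolding m_def del_reflect k by (simp add: pcompose_mult)
  have "del (p' * m) = 0" "del (q' * m) = 0" by (simp_all add: del_mult km kp k algebra_simps)
  note this[THEN even_poly_of_del]
  moreover have "p * (q' * m) = p' * m * q" by (simp add: p'_def q'_def algebra_simps)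
  moreover have "q' * m \<noteq> 0" using m0 q'(2) by simp
  ultimately show ?thesis by (intro that[of "q' * m" "p' * m"])
qed

end

section \<open>Quasi-constant decompositions over a differential field\<close>

definition dot :: "'a::linordered_field \<times> 'a \<times> 'a \<Rightarrow> 'a \<times> 'a \<times> 'a \<Rightarrow> 'a" where
  "dot u v = fst u * fst v + fst (snd u) * fst (snd v) + snd (snd u) * snd (snd v)"

definition cross :: "'a::linordered_field \<times> 'a \<times> 'a \<Rightarrow> 'a \<times> 'a \<times> 'a \<Rightarrow> 'a \<times> 'a \<times> 'a" where
  "cross u v = (fst (snd u) * snd (snd v) - snd (snd u) * fst (snd v),
     snd (snd u) * fst v - fst u * snd (snd v), fst u * fst (snd v) - fst (snd u) * fst v)"

lemma dot_commute: "dot u v = dot v u"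
  by (simp add: dot_def algebra_simps)

lemma dot_nonneg: "0 \<le> dot u u"
  by (simp add: dot_def)

text \<open>Expansion of \<open>dot a b\<close> along \<open>u\<close>, \<open>v\<close> and their
  cross product, multiplied by the Gram determinant of \<open>u\<close> and
  \<open>v\<close>.\<close>

lemma gram:
  "(dot u u * dot v v - (dot u v)\<^sup>2) * dot a b = dot a (cross u v) * dot b (cross u v)
     + dot a v * dot b v * dot u u - (dot a v * dot b u + dot a u * dot b v) * dot u v + dot a u * dot b u * dot v v"
  by (cases u, cases v, cases a, cases b) (simp add: dot_def cross_def power2_eq_square algebra_simps)

locale differential_field =
  fixes \<delta> :: "'k::linordered_field \<Rightarrow> 'k"
  assumes \<delta>: "derivation \<delta>"
begin

definition const :: "'k \<Rightarrow> bool" where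
  "const x \<longleftrightarrow> \<delta> x = 0"

lemma const_inverse: "const x \<Longrightarrow> const (inverse x)"
proof (cases "x = 0")
  case False
  assume "const x"
  have "x * \<delta> (inverse x) = \<delta> (x * inverse x)" using \<open>const x\<close> by (simp add: const_def der_mult[OF \<delta>])
  then show ?thesis using False by (simp add: const_def der_1[OF \<delta>])
qed (simp add: const_def der_0[OF \<delta>])

lemma const_divide: "const x \<Longrightarrow> const y \<Longrightarrow> const (x / y)"
  using const_inverse[of y] by (simp add: const_def der_mult[OF \<delta>] divide_inverse)

lemma const_intros:
  "const 0" "const 1" "const (numeral n)" "const x \<Longrightarrow> const (- x)"
  "const x \<Longrightarrow> const y \<Longrightarrow> const (x + y)" "const x \<Longrightarrow> const y \<Longrightarrow> const (x - y)"
  "const x \<Longrightarrow> const y \<Longrightarrow> const (x * y)" "const x \<Longrightarrow> const (x ^ i)"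
  by (simp_all add: const_def der_0[OF \<delta>] der_1[OF \<delta>] der_numeral[OF \<delta>] der_minus[OF \<delta>] der_add[OF \<delta>]
      der_diff[OF \<delta>] der_mult[OF \<delta>] der_power[OF \<delta>])

lemmas const_rules = const_intros const_divide

lemma const_of_square:
  assumes "const (x\<^sup>2)"
  shows "const x"
proof (cases "x = 0")
  case False
  then show ?thesis using assms by (simp add: const_def der_power2[OF \<delta>])
qed (simp add: const_intros)

text \<open>Differentiating \<open>poly F x = 0\<close> gives the value of \<open>pderiv F\<close>
  at \<open>x\<close> times the derivative of \<open>x\<close>. If that value is 0, then
  \<open>x\<close> is a root of the nonzero polynomial \<open>pderiv F\<close> of smaller
  degree.\<close>

lemma const_root:
  assumes "F \<noteq> 0" "\<And>i. const (coeff F i)" "poly F x = 0"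
  shows "const x"
  using assms
proof (induction "degree F" arbitrary: F rule: less_induct)
  case less
  have "degree F \<noteq> 0"
  proof
    assume "degree F = 0"
    then obtain c where "F = [:c:]" by (rule degree_eq_zeroE)
    with less.prems show False by simp
  qed
  then have F': "degree (pderiv F) < degree F" "pderiv F \<noteq> 0"
    by (simp_all add: degree_pderiv pderiv_eq_0_iff)
  have "\<delta> (poly F x) = poly (pderiv F) x * \<delta> x" using less.prems(2)
  proof (induction F)
    case 0
    show ?case by (simp add: der_0[OF \<delta>])
  next
    case (pCons a F)
    have "const a" using pCons.prems[of 0] by simp
    moreover have "const (coeff F i)" for i using pCons.prems[of "Suc i"] by simp
    ultimately show ?case using pCons.IH
      by (simp add: const_def der_add[OF \<delta>] der_mult[OF \<delta>] pderiv_pCons algebra_simps)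
  qed
  then have "poly (pderiv F) x = 0 \<or> const x" using less.prems(3) by (auto simp: const_def der_0[OF \<delta>])
  moreover have "const (coeff (pderiv F) i)" for i
    using less.prems(2)[of "Suc i"]
    by (simp add: const_def coeff_pderiv der_mult[OF \<delta>] der_add[OF \<delta>] der_1[OF \<delta>] der_of_nat[OF \<delta>] del: of_nat_Suc)
  ultimately show ?case using less.hyps[OF F'] by blast
qed

text \<open>The form used for elimination: one quantity is a quadratic in \<open>x\<close> and its
  square is another polynomial of degree at most 2 in \<open>x\<close>, all with constant
  coefficients.\<close>

lemma const_quartic_root:
  assumes c: "const q0" "const q1" "const q2" "const s0" "const s1" "const s2" and q2: "q2 \<noteq> 0"
    and eq: "(q2 * x\<^sup>2 + q1 * x + q0)\<^sup>2 = s2 * x\<^sup>2 + s1 * x + s0"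
  shows "const x"
proof (rule const_root)
  let ?F = "[:q0\<^sup>2 - s0, 2 * q0 * q1 - s1, q1\<^sup>2 + 2 * q0 * q2 - s2, 2 * q1 * q2, q2\<^sup>2:]"
  show "?F \<noteq> 0" using q2 by simp
  show "const (coeff ?F i)" for i
    by (auto simp: coeff_pCons split: nat.split intro!: const_intros c)
  show "poly ?F x = 0" using eq by (simp add: power2_eq_square algebra_simps)
qed

end

text \<open>The last two assumptions are the only arithmetic input; everything else about the vectors is linear
  algebra of their Gram matrix.\<close>
locale quasi_constant = differential_field \<delta> for \<delta> :: "'k::linordered_field \<Rightarrow> 'k" +
  fixes p0 p1 p2 p3 :: 'k
  assumes p: "const p0" "const p1" "const p2" "const p3" and pos: "0 < p0" "0 < p3"
    and R1: "\<And>x z. z\<^sup>2 = - (p3 * x ^ 3 + p2 * x\<^sup>2 + p1 * x + p0) \<Longrightarrow> const x"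
    and R2: "\<And>x z. z\<^sup>2 = - (x * (p3 * x ^ 3 + p2 * x\<^sup>2 + p1 * x + p0)) \<Longrightarrow> const x"
begin

abbreviation P where "P x \<equiv> p3 * x ^ 3 + p2 * x\<^sup>2 + p1 * x + p0"

lemma R1_z:
  assumes "z\<^sup>2 = - P x"
  shows "const x \<and> const z"
proof -
  have x: "const x" using R1[OF assms] .
  have "const (z\<^sup>2)" unfolding assms by (intro const_intros p x)
  with x show ?thesis using const_of_square by blast
qed

lemma R2_z:
  assumes "(x * z)\<^sup>2 = - (x * P x)" "x \<noteq> 0"
  shows "const x \<and> const z"
proof -
  have x: "const x" using R2[OF assms(1)] .
  have "const ((x * z)\<^sup>2)" unfolding assms(1) by (intro const_intros p x)
  then have "const (x * z)" by (rule const_of_square)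
  then have "const (x * z / x)" using x by (rule const_divide)
  with x assms(2) show ?thesis by simp
qed

text \<open>The cubic is monic without quadratic term and the \<open>g\<close>-part is even. The one
  factor \<open>d\<close> in front of \<open>g^2 + p3 h^2\<close> is what the descent later
  normalises.\<close>

definition constant_form :: "bool" where
  "constant_form \<longleftrightarrow> (\<exists>f0 f1 d g0 g2 h0 h1 h2. const f0 \<and> const f1 \<and> const d \<and> const g0 \<and> const g2 \<and>
     const h0 \<and> const h1 \<and> const h2 \<and> 0 < d \<and>
     (\<forall>x. P (x\<^sup>2) = p3 * (x ^ 3 + f1 * x + f0)\<^sup>2 + d * ((g2 * x\<^sup>2 + g0)\<^sup>2 + p3 * (h2 * x\<^sup>2 + h1 * x + h0)\<^sup>2)))"

lemma constant_formI:
  assumes "\<And>x. P (x\<^sup>2) = p3 * (x ^ 3 + f1 * x + f0)\<^sup>2 + d * ((g2 * x\<^sup>2 + g0)\<^sup>2 + p3 * (h2 * x\<^sup>2 + h1 * x + h0)\<^sup>2)"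
    and "0 < d" "const f0" "const f1" "const d" "const g0" "const g2" "const h0" "const h1" "const h2"
  shows constant_form
  unfolding constant_form_def
  by (rule exI[of _ f0], rule exI[of _ f1], rule exI[of _ d], rule exI[of _ g0], rule exI[of _ g2],
      rule exI[of _ h0], rule exI[of _ h1], rule exI[of _ h2], intro conjI allI) (fact assms)+

section \<open>The Gram data of the four vectors, by cases\<close>

context
  fixes A1 A2 B0 B1 m m0 m1 w0 w1 dA dB :: 'k
  assumes nonneg: "0 \<le> A2" "0 \<le> B0" and sums: "A1 + B0 = p1" "A2 + B1 = p2"
    and dB: "dB = p3 * B0 - B1\<^sup>2 / 4" and dA: "dA = p0 * A2 - A1\<^sup>2 / 4"
    and B_gram: "dB * p0 = m0\<^sup>2 + m\<^sup>2 * B0" "dB * A1 = 2 * m0 * m1 + m\<^sup>2 * B1" "dB * A2 = m1\<^sup>2 + m\<^sup>2 * p3"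
    and A_gram: "dA * B0 = w0\<^sup>2 + m\<^sup>2 * p0" "dA * B1 = 2 * w0 * w1 + m\<^sup>2 * A1" "dA * p3 = w1\<^sup>2 + m\<^sup>2 * A2"
begin

text \<open>\<open>A1, A2, B0, B1\<close> are the coefficients of \<open>\<bar>a0 + a1 \<xi>\<bar>\<^sup>2\<close> and \<open>\<bar>c0 + c1 \<xi>\<bar>\<^sup>2\<close>, \<open>m = a0 \<bullet> c1 = - a1 \<bullet> c0\<close>,
  \<open>dA, dB\<close> are the Gram determinants, and \<open>m0, m1, w0, w1\<close> are triple products.\<close>
lemma constant_form_regular:
  assumes dB0: "0 < dB" and c: "const m" "const m0" "const m1" "const dB" "const B1"
  shows constant_form
proof -
  define u where "u = B1 / (2 * p3)"
  \<comment> \<open>Completing the square in the \<open>c\<close>-part gives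
    \<open>(m0 + m1 x^2)^2 / dB\<close> plus the product of \<open>x^2 + m^2 / dB\<close> and
    \<open>p3 (x^2 + u)^2 + dB / p3\<close>. The two-square composition of that product yields the
    cubic and the \<open>h\<close>-part.\<close>
  have "P (x\<^sup>2) = p3 * (x ^ 3 + u * x + - m / p3)\<^sup>2
      + 1 / dB * ((m1 * x\<^sup>2 + m0)\<^sup>2 + p3 * (m * x\<^sup>2 + dB / p3 * x + u * m)\<^sup>2)" for x
  proof -
    have e0: "p0 = (m0\<^sup>2 + m\<^sup>2 * B0) / dB" and e1: "A1 = (2 * m0 * m1 + m\<^sup>2 * B1) / dB"
      and e2: "A2 = (m1\<^sup>2 + m\<^sup>2 * p3) / dB"
      using B_gram dB0 by (simp_all add: field_simps)
    have eB0: "B0 = p3 * u\<^sup>2 + dB / p3" and eB1: "B1 = 2 * p3 * u"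
      using pos by (simp_all add: dB u_def power2_eq_square field_simps)
    have "P (x\<^sup>2) = (p0 + A1 * x\<^sup>2 + A2 * x ^ 4) + x\<^sup>2 * (B0 + B1 * x\<^sup>2 + p3 * x ^ 4)"
      by (simp add: sums[symmetric] algebra_simps flip: power_mult power_add)
    also have "\<dots> = ((m0 + m1 * x\<^sup>2)\<^sup>2 + m\<^sup>2 * (B0 + B1 * x\<^sup>2 + p3 * x ^ 4)) / dB + x\<^sup>2 * (B0 + B1 * x\<^sup>2 + p3 * x ^ 4)"
      unfolding e0 e1 e2 using dB0 by (simp add: field_simps power2_eq_square power4_eq_xxxx)
    also have "B0 + B1 * x\<^sup>2 + p3 * x ^ 4 = p3 * (x\<^sup>2 + u)\<^sup>2 + dB / p3"
      unfolding eB0 eB1 using pos by (simp add: field_simps power2_eq_square power4_eq_xxxx)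
    also have "((m0 + m1 * x\<^sup>2)\<^sup>2 + m\<^sup>2 * (p3 * (x\<^sup>2 + u)\<^sup>2 + dB / p3)) / dB + x\<^sup>2 * (p3 * (x\<^sup>2 + u)\<^sup>2 + dB / p3)
        = p3 * (x ^ 3 + u * x + - m / p3)\<^sup>2 + 1 / dB * ((m1 * x\<^sup>2 + m0)\<^sup>2 + p3 * (m * x\<^sup>2 + dB / p3 * x + u * m)\<^sup>2)"
      using pos dB0 by (simp add: field_simps power2_eq_square power3_eq_cube)
    finally show ?thesis .
  qed
  from this show ?thesis
  proof (rule constant_formI)
    have u: "const u" unfolding u_def by (intro const_rules p c)
    show "const (- m / p3)" "const u" "const (1 / dB)" "const m0" "const m1" "const (u * m)"
      "const (dB / p3)" "const m" by (intro const_rules p c u)+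
  qed (use dB0 in simp)
qed

text \<open>The Gram data give one point for each of \<open>R1\<close> and \<open>R2\<close>. Once
  these are constant, the remaining unknowns \<open>k\<close> and \<open>l\<close> satisfy two
  relations with constant coefficients, which make \<open>l\<close> algebraic over the
  constants.\<close>

lemma constant_form_generic:
  assumes m: "m \<noteq> 0"
  shows constant_form
proof -
  have m2: "0 < m\<^sup>2" using m by simp
  have "0 < dB * A2" unfolding B_gram(3) using m2 pos by (intro add_nonneg_pos) simp_all
  then have dB0: "0 < dB" using nonneg by (simp add: zero_less_mult_iff)
  have "0 < dA * B0" unfolding A_gram(1) using m2 pos by (intro add_nonneg_pos) simp_all
  then have dA0: "0 < dA" using nonneg by (simp add: zero_less_mult_iff)
  \<comment> \<open>Both Gram determinants are positive, so \<open>x1\<close> and \<open>x2\<close>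
    are negative. The ordinates are chosen so that \<open>z1^2 = - P x1\<close> and
    \<open>(x2 * y2)^2 = - (x2 * P x2)\<close>.\<close>
  define x1 x2 z1 y2 k l where "x1 = - dA / m\<^sup>2" and "x2 = - m\<^sup>2 / dB"
    and "z1 = (w0 + w1 * x1) / m" and "y2 = (m0 + m1 * x2) / m" and "k = w1 / m" and "l = m1 / m"
  have neg: "x1 < 0" "x2 < 0" using m2 dA0 dB0 by (simp_all add: x1_def x2_def divide_neg_pos)
  have w: "w1 = k * m" "w0 = (z1 - k * x1) * m" and mm: "m1 = l * m" "m0 = (y2 - l * x2) * m"
    and dAx: "dA = - x1 * m\<^sup>2" and dBx: "m\<^sup>2 = - x2 * dB"
    using m dB0 by (simp_all add: k_def l_def z1_def y2_def x1_def x2_def field_simps)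
  have A_rel: "- x1 * B0 = (z1 - k * x1)\<^sup>2 + p0" "- x1 * B1 = 2 * (z1 - k * x1) * k + A1" "- x1 * p3 = k\<^sup>2 + A2"
  proof -
    have "m\<^sup>2 * (- x1 * B0) = m\<^sup>2 * ((z1 - k * x1)\<^sup>2 + p0)" "m\<^sup>2 * (- x1 * B1) = m\<^sup>2 * (2 * (z1 - k * x1) * k + A1)"
      "m\<^sup>2 * (- x1 * p3) = m\<^sup>2 * (k\<^sup>2 + A2)"
      using A_gram by (simp_all add: dAx w power2_eq_square algebra_simps)
    then show "- x1 * B0 = (z1 - k * x1)\<^sup>2 + p0" "- x1 * B1 = 2 * (z1 - k * x1) * k + A1" "- x1 * p3 = k\<^sup>2 + A2"
      using m2 by (metis mult_left_cancel less_irrefl)+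
  qed
  have B_rel: "p0 = - x2 * ((y2 - l * x2)\<^sup>2 + B0)" "A1 = - x2 * (2 * (y2 - l * x2) * l + B1)" "A2 = - x2 * (l\<^sup>2 + p3)"
  proof -
    have "dB * p0 = m\<^sup>2 * ((y2 - l * x2)\<^sup>2 + B0)" "dB * A1 = m\<^sup>2 * (2 * (y2 - l * x2) * l + B1)"
      "dB * A2 = m\<^sup>2 * (l\<^sup>2 + p3)"
      unfolding B_gram mm by (simp_all add: power2_eq_square algebra_simps)
    then have "dB * p0 = dB * (- x2 * ((y2 - l * x2)\<^sup>2 + B0))" "dB * A1 = dB * (- x2 * (2 * (y2 - l * x2) * l + B1))"
      "dB * A2 = dB * (- x2 * (l\<^sup>2 + p3))"
      unfolding dBx by (simp_all add: mult_ac)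
    then show "p0 = - x2 * ((y2 - l * x2)\<^sup>2 + B0)" "A1 = - x2 * (2 * (y2 - l * x2) * l + B1)" "A2 = - x2 * (l\<^sup>2 + p3)"
      using dB0 by (metis mult_left_cancel less_irrefl)+
  qed
  have z1: "z1\<^sup>2 = - P x1"
  proof -
    have "p0 = - x1 * B0 - (z1 - k * x1)\<^sup>2" "A1 = - x1 * B1 - 2 * (z1 - k * x1) * k" "A2 = - x1 * p3 - k\<^sup>2"
      using A_rel by (simp_all add: algebra_simps)
    then have "P x1 = p3 * x1 ^ 3 + (- x1 * p3 - k\<^sup>2 + B1) * x1\<^sup>2 + (- x1 * B1 - 2 * (z1 - k * x1) * k + B0) * x1
        + (- x1 * B0 - (z1 - k * x1)\<^sup>2)" unfolding sums[symmetric] by (simp only:)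
    also have "\<dots> = - z1\<^sup>2" by (simp add: power2_eq_square power3_eq_cube algebra_simps)
    finally show ?thesis by simp
  qed
  then have c1: "const x1" "const z1" using R1_z by auto
  have "(x2 * y2)\<^sup>2 = - (x2 * P x2)"
  proof -
    have "P x2 = p3 * x2 ^ 3 + (- x2 * (l\<^sup>2 + p3) + B1) * x2\<^sup>2 + (- x2 * (2 * (y2 - l * x2) * l + B1) + B0) * x2
        + - x2 * ((y2 - l * x2)\<^sup>2 + B0)" unfolding sums[symmetric] B_rel(2,3) by (subst B_rel(1)) (rule refl)
    also have "\<dots> = - x2 * y2\<^sup>2" by (simp add: power2_eq_square power3_eq_cube algebra_simps)
    finally show ?thesis by (simp add: power2_eq_square)
  qed
  then have c2: "const x2" "const y2" using R2_z neg by auto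
  have i: "k\<^sup>2 = x2 * l\<^sup>2 + p3 * (x2 - x1)" using A_rel(3) B_rel(3) by algebra
  have "const l"
  proof (cases "x1 = x2")
    case True
    then have "k\<^sup>2 = x2 * l\<^sup>2" using i by simp
    moreover have "x2 * l\<^sup>2 < 0" if "l \<noteq> 0" using neg that by (simp add: mult_neg_pos)
    ultimately have "l = 0" by (metis not_less zero_le_power2)
    then show ?thesis by (simp add: const_intros)
  next
    case False
    \<comment> \<open>Eliminating \<open>B0\<close> between the first parts of \<open>A_rel\<close>
      and \<open>B_rel\<close> equates a quadratic in \<open>l\<close> with a constant multiple of
      \<open>k\<close>. Squaring and replacing \<open>k^2\<close> by \<open>i\<close> leaves a
      quartic in \<open>l\<close>.\<close>
    define q0 where "q0 = x2 * (z1\<^sup>2 + x1\<^sup>2 * (p3 * (x2 - x1)) - x1 * y2\<^sup>2 + p0) - p0 * x1"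
    have "(x1 * x2\<^sup>2 * (x1 - x2)) * l\<^sup>2 + (2 * x1 * x2\<^sup>2 * y2) * l + q0 = 2 * x2 * z1 * x1 * k"
    proof -
      have "x1 * p0 = x2 * (- x1 * B0) - x1 * x2 * (y2 - l * x2)\<^sup>2"
        using arg_cong[OF B_rel(1), of "\<lambda>t. x1 * t"] by (simp add: algebra_simps)
      also have "\<dots> = x2 * ((z1 - k * x1)\<^sup>2 + p0) - x1 * x2 * (y2 - l * x2)\<^sup>2" unfolding A_rel(1) by (rule refl)
      finally have "2 * x2 * z1 * x1 * k
          = x2 * z1\<^sup>2 + x2 * x1\<^sup>2 * k\<^sup>2 + x2 * p0 - x1 * p0 - x1 * x2 * (y2 - l * x2)\<^sup>2"
        by (simp add: power2_eq_square algebra_simps)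
      then show ?thesis unfolding q0_def i by (simp add: power2_eq_square algebra_simps)
    qed
    then have "((x1 * x2\<^sup>2 * (x1 - x2)) * l\<^sup>2 + (2 * x1 * x2\<^sup>2 * y2) * l + q0)\<^sup>2
        = (4 * x2\<^sup>2 * z1\<^sup>2 * x1\<^sup>2 * x2) * l\<^sup>2 + 0 * l + 4 * x2\<^sup>2 * z1\<^sup>2 * x1\<^sup>2 * (p3 * (x2 - x1))"
      by (simp add: power_mult_distrib i algebra_simps)
    note eq = this
    have q0: "const q0" unfolding q0_def by (intro const_rules p c1 c2)
    have nz: "x1 * x2\<^sup>2 * (x1 - x2) \<noteq> 0" using False neg by simp
    show ?thesis
      by (rule const_quartic_root[OF q0 _ _ _ _ _ nz eq]) (intro const_rules p c1 c2)+
  qed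
  have "const (k\<^sup>2)" unfolding i by (intro const_rules p c1 c2 \<open>const l\<close>)
  then have "const k" by (rule const_of_square)
  note c = p c1 c2 \<open>const l\<close> \<open>const k\<close>
  have cA2: "const A2" unfolding B_rel(3) by (intro const_rules c)
  have "B0 = - p0 / x2 - (y2 - l * x2)\<^sup>2" using B_rel(1) neg by (simp add: field_simps)
  then have cB0: "const B0" by (simp only:) (intro const_rules c)
  have "B1 = p2 - A2" using sums by simp
  then have cB1: "const B1" by (simp only:) (intro const_rules c cA2)
  have cdB: "const dB" unfolding dB by (intro const_rules c cB0 cB1)
  have "const (m\<^sup>2)" unfolding dBx by (intro const_rules c cdB)
  then have cm: "const m" by (rule const_of_square)
  have "const m0" "const m1" unfolding mm by (intro const_rules c cm)+
  then show ?thesis using constant_form_regular[OF dB0] cm cdB cB1 by blast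
qed

text \<open>Here \<open>a0\<close> and \<open>a1\<close> are both orthogonal to the independent
  vectors \<open>c0\<close> and \<open>c1\<close>, so \<open>a1\<close> is \<open>t\<close> times
  \<open>a0\<close>. One point for \<open>R1\<close> suffices to make \<open>t\<close> and
  \<open>k\<close> constant.\<close>

lemma constant_form_degenerate:
  assumes m: "m = 0" and dB0: "dB \<noteq> 0"
  shows constant_form
proof -
  have e: "dB * p0 = m0\<^sup>2" "dB * A1 = 2 * m0 * m1" "dB * A2 = m1\<^sup>2" using B_gram m by simp_all
  have m0: "m0 \<noteq> 0" using e(1) dB0 pos by auto
  have "0 < dB * p0" unfolding e(1) using m0 by simp
  then have dB1: "0 < dB" using pos by (simp add: zero_less_mult_iff)
  \<comment> \<open>\<open>k\<close> is chosen so that \<open>k * c + t * u = 1\<close>. Then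
    \<open>(p0 t^2 + k^2) (u^2 + p0 c^2)\<close> equals \<open>V^2 + p0\<close> by composition,
    which puts \<open>x1\<close> on the curve of \<open>R1\<close>.\<close>
  define t c u k where "t = m1 / m0" and "c = m0 / (p0 * p3)" and "u = B1 / (2 * p3)" and "k = (1 - t * u) / c"
  have c0: "c \<noteq> 0" using m0 pos by (simp add: c_def)
  have dBc: "dB = c\<^sup>2 * p0 * p3\<^sup>2" using e(1) pos by (simp add: c_def power2_eq_square field_simps)
  have m1t: "m1 = t * m0" using m0 by (simp add: t_def)
  have A: "A1 = 2 * t * p0" "A2 = t\<^sup>2 * p0"
  proof -
    have "dB * A1 = dB * (2 * t * p0)" "dB * A2 = dB * (t\<^sup>2 * p0)" using e by (simp_all add: m1t power2_eq_square algebra_simps)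
    then show "A1 = 2 * t * p0" "A2 = t\<^sup>2 * p0" using dB0 by simp_all
  qed
  have B: "B1 = 2 * p3 * u" "B0 = p3 * (u\<^sup>2 + c\<^sup>2 * p0)"
  proof -
    show "B1 = 2 * p3 * u" using pos by (simp add: u_def)
    then have "p3 * B0 = p3 * (p3 * (u\<^sup>2 + c\<^sup>2 * p0))" using dB unfolding dBc by (simp add: power2_eq_square algebra_simps)
    then show "B0 = p3 * (u\<^sup>2 + c\<^sup>2 * p0)" using pos by simp
  qed
  have kc: "k * c = 1 - t * u" using c0 by (simp add: k_def)
  define x1 where "x1 = - ((k\<^sup>2 + p0 * t\<^sup>2) / p3)"
  define V where "V = k * u - t * p0 * c"
  define z1 where "z1 = k * x1 + V"
  have x1: "p0 * t\<^sup>2 + k\<^sup>2 = - x1 * p3" using pos by (simp add: x1_def)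
  have 1: "1 = k * c + t * u" using kc by simp
  have v0: "V\<^sup>2 + p0 = - x1 * B0"
  proof -
    have "- x1 * B0 = (p0 * t\<^sup>2 + k\<^sup>2) * (u\<^sup>2 + c\<^sup>2 * p0)" unfolding x1 B by simp
    moreover have "p0 = p0 * (k * c + t * u)\<^sup>2" by (simp flip: 1)
    then have "V\<^sup>2 + p0 = V\<^sup>2 + p0 * (k * c + t * u)\<^sup>2" by simp
    ultimately show ?thesis unfolding V_def by (simp add: power2_eq_square algebra_simps)
  qed
  have v1: "2 * k * V + A1 = - x1 * B1"
  proof -
    have "- x1 * B1 = 2 * u * (p0 * t\<^sup>2 + k\<^sup>2)" unfolding x1 B by simp
    moreover have "A1 = 2 * p0 * t * (k * c + t * u)" by (simp add: A flip: 1)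
    ultimately show ?thesis unfolding V_def by (simp add: power2_eq_square algebra_simps)
  qed
  have "z1\<^sup>2 = - P x1"
  proof -
    have "z1\<^sup>2 = (A2 + k\<^sup>2) * x1\<^sup>2 + (2 * k * V + A1) * x1 + (V\<^sup>2 + p0) - A2 * x1\<^sup>2 - A1 * x1 - p0"
      unfolding z1_def by (simp add: power2_eq_square algebra_simps)
    also have "A2 + k\<^sup>2 = - x1 * p3" using x1 by (simp add: A mult.commute)
    finally show ?thesis unfolding v0 v1 sums[symmetric] by (simp add: power2_eq_square power3_eq_cube algebra_simps)
  qed
  then have c1: "const x1" "const z1" using R1_z by auto
  have "x1 \<noteq> 0"
  proof
    assume "x1 = 0"
    then have "V\<^sup>2 + p0 = 0" using v0 by simp
    moreover have "V\<^sup>2 + p0 > 0" using pos by (intro add_nonneg_pos) simp_all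
    ultimately show False by simp
  qed
  \<comment> \<open>This writes \<open>t\<close> as a quadratic in \<open>k\<close>; the definition
    of \<open>x1\<close> writes \<open>t^2\<close> as another, and together they give a quartic for
    \<open>k\<close>.\<close>
  have "2 * p0 * x1 * t = x1\<^sup>2 * k\<^sup>2 - 2 * z1 * x1 * k + (p1 * x1 + p0 + z1\<^sup>2)"
  proof -
    have "B0 = p1 - 2 * t * p0" using sums by (simp add: A algebra_simps)
    then have "V\<^sup>2 = - x1 * (p1 - 2 * t * p0) - p0" using v0 by (simp add: eq_diff_eq)
    moreover have "V = z1 - k * x1" by (simp add: z1_def)
    ultimately show ?thesis by (simp add: power2_eq_square algebra_simps)
  qed
  moreover have "2 * p0 * x1 \<noteq> 0" using pos \<open>x1 \<noteq> 0\<close> by simp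
  ultimately have "t = (x1\<^sup>2 * k\<^sup>2 - 2 * z1 * x1 * k + (p1 * x1 + p0 + z1\<^sup>2)) / (2 * p0 * x1)"
    by (simp only: eq_divide_eq mult.commute not_False_eq_True if_True)
  then have t: "t = x1 / (2 * p0) * k\<^sup>2 + (- z1 / p0) * k + (p1 * x1 + p0 + z1\<^sup>2) / (2 * p0 * x1)"
    using pos \<open>x1 \<noteq> 0\<close> by (simp add: add_divide_distrib diff_divide_distrib power2_eq_square)
  have "t\<^sup>2 = (- 1 / p0) * k\<^sup>2 + 0 * k + (- x1 * p3 / p0)"
  proof -
    have "p0 * t\<^sup>2 = - k\<^sup>2 - x1 * p3" using x1 by (simp add: algebra_simps)
    then have "t\<^sup>2 = (- k\<^sup>2 - x1 * p3) / p0" using pos by (simp add: eq_divide_eq mult.commute)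
    then show ?thesis by (simp add: diff_divide_distrib)
  qed
  note eq = this[unfolded t]
  have ck: "const k"
    by (rule const_quartic_root[OF _ _ _ _ _ _ _ eq]) (intro const_rules p c1 | simp add: less_imp_neq[OF pos(1), symmetric] \<open>x1 \<noteq> 0\<close>)+
  have ct: "const t" unfolding t by (intro const_rules p c1 ck)
  have cA: "const A1" "const A2" unfolding A by (intro const_rules p ct)+
  have "B0 = p1 - A1" "B1 = p2 - A2" using sums by simp_all
  then have cB: "const B0" "const B1" using cA p by (auto intro!: const_rules)
  have cdB: "const dB" unfolding dB by (intro const_rules p cB)
  have "const (m0\<^sup>2)" unfolding e(1)[symmetric] by (intro const_rules p cdB)
  then have cm0: "const m0" by (rule const_of_square)
  have "const m1" unfolding m1t by (intro const_rules ct cm0)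
  then show ?thesis using constant_form_regular[OF dB1] cm0 cdB cB m by (simp add: const_intros)
qed

text \<open>\<open>c0\<close> and \<open>c1\<close> are now parallel, so the odd part contributes
  \<open>p3 (\<xi> - x0)^2\<close>. It remains to show that \<open>x0\<close> is constant;
  positivity has already forced \<open>m = 0\<close>.\<close>

lemma constant_form_singular:
  assumes dB0: "dB = 0"
  shows constant_form
proof -
  have "m1\<^sup>2 + m\<^sup>2 * p3 = 0" using B_gram(3) dB0 by simp
  then have m: "m = 0" using pos by (metis add_nonneg_eq_0_iff mult_eq_0_iff mult_nonneg_nonneg less_imp_le
      less_irrefl power_eq_0_iff zero_le_power2)
  define x0 c where "x0 = - B1 / (2 * p3)" and "c = w1 / p3"
  have B: "B1 = - 2 * p3 * x0" "B0 = p3 * x0\<^sup>2"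
    using dB dB0 pos by (simp_all add: x0_def field_simps power2_eq_square)
  have dAc: "dA = c\<^sup>2 * p3" using A_gram(3) m pos by (simp add: c_def power2_eq_square field_simps)
  have A: "A1 = p1 - p3 * x0\<^sup>2" "A2 = p2 + 2 * p3 * x0" using sums B by (simp_all add: algebra_simps)
  have "const x0"
  proof (cases "c = 0")
    case True
    \<comment> \<open>Here the even part is \<open>p0 (1 + s \<xi>)^2\<close>. Comparing
      coefficients gives \<open>x0\<close> as a quadratic and \<open>x0^2\<close> as a linear
      polynomial in \<open>s\<close>.\<close>
    define s where "s = A1 / (2 * p0)"
    have s1: "A1 = 2 * p0 * s" using pos by (simp add: s_def)
    have "p0 * A2 = p0 * (p0 * s\<^sup>2)" using dA dAc True s1 by (auto simp add: power2_eq_square algebra_simps)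
    then have s2: "A2 = p0 * s\<^sup>2" using pos by simp
    have x0: "x0 = p0 / (2 * p3) * s\<^sup>2 + 0 * s + (- p2 / (2 * p3))"
      using s2 A pos by (simp add: field_simps)
    have "x0\<^sup>2 = 0 * s\<^sup>2 + (- 2 * p0 / p3) * s + p1 / p3"
      using s1 A pos by (simp add: field_simps)
    note eq = this[unfolded x0]
    have cs: "const s"
      by (rule const_quartic_root[OF _ _ _ _ _ _ _ eq]) (intro const_rules p | simp add: less_imp_neq[OF pos(1), symmetric] less_imp_neq[OF pos(2), symmetric])+
    show ?thesis unfolding x0 by (intro const_rules p cs)
  next
    case False
    have "0 < dA" unfolding dAc using False pos by simp
    moreover have "0 \<le> A1\<^sup>2 / 4" by simp
    ultimately have "0 < p0 * A2" using dA by linarith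
    then have A20: "0 < A2" using pos by (simp add: zero_less_mult_iff)
    define c' u where "c' = c / A2" and "u = A1 / (2 * A2)"
    have c'0: "c' \<noteq> 0" using False A20 by (simp add: c'_def)
    \<comment> \<open>This \<open>k\<close> makes \<open>k * c' + u = - x0\<close>, so composing
      \<open>k^2 + p3\<close> with \<open>u^2 + p3 c'^2\<close> gives \<open>V^2 + p3 x0^2\<close>
      and hence a point for \<open>R2\<close>.\<close>
    define k where "k = - (u + x0) / c'"
    have kc: "k * c' = - (u + x0)" using c'0 by (simp add: k_def)
    have A1: "A1 = 2 * A2 * u" using A20 by (simp add: u_def)
    have A0: "p0 = A2 * (u\<^sup>2 + p3 * c'\<^sup>2)"
    proof -
      have "c = c' * A2" using A20 by (simp add: c'_def)
      then have "A2 * p0 = A2 * (A2 * (u\<^sup>2 + p3 * c'\<^sup>2))"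
        using dA dAc A1 by (auto simp add: power2_eq_square algebra_simps)
      then show ?thesis using A20 by simp
    qed
    define x2 where "x2 = - A2 / (k\<^sup>2 + p3)"
    have "0 < k\<^sup>2 + p3" using pos by (intro add_nonneg_pos) simp_all
    then have x2: "- A2 = x2 * (k\<^sup>2 + p3)" and x20: "x2 < 0"
      using A20 by (simp_all add: x2_def divide_neg_pos)
    define V where "V = k * u - p3 * c'"
    define v2 where "v2 = k * x2 + V"
    have x0kc: "x0 = - (k * c' + u)" using kc by simp
    have v0: "p0 = - x2 * (V\<^sup>2 + p3 * x0\<^sup>2)"
    proof -
      have "- p0 = - A2 * (u\<^sup>2 + p3 * c'\<^sup>2)" by (subst A0) simp
      then show ?thesis unfolding x2 V_def x0kc by (simp add: power2_eq_square algebra_simps)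
    qed
    have v1: "A1 = - x2 * (2 * k * V - 2 * p3 * x0)"
    proof -
      have "- A1 = - A2 * (2 * u)" by (subst A1) simp
      then show ?thesis unfolding x2 V_def x0kc by (simp add: power2_eq_square algebra_simps)
    qed
    have v2: "A2 = - x2 * (k\<^sup>2 + p3)" using x2 by simp
    have "(x2 * v2)\<^sup>2 = - (x2 * P x2)"
    proof -
      have "p1 = A1 + p3 * x0\<^sup>2" "p2 = A2 - 2 * p3 * x0" using A by simp_all
      then have "P x2 = p3 * x2 ^ 3 + (- x2 * (k\<^sup>2 + p3) - 2 * p3 * x0) * x2\<^sup>2
          + (- x2 * (2 * k * V - 2 * p3 * x0) + p3 * x0\<^sup>2) * x2 + - x2 * (V\<^sup>2 + p3 * x0\<^sup>2)"
        unfolding v0[symmetric] v1[symmetric] v2[symmetric] by (simp only:)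
      also have "\<dots> = - x2 * v2\<^sup>2" unfolding v2_def by (simp add: power2_eq_square power3_eq_cube algebra_simps)
      finally show ?thesis by (simp add: power2_eq_square)
    qed
    then have c2: "const x2" "const v2" using R2_z x20 by auto
    have x0: "x0 = - x2 / (2 * p3) * k\<^sup>2 + 0 * k + (- (x2 * p3 + p2) / (2 * p3))"
      using x2 A(2) pos by (simp add: field_simps)
    have "p3 * (x2 * x0\<^sup>2) = - p0 - x2 * (v2 - k * x2)\<^sup>2"
      using v0 by (simp add: v2_def algebra_simps)
    then have "x0\<^sup>2 = (- p0 - x2 * (v2 - k * x2)\<^sup>2) / (p3 * x2)"
      using pos x20 by (simp add: eq_divide_eq mult_ac)
    then have "x0\<^sup>2 = (- x2\<^sup>2 / p3) * k\<^sup>2 + (2 * v2 * x2 / p3) * k + (- v2\<^sup>2 / p3 - p0 / (p3 * x2))"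
      using pos x20 by (simp add: power2_diff add_divide_distrib diff_divide_distrib power2_eq_square algebra_simps)
    note eq = this[unfolded x0]
    have ck: "const k"
      by (rule const_quartic_root[OF _ _ _ _ _ _ _ eq]) (intro const_rules p c2 | simp add: less_imp_neq[OF pos(2), symmetric] less_imp_neq[OF x20])+
    show ?thesis unfolding x0 by (intro const_rules p c2 ck)
  qed
  then have cA: "const A1" "const A2" unfolding A by (auto intro!: const_rules p)
  have "c\<^sup>2 = (p0 * A2 - A1\<^sup>2 / 4) / p3" using dA dAc pos by (simp add: eq_divide_eq)
  then have "const (c\<^sup>2)" using cA by (auto intro!: const_rules p)
  then have cc: "const c" by (rule const_of_square)
  \<comment> \<open>The even part is completed to a square around its constant term
    \<open>p0\<close>; the remainder is \<open>c^2 p3 x^4 / p0\<close>.\<close>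
  have "P (x\<^sup>2) = p3 * (x ^ 3 + - x0 * x + 0)\<^sup>2
      + p0 * ((A1 / (2 * p0) * x\<^sup>2 + 1)\<^sup>2 + p3 * (c / p0 * x\<^sup>2 + 0 * x + 0)\<^sup>2)" for x
  proof -
    have "p0 * A2 = c\<^sup>2 * p3 + A1\<^sup>2 / 4" using dA dAc by simp
    then have A2: "A2 = (c\<^sup>2 * p3 + A1\<^sup>2 / 4) / p0" using pos by (simp add: field_simps)
    have "P (x\<^sup>2) = p3 * (x ^ 3 + - x0 * x + 0)\<^sup>2 + (p0 + A1 * x\<^sup>2 + A2 * x ^ 4)"
      unfolding sums[symmetric] B by (simp add: power2_eq_square power3_eq_cube power4_eq_xxxx algebra_simps)
    also have "p0 + A1 * x\<^sup>2 + A2 * x ^ 4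
        = p0 * ((A1 / (2 * p0) * x\<^sup>2 + 1)\<^sup>2 + p3 * (c / p0 * x\<^sup>2 + 0 * x + 0)\<^sup>2)"
      unfolding A2 using pos by (simp add: power2_eq_square power4_eq_xxxx field_simps)
    finally show ?thesis .
  qed
  then show ?thesis
    by (rule constant_formI) (rule pos | intro const_rules p cA cc \<open>const x0\<close>)+
qed

lemma constant_form_scalar: constant_form
  using constant_form_generic constant_form_degenerate constant_form_singular by blast

end

text \<open>The assumptions are the coefficients of the squared length of
  \<open>a0 + c0 x + a1 x^2 + c1 x^3\<close>, equal to \<open>P (x^2)\<close>. The Gram relations
  are instances of \<open>gram\<close> simplified by orthogonality.\<close>

lemma constant_form_vectors:
  assumes "dot a0 a0 = p0" "dot a0 c0 = 0" "2 * dot a0 a1 + dot c0 c0 = p1" "dot a0 c1 + dot a1 c0 = 0"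
    "dot a1 a1 + 2 * dot c0 c1 = p2" "dot a1 c1 = 0" "dot c1 c1 = p3"
  shows constant_form
proof (rule constant_form_scalar)
  define m where "m = dot a0 c1"
  have m: "dot a1 c0 = - m" using assms(4) by (simp add: m_def eq_neg_iff_add_eq_0 add.commute)
  note d = assms(1,2,6,7) m m_def[symmetric] dot_commute[of c0 a0] dot_commute[of c1 a0] dot_commute[of c0 a1]
    dot_commute[of c1 a1] dot_commute[of a1 a0] dot_commute[of c1 c0]
  let ?dA = "dot a0 a0 * dot a1 a1 - (dot a0 a1)\<^sup>2" and ?dB = "dot c0 c0 * dot c1 c1 - (dot c0 c1)\<^sup>2"
  show "0 \<le> dot a1 a1" "0 \<le> dot c0 c0" by (rule dot_nonneg)+
  show "2 * dot a0 a1 + dot c0 c0 = p1" "dot a1 a1 + 2 * dot c0 c1 = p2" by (fact assms)+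
  show "?dB = p3 * dot c0 c0 - (2 * dot c0 c1)\<^sup>2 / 4" "?dA = p0 * dot a1 a1 - (2 * dot a0 a1)\<^sup>2 / 4"
    by (simp_all add: d power2_eq_square)
  show "?dB * p0 = (dot a0 (cross c0 c1))\<^sup>2 + m\<^sup>2 * dot c0 c0"
    "?dB * (2 * dot a0 a1) = 2 * dot a0 (cross c0 c1) * dot a1 (cross c0 c1) + m\<^sup>2 * (2 * dot c0 c1)"
    "?dB * dot a1 a1 = (dot a1 (cross c0 c1))\<^sup>2 + m\<^sup>2 * p3"
    using gram[of c0 c1 a0 a0] gram[of c0 c1 a0 a1] gram[of c0 c1 a1 a1]
    by (simp_all add: d power2_eq_square algebra_simps)
  show "?dA * dot c0 c0 = (dot c0 (cross a0 a1))\<^sup>2 + m\<^sup>2 * p0"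
    "?dA * (2 * dot c0 c1) = 2 * dot c0 (cross a0 a1) * dot c1 (cross a0 a1) + m\<^sup>2 * (2 * dot a0 a1)"
    "?dA * p3 = (dot c1 (cross a0 a1))\<^sup>2 + m\<^sup>2 * dot a1 a1"
    using gram[of a0 a1 c0 c0] gram[of a0 a1 c0 c1] gram[of a0 a1 c1 c1]
    by (simp_all add: d power2_eq_square algebra_simps)
qed

end

section \<open>The field of rational functions in \<open>y\<close> and its constants\<close>

lemma fract_coprime:
  fixes x :: "real poly fract"
  obtains p q where "coprime p q" "q \<noteq> 0" "x = to_fract p / to_fract q"
proof (rule that)
  show "coprime (fst (quot_of_fract x)) (snd (quot_of_fract x))" by (rule coprime_quot_of_fract)
  show "snd (quot_of_fract x) \<noteq> 0" by simp
  show "x = to_fract (fst (quot_of_fract x)) / to_fract (snd (quot_of_fract x))"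
    using quot_to_fract_quot_of_fract[of x] by (simp add: quot_to_fract_def case_prod_unfold Fract_conv_to_fract)
qed

lemma square_dvd_square:
  fixes u v s :: "'a::field_gcd poly"
  assumes "u\<^sup>2 = s * v\<^sup>2" "v \<noteq> 0"
  obtains r where "s = r\<^sup>2"
proof -
  have "v\<^sup>2 dvd u\<^sup>2" using assms(1) by simp
  then have "v dvd u" by simp
  then obtain r where "u = v * r" by (rule dvdE)
  with assms have "r\<^sup>2 = s" by (simp add: power_mult_distrib)
  then show thesis using that by blast
qed

lemma to_fract_square:
  fixes z :: "real poly fract"
  assumes "z\<^sup>2 = to_fract s"
  obtains r where "s = r\<^sup>2"
proof -
  obtain u v where v: "v \<noteq> 0" and z: "z = to_fract u / to_fract v" by (rule fract_coprime)
  have "to_fract (u\<^sup>2) = to_fract (s * v\<^sup>2)"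
    using assms v unfolding z by (simp add: power2_eq_square divide_eq_eq)
  then have "u\<^sup>2 = s * v\<^sup>2" by (simp only: to_fract_eq_iff)
  from square_dvd_square[OF this v that] show thesis .
qed

lemma to_fract_power [simp]: "to_fract (p ^ n) = to_fract p ^ n"
  by (induction n) simp_all

lemma to_fract_of_nat: "to_fract (of_nat n) = of_nat n"
  by (induction n) simp_all

lemma to_fract_numeral [simp]: "to_fract (numeral n) = numeral n"
  using to_fract_of_nat[of "numeral n"] by simp

lemma to_fract_pos: "0 < to_fract p \<longleftrightarrow> 0 < p" for p :: "'a::linordered_idom"
  by (simp add: to_fract_def zero_less_Fract_iff)

lemma poly_pos_iff: "0 < p \<longleftrightarrow> 0 < lead_coeff p" for p :: "'a::linordered_idom poly"
  by (simp add: less_poly_def pos_poly_def last_coeffs_eq_coeff_degree)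

text \<open>A family of polynomials in \<open>T\<close> indexed by real \<open>x\<close>: the
  descent evaluates at real points and needs a real zero of a cubic in \<open>x\<close>.\<close>

definition (in real_case) PT :: "real \<Rightarrow> real poly" where
  "PT x = [:0, 1:] * [:2 * x\<^sup>2 + 1 + 2 * \<beta>, 1:] * ([:x\<^sup>2 + \<beta>, 1:]\<^sup>2 + [:- \<kappa>\<^sup>2, 1:])"

context real_case
begin

text \<open>The graph of \<open>del\<close> on polynomials is fed to the general extension theorem,
  which replaces a construction by the quotient rule.\<close>

lemma del_extension:
  obtains \<delta> where "derivation \<delta>" "\<And>p. \<delta> (to_fract p) = to_fract (del p)"
proof -
  have "deriv_graph (range (\<lambda>p. (to_fract p, to_fract (del p))))"
    unfolding deriv_graph_def
  proof (intro conjI allI impI)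
    show "(1, 0) \<in> range (\<lambda>p. (to_fract p, to_fract (del p)))"
      by (rule range_eqI[of _ _ 1]) (simp add: del_1)
    fix a a' b b' assume "(a, a') \<in> range (\<lambda>p. (to_fract p, to_fract (del p)))" "(b, b') \<in> range (\<lambda>p. (to_fract p, to_fract (del p)))"
    then obtain p q where "a = to_fract p" "a' = to_fract (del p)" "b = to_fract q" "b' = to_fract (del q)" by auto
    note pq = this
    show "(a - b, a' - b') \<in> range (\<lambda>p. (to_fract p, to_fract (del p)))"
      by (rule range_eqI[of _ _ "p - q"]) (simp add: pq del_diff)
    show "(a * b, a * b' + a' * b) \<in> range (\<lambda>p. (to_fract p, to_fract (del p)))"
      by (rule range_eqI[of _ _ "p * q"]) (simp add: pq del_mult)
  next
    fix c assume "(0, c) \<in> range (\<lambda>p. (to_fract p, to_fract (del p)))"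
    then show "c = 0" by (auto simp: del_0)
  qed
  then show thesis
  proof (rule derivation_extension)
    fix \<delta> :: "real poly fract \<Rightarrow> real poly fract"
    assume d: "derivation \<delta>"
      "\<And>a a'. (a, a') \<in> range (\<lambda>p. (to_fract p, to_fract (del p))) \<Longrightarrow> \<delta> a = a'"
    show thesis by (rule that[OF d(1)], rule d(2)) simp
  qed
qed

definition p3 where "p3 = - rt"
definition p2 where "p2 = - rt * (ra + 2 * rb)"
definition p1 where "p1 = - rt * (rb\<^sup>2 - rn + 2 * ra * rb)"
definition p0 where "p0 = - rt * ra * (rb\<^sup>2 - rn)"

context
  fixes \<delta> :: "real poly fract \<Rightarrow> real poly fract"
  assumes \<delta>: "derivation \<delta>" and \<delta>_poly: "\<And>p. \<delta> (to_fract p) = to_fract (del p)"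
begin

interpretation differential_field \<delta>
  by standard (fact \<delta>)

lemma const_iff_W:
  assumes "q \<noteq> 0"
  shows "const (to_fract p / to_fract q) \<longleftrightarrow> W p q = 0"
proof -
  let ?x = "to_fract p / to_fract q"
  have x: "?x * to_fract q = to_fract p" using assms by simp
  then have "to_fract (del p) = \<delta> (?x * to_fract q)" by (simp only: \<delta>_poly)
  also have "\<dots> = ?x * to_fract (del q) + \<delta> ?x * to_fract q" by (simp only: der_mult[OF \<delta>] \<delta>_poly)
  finally have "to_fract q * to_fract (del p) = (?x * to_fract q) * to_fract (del q) + to_fract q * to_fract q * \<delta> ?x"
    by (simp only: ring_distribs mult_ac)
  then have "to_fract q * to_fract q * \<delta> ?x = to_fract (W p q)"
    unfolding x W_def by simp
  then show ?thesis using assms unfolding const_def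
    by (metis mult_eq_0_iff to_fract_eq_0_iff)
qed

lemma const_to_fract: "del p = 0 \<Longrightarrow> const (to_fract p)"
  by (simp add: const_def \<delta>_poly)

lemma P_factor:
  "to_fract p3 * x ^ 3 + to_fract p2 * x\<^sup>2 + to_fract p1 * x + to_fract p0
     = - (to_fract rt * (x + to_fract ra) * ((x + to_fract rb)\<^sup>2 - to_fract rn))"
  unfolding p3_def p2_def p1_def p0_def
  by (simp add: power2_eq_square power3_eq_cube algebra_simps)

lemma clear_denominators:
  fixes p q :: "'b::field"
  assumes "q \<noteq> 0"
  shows "q ^ 4 * (t * (p / q + a) * ((p / q + b)\<^sup>2 - n)) = t * q * (p + a * q) * ((p + b * q)\<^sup>2 - n * q\<^sup>2)"
    "q ^ 4 * (p / q * (t * (p / q + a) * ((p / q + b)\<^sup>2 - n))) = t * p * (p + a * q) * ((p + b * q)\<^sup>2 - n * q\<^sup>2)"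
proof -
  have 1: "p / q + a = (p + a * q) / q" "(p / q + b)\<^sup>2 - n = ((p + b * q)\<^sup>2 - n * q\<^sup>2) / q\<^sup>2"
    using assms by (simp_all add: add_divide_eq_iff divide_add_eq_iff power_divide diff_divide_distrib)
  show "q ^ 4 * (t * (p / q + a) * ((p / q + b)\<^sup>2 - n)) = t * q * (p + a * q) * ((p + b * q)\<^sup>2 - n * q\<^sup>2)"
    "q ^ 4 * (p / q * (t * (p / q + a) * ((p / q + b)\<^sup>2 - n))) = t * p * (p + a * q) * ((p + b * q)\<^sup>2 - n * q\<^sup>2)"
    unfolding 1 using assms by (simp_all add: power2_eq_square power4_eq_xxxx)
qed

text \<open>Writing \<open>x = p / q\<close> in lowest terms and multiplying by \<open>q^4\<close>
  turns \<open>R1\<close> and \<open>R2\<close> into the two Wronskian results. The order on the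
  field is that of the sign of leading coefficients.\<close>

lemma quasi_constant: "quasi_constant \<delta> (to_fract p0) (to_fract p1) (to_fract p2) (to_fract p3)"
proof unfold_locales
  have d: "del p0 = 0" "del p1 = 0" "del p2 = 0" "del p3 = 0"
    by (simp_all add: p0_def p1_def p2_def p3_def del_mult del_add del_diff del_minus del_power2 del_numeral
        del_ra del_rb del_rn del_rt)
  then show "const (to_fract p0)" "const (to_fract p1)" "const (to_fract p2)" "const (to_fract p3)"
    by (simp_all add: const_to_fract)
  have "lead_coeff p3 > 0" by (simp add: p3_def rt_def)
  then show "0 < to_fract p3" by (simp add: to_fract_pos poly_pos_iff)
  have "lead_coeff p0 > 0" by (simp add: p0_def rt_def ra_def rb_def rn_def power2_eq_square)
  then show "0 < to_fract p0" by (simp add: to_fract_pos poly_pos_iff)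
next
  fix x z assume z: "z\<^sup>2 = - (to_fract p3 * x ^ 3 + to_fract p2 * x\<^sup>2 + to_fract p1 * x + to_fract p0)"
  obtain p q where pq: "coprime p q" "q \<noteq> 0" and x: "x = to_fract p / to_fract q" by (rule fract_coprime)
  have "(to_fract q ^ 2 * z)\<^sup>2 = to_fract q ^ 4 * z\<^sup>2" by (simp add: power_mult_distrib flip: power_mult)
  also have "\<dots> = to_fract (rt * q * (p + ra * q) * ((p + rb * q)\<^sup>2 - rn * q\<^sup>2))"
    using clear_denominators(1)[of "to_fract q" "to_fract rt" "to_fract p" "to_fract ra" "to_fract rb" "to_fract rn"] pq(2)
    unfolding z P_factor x by simp
  finally obtain r where "rt * q * (p + ra * q) * ((p + rb * q)\<^sup>2 - rn * q\<^sup>2) = r\<^sup>2" by (rule to_fract_square)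
  from W_eq_0_first[OF pq this[symmetric]] show "const x" using pq(2) by (simp add: x const_iff_W)
next
  fix x z assume z: "z\<^sup>2 = - (x * (to_fract p3 * x ^ 3 + to_fract p2 * x\<^sup>2 + to_fract p1 * x + to_fract p0))"
  obtain p q where pq: "coprime p q" "q \<noteq> 0" and x: "x = to_fract p / to_fract q" by (rule fract_coprime)
  have "(to_fract q ^ 2 * z)\<^sup>2 = to_fract q ^ 4 * z\<^sup>2" by (simp add: power_mult_distrib flip: power_mult)
  also have "\<dots> = to_fract (rt * p * (p + ra * q) * ((p + rb * q)\<^sup>2 - rn * q\<^sup>2))"
    using clear_denominators(2)[of "to_fract q" "to_fract p" "to_fract rt" "to_fract ra" "to_fract rb" "to_fract rn"] pq(2)
    unfolding z P_factor x by simp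
  finally obtain r where "rt * p * (p + ra * q) * ((p + rb * q)\<^sup>2 - rn * q\<^sup>2) = r\<^sup>2" by (rule to_fract_square)
  from W_eq_0_second[OF pq this[symmetric]] show "const x" using pq(2) by (simp add: x const_iff_W)
qed

definition emb :: "real poly \<Rightarrow> real poly fract" where
  "emb p = to_fract (pcompose p T)"

lemma emb_hom: "emb (p + q) = emb p + emb q" "emb (p * q) = emb p * emb q" "emb (p ^ n) = emb p ^ n"
proof -
  show "emb (p + q) = emb p + emb q" and m: "emb (p * q) = emb p * emb q" for p q
    by (simp_all add: emb_def pcompose_add pcompose_mult)
  show "emb (p ^ n) = emb p ^ n"
    by (induction n) (simp_all add: m, simp add: emb_def pcompose_1)
qed

lemma emb_eq_0: "emb p = 0 \<longleftrightarrow> p = 0"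
  by (simp add: emb_def pcompose_eq_0_iff T_def)

lemma emb_inj: "emb p = emb q \<Longrightarrow> p = q"
  using emb_eq_0[of "p - q"] by (simp add: emb_def pcompose_diff)

lemma emb_pos: "0 < emb p \<longleftrightarrow> 0 < lead_coeff p"
proof -
  have "lead_coeff (pcompose p T) = lead_coeff p"
    using lead_coeff_comp[of T p] by (simp add: T_def)
  then show ?thesis by (simp add: emb_def to_fract_pos poly_pos_iff)
qed

text \<open>A constant is a quotient of even polynomials in \<open>y\<close>, and these are
  polynomials in \<open>T\<close>.\<close>

lemma const_emb:
  assumes "const c"
  obtains n g where "n \<noteq> 0" "emb n * c = emb g"
proof -
  obtain p q where pq: "coprime p q" "q \<noteq> 0" and x: "c = to_fract p / to_fract q" by (rule fract_coprime)
  have "W p q = 0" using assms pq by (simp add: x const_iff_W)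
  from even_fraction[OF pq this] obtain g n where
    gn: "n \<noteq> 0" "p * n = g * q" "even_poly g" "even_poly n" .
  obtain g' where g': "g = pcompose g' T" using even_poly_pcompose[OF gn(3)] unfolding T_def .
  obtain n' where n': "n = pcompose n' T" using even_poly_pcompose[OF gn(4)] unfolding T_def .
  have "to_fract n * c = to_fract (p * n) / to_fract q" by (simp add: x)
  also have "\<dots> = to_fract g" using pq by (simp add: gn(2))
  finally have "emb n' * c = emb g'" by (simp add: emb_def g' n')
  then show thesis using that[of n' g'] gn(1) n' by (metis pcompose_0)
qed

lemma const_common_denominator:
  assumes "\<And>c. c \<in> set cs \<Longrightarrow> const c"
  obtains n where "n \<noteq> 0" "\<And>c. c \<in> set cs \<Longrightarrow> \<exists>g. emb n * c = emb g"
proof -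
  have "\<exists>n. n \<noteq> 0 \<and> (\<forall>c\<in>set cs. \<exists>g. emb n * c = emb g)"
    using assms
  proof (induction cs)
    case (Cons c cs)
    then obtain n where n: "n \<noteq> 0" "\<forall>c\<in>set cs. \<exists>g. emb n * c = emb g" by auto
    obtain m h where m: "m \<noteq> 0" "emb m * c = emb h" using const_emb[of c] Cons.prems by auto
    have "emb (m * n) * c = emb (h * n)" using m(2) by (simp add: emb_hom mult_ac)
    moreover have "\<exists>g. emb (m * n) * c = emb g" if c: "c \<in> set cs" for c
    proof -
      obtain g where "emb n * c = emb g" using n(2) c by blast
      then have "emb (m * n) * c = emb (m * g)" by (simp add: emb_hom mult.assoc)
      then show ?thesis by blast
    qed
    ultimately show ?case using m(1) n(1) by (intro exI[of _ "m * n"]) auto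
  qed (auto intro: exI[of _ 1])
  then show thesis using that by blast
qed

lemma constant_form_polys:
  assumes "dot u0 u0 = to_fract p0" "dot u0 v0 = 0" "2 * dot u0 u1 + dot v0 v0 = to_fract p1"
    "dot u0 v1 + dot u1 v0 = 0" "dot u1 u1 + 2 * dot v0 v1 = to_fract p2" "dot u1 v1 = 0" "dot v1 v1 = to_fract p3"
  obtains e f0 f1 d g0 g2 h0 h1 h2 where "e \<noteq> 0" "0 < lead_coeff d"
    "\<And>x. e\<^sup>2 * PT x = [:0, 2:] * ([:x:] ^ 3 * e + [:x:] * f1 + f0)\<^sup>2
       + d * (([:x:]\<^sup>2 * g2 + g0)\<^sup>2 + [:0, 2:] * ([:x:]\<^sup>2 * h2 + [:x:] * h1 + h0)\<^sup>2)"
proof -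
  interpret quasi_constant \<delta> "to_fract p0" "to_fract p1" "to_fract p2" "to_fract p3" by (rule quasi_constant)
  from constant_form_vectors[OF assms] obtain f0 f1 d g0 g2 h0 h1 h2 where form:
    "const f0 \<and> const f1 \<and> const d \<and> const g0 \<and> const g2 \<and> const h0 \<and> const h1 \<and> const h2 \<and> 0 < d \<and>
     (\<forall>x. P (x\<^sup>2) = to_fract p3 * (x ^ 3 + f1 * x + f0)\<^sup>2
        + d * ((g2 * x\<^sup>2 + g0)\<^sup>2 + to_fract p3 * (h2 * x\<^sup>2 + h1 * x + h0)\<^sup>2))"
    unfolding constant_form_def by (elim exE) (rule that)
  then have c: "const f0" "const f1" "const d" "const g0" "const g2" "const h0" "const h1" "const h2" and d: "0 < d"
    and eq: "P (x\<^sup>2) = to_fract p3 * (x ^ 3 + f1 * x + f0)\<^sup>2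
        + d * ((g2 * x\<^sup>2 + g0)\<^sup>2 + to_fract p3 * (h2 * x\<^sup>2 + h1 * x + h0)\<^sup>2)" for x
    by (simp_all only:)
  obtain n where n: "n \<noteq> 0" and ex: "\<And>c. c \<in> set [f0, f1, d, g0, g2, h0, h1, h2] \<Longrightarrow> \<exists>g. emb n * c = emb g"
    by (rule const_common_denominator[of "[f0, f1, d, g0, g2, h0, h1, h2]"]) (use c in force)+
  obtain F0 F1 E G0 G2 H0 H1 H2 where r: "emb n * f0 = emb F0" "emb n * f1 = emb F1" "emb n * d = emb E"
    "emb n * g0 = emb G0" "emb n * g2 = emb G2" "emb n * h0 = emb H0" "emb n * h1 = emb H1" "emb n * h2 = emb H2"
    using ex[of f0] ex[of f1] ex[of d] ex[of g0] ex[of g2] ex[of h0] ex[of h1] ex[of h2] by auto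
  have p3: "to_fract p3 = emb [:0, 2:]"
    by (simp add: p3_def rt_def emb_def T_def pcompose_pCons)
  have P: "P ((emb [:x:])\<^sup>2) = emb (PT x)" for x
  proof -
    have "emb [:x:] = to_fract [:x:]" by (simp add: emb_def)
    moreover have "pcompose (PT x) T = - (rt * ([:x:]\<^sup>2 + ra) * (([:x:]\<^sup>2 + rb)\<^sup>2 - rn))"
      by (simp add: PT_def pcompose_mult pcompose_add pcompose_pCons T_def rt_def ra_def rb_def rn_def
          power2_eq_square algebra_simps)
    ultimately show ?thesis unfolding P_factor by (simp add: emb_def)
  qed
  show thesis
  \<comment> \<open>For a common denominator \<open>n\<close> the identity is multiplied by
    \<open>n^4\<close>: the cubic absorbs \<open>n^2\<close>, while \<open>g\<close> and
    \<open>h\<close> absorb \<open>n\<close> each and \<open>d\<close> absorbs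
    \<open>n^2\<close>.\<close>
  proof (rule that[of "n\<^sup>2" "E * n"])
    show "n\<^sup>2 \<noteq> 0" using n by simp
    have "0 < (emb n)\<^sup>2" using n by (simp add: emb_eq_0)
    then have "0 < (emb n)\<^sup>2 * d" using d by (rule mult_pos_pos)
    also have "(emb n)\<^sup>2 * d = emb (E * n)" by (simp add: emb_hom r(3)[symmetric] power2_eq_square mult_ac)
    finally have "0 < emb (E * n)" .
    then show "0 < lead_coeff (E * n)" by (simp only: emb_pos)
    fix x
    let ?x = "emb [:x:]"
    have "emb ((n\<^sup>2)\<^sup>2 * PT x) = emb n ^ 4 * P (?x\<^sup>2)" unfolding P emb_hom by (simp flip: power_mult)
    also have "\<dots> = to_fract p3 * (emb n * (?x ^ 3 * emb n + ?x * (emb n * f1) + (emb n * f0)))\<^sup>2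
        + (emb n * d) * emb n * ((?x\<^sup>2 * (emb n * g2) + emb n * g0)\<^sup>2
          + to_fract p3 * (?x\<^sup>2 * (emb n * h2) + ?x * (emb n * h1) + emb n * h0)\<^sup>2)"
      unfolding eq by (simp add: power2_eq_square power4_eq_xxxx algebra_simps)
    also have "\<dots> = emb ([:0, 2:] * ([:x:] ^ 3 * n\<^sup>2 + [:x:] * (n * F1) + n * F0)\<^sup>2
       + (E * n) * (([:x:]\<^sup>2 * G2 + G0)\<^sup>2 + [:0, 2:] * ([:x:]\<^sup>2 * H2 + [:x:] * H1 + H0)\<^sup>2))"
      unfolding r p3 emb_hom by (simp add: power2_eq_square algebra_simps)
    finally show "(n\<^sup>2)\<^sup>2 * PT x = [:0, 2:] * ([:x:] ^ 3 * n\<^sup>2 + [:x:] * (n * F1) + n * F0)\<^sup>2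
       + (E * n) * (([:x:]\<^sup>2 * G2 + G0)\<^sup>2 + [:0, 2:] * ([:x:]\<^sup>2 * H2 + [:x:] * H1 + H0)\<^sup>2)"
      by (rule emb_inj)
  qed
qed

end

end

section \<open>Descent\<close>

lemma cubic_has_root:
  fixes a b c :: real
  assumes "a \<noteq> 0"
  obtains x where "a * x ^ 3 + b * x + c = 0"
proof -
  have pos: "\<exists>x. a * x ^ 3 + b * x + c = 0" if a: "0 < a" for a b c :: real
  proof -
    \<comment> \<open>At \<open>X\<close> and \<open>- X\<close> the cubic term outweighs the other
      two, so the values there have opposite weak signs.\<close>
    define X where "X = 1 + (\<bar>b\<bar> + \<bar>c\<bar>) / a"
    have X1: "1 \<le> X" using a by (simp add: X_def)
    have aX: "\<bar>b\<bar> + \<bar>c\<bar> < a * X" using a by (simp add: X_def field_simps)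
    have X2: "X \<le> X\<^sup>2" using X1 by (simp add: power2_eq_square)
    have "\<bar>b\<bar> * X + \<bar>c\<bar> \<le> (\<bar>b\<bar> + \<bar>c\<bar>) * X\<^sup>2"
    proof -
      have "\<bar>b\<bar> * X \<le> \<bar>b\<bar> * X\<^sup>2" using X2 by (intro mult_left_mono) simp_all
      moreover have "\<bar>c\<bar> * 1 \<le> \<bar>c\<bar> * X\<^sup>2" using X1 X2 by (intro mult_left_mono) simp_all
      ultimately show ?thesis by (simp add: distrib_right)
    qed
    also have "\<dots> \<le> a * X * X\<^sup>2" using aX by (intro mult_right_mono) simp_all
    finally have le: "\<bar>b\<bar> * X + \<bar>c\<bar> \<le> a * X ^ 3" by (simp add: power2_eq_square power3_eq_cube mult_ac)
    have bX: "\<bar>b * X\<bar> = \<bar>b\<bar> * X" using X1 by (simp add: abs_mult)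
    have "a * (- X) ^ 3 + b * (- X) + c \<le> 0" "0 \<le> a * X ^ 3 + b * X + c"
      using le bX by auto
    moreover have "continuous_on {- X..X} (\<lambda>x. a * x ^ 3 + b * x + c)" by (intro continuous_intros)
    ultimately show ?thesis using IVT'[of "\<lambda>x. a * x ^ 3 + b * x + c" "- X" 0 X] X1 by auto
  qed
  show thesis
  proof (cases "0 < a")
    case True
    then show ?thesis using pos that by blast
  next
    case False
    then obtain x where "- a * x ^ 3 + - b * x + - c = 0" using pos[of "- a" "- b" "- c"] assms by auto
    then show ?thesis using that[of x] by simp
  qed
qed

lemma root_split: "poly p t = 0 \<longleftrightarrow> (\<exists>q. p = [:- t, 1:] * q)" for p :: "real poly"
  unfolding poly_eq_0_iff_dvd dvd_def ..

section \<open>The norm forms \<open>a^2 + T b^2\<close>\<close>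

lemma norm_form_mult:
  fixes a b c d t :: "'a::comm_ring_1"
  shows "(a\<^sup>2 + t * b\<^sup>2) * (c\<^sup>2 + t * d\<^sup>2) = (a * c - t * (b * d))\<^sup>2 + t * (a * d + b * c)\<^sup>2"
  by (simp add: power2_eq_square algebra_simps)

lemma poly_of_real: "poly (map_poly of_real p) (complex_of_real x) = of_real (poly p x)"
  by (induction p) (simp_all add: map_poly_pCons)

lemma quadratic_dvd_of_complex_root:
  fixes p :: "real poly"
  assumes "poly (map_poly complex_of_real p) z = 0" "Im z \<noteq> 0"
  shows "[:(Re z)\<^sup>2 + (Im z)\<^sup>2, - 2 * Re z, 1:] dvd p"
proof -
  let ?q = "[:(Re z)\<^sup>2 + (Im z)\<^sup>2, - 2 * Re z, 1:]" and ?c = "map_poly complex_of_real"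
  have hom: "?c (a + b) = ?c a + ?c b" "?c (a * b) = ?c a * ?c b" for a b
    by (simp_all add: poly_eq_iff coeff_map_poly coeff_mult)
  have q0: "poly (?c ?q) z = 0"
    by (simp add: map_poly_pCons complex_eq_iff power2_eq_square algebra_simps)
  have "?q * (p div ?q) + p mod ?q = p" by (rule mult_div_mod_eq)
  then have "poly (?c (?q * (p div ?q) + p mod ?q)) z = 0" using assms(1) by simp
  then have m: "poly (?c (p mod ?q)) z = 0" unfolding hom poly_add poly_mult q0 by simp
  have "p mod ?q = 0 \<or> degree (p mod ?q) < 2" using degree_mod_less[of ?q p] by (simp add: numeral_2_eq_2)
  then have "degree (p mod ?q) \<le> 1" by auto
  then have "p mod ?q = [:coeff (p mod ?q) 0, coeff (p mod ?q) 1:]"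
    by (intro poly_eqI) (auto simp: coeff_pCons coeff_eq_0 split: nat.split)
  then obtain a b where ab: "p mod ?q = [:a, b:]" by blast
  from m have "b * Im z = 0" "a + b * Re z = 0"
    unfolding ab by (simp_all add: map_poly_pCons complex_eq_iff mult.commute)
  then have "p mod ?q = 0" using assms(2) unfolding ab by simp
  then show ?thesis by (simp add: mod_eq_0_iff_dvd)
qed

text \<open>Norm forms are multiplicative, so it is enough to treat factors. A real zero
  \<open>r \<le> 0\<close> gives \<open>T - r\<close> with \<open>- r\<close> a square; a complex
  pair of modulus \<open>c\<close> gives \<open>(T - c)^2 + 2 (c - Re z) T\<close>.\<close>

lemma norm_form_of_pos:
  fixes d :: "real poly"
  assumes "\<And>t. 0 < t \<Longrightarrow> poly d t \<noteq> 0" "0 < lead_coeff d"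
  shows "\<exists>a b. d = a\<^sup>2 + [:0, 1:] * b\<^sup>2"
  using assms
proof (induction "degree d" arbitrary: d rule: less_induct)
  case less
  have prod: "\<exists>a b. d = a\<^sup>2 + [:0, 1:] * b\<^sup>2"
    if d: "d = q * s" "lead_coeff q = 1" "0 < degree q" and q: "q = u\<^sup>2 + [:0, 1:] * v\<^sup>2" for q s u v
  proof -
    have s: "0 < lead_coeff s" using less.prems(2) unfolding d(1) lead_coeff_mult d(2) by simp
    then have "degree d = degree q + degree s" unfolding d(1) using d(3) by (intro degree_mult_eq) auto
    then have "degree s < degree d" using d(3) by simp
    moreover have "poly s t \<noteq> 0" if "0 < t" for t using less.prems(1)[OF that] by (auto simp: d(1))
    ultimately obtain a b where "s = a\<^sup>2 + [:0, 1:] * b\<^sup>2" using less.hyps[of s] s by blast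
    then have "d = (u * a - [:0, 1:] * (v * b))\<^sup>2 + [:0, 1:] * (u * b + v * a)\<^sup>2"
      unfolding d(1) q by (simp only: norm_form_mult)
    then show ?thesis by blast
  qed
  show ?case
  proof (cases "degree d = 0")
    case True
    then obtain c where c: "d = [:c:]" by (rule degree_eq_zeroE)
    then have "d = [:sqrt c:]\<^sup>2 + [:0, 1:] * 0\<^sup>2" using less.prems(2) by (simp add: power2_eq_square)
    then show ?thesis by blast
  next
    case False
    have "degree (map_poly complex_of_real d) = degree d" by (rule degree_map_poly) simp
    then have "\<not> constant (poly (map_poly complex_of_real d))" using False by (simp add: constant_degree)
    then obtain z where z: "poly (map_poly complex_of_real d) z = 0"
      using fundamental_theorem_of_algebra by blast
    show ?thesis
    proof (cases "Im z = 0")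
      case True
      then have "z = complex_of_real (Re z)" by (simp add: complex_eq_iff)
      then have "complex_of_real (poly d (Re z)) = 0" using z by (metis poly_of_real)
      then have r: "poly d (Re z) = 0" by simp
      then have le: "Re z \<le> 0" using less.prems(1) by force
      obtain s where ds: "d = [:- Re z, 1:] * s" using r root_split by blast
      have q: "[:- Re z, 1:] = [:sqrt (- Re z):]\<^sup>2 + [:0, 1:] * 1\<^sup>2" using le by (simp add: power2_eq_square)
      show ?thesis by (rule prod[OF ds _ _ q]) simp_all
    next
      case False
      define c where "c = sqrt ((Re z)\<^sup>2 + (Im z)\<^sup>2)"
      have c: "\<bar>Re z\<bar> \<le> c" "c\<^sup>2 = (Re z)\<^sup>2 + (Im z)\<^sup>2" by (simp_all add: c_def)
      obtain s where ds: "d = [:(Re z)\<^sup>2 + (Im z)\<^sup>2, - 2 * Re z, 1:] * s"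
        using quadratic_dvd_of_complex_root[OF z False] by (rule dvdE)
      have q: "[:(Re z)\<^sup>2 + (Im z)\<^sup>2, - 2 * Re z, 1:] = [:- c, 1:]\<^sup>2 + [:0, 1:] * [:sqrt (2 * (c - Re z)):]\<^sup>2"
        using c by (simp add: power2_eq_square)
      show ?thesis by (rule prod[OF ds _ _ q]) simp_all
    qed
  qed
qed

section \<open>Removing the positive zeros of \<open>d\<close>\<close>

context real_case
begin

definition QT :: "real \<Rightarrow> real poly" where
  "QT x = [:2 * x\<^sup>2 + 1 + 2 * \<beta>, 1:] * ([:x\<^sup>2 + \<beta>, 1:]\<^sup>2 + [:- \<kappa>\<^sup>2, 1:])"

lemma PT_QT: "PT x = [:0, 1:] * QT x"
  by (simp only: PT_def QT_def mult.assoc)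

lemma PT_pos:
  assumes "0 < t"
  shows "0 < poly (PT x) t"
proof -
  have "\<beta>\<^sup>2 \<le> (x\<^sup>2 + \<beta> + t)\<^sup>2" using assms beta by (intro power_mono) simp_all
  then have "0 < (x\<^sup>2 + \<beta> + t)\<^sup>2 + t - \<kappa>\<^sup>2" using kappa_bounds assms by linarith
  moreover have "0 < 2 * x\<^sup>2 + 1 + 2 * \<beta> + t" using assms beta by (simp add: add_nonneg_pos)
  moreover have "poly (PT x) t = t * (2 * x\<^sup>2 + 1 + 2 * \<beta> + t) * ((x\<^sup>2 + \<beta> + t)\<^sup>2 + t - \<kappa>\<^sup>2)"
    by (simp add: PT_def algebra_simps)
  ultimately show ?thesis using assms by simp
qed

definition representation where
  "representation e f0 f1 d g0 g2 h0 h1 h2 \<longleftrightarrow> e \<noteq> 0 \<and> 0 < lead_coeff d \<and>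
     (\<forall>x. e\<^sup>2 * PT x = [:0, 2:] * ([:x:] ^ 3 * e + [:x:] * f1 + f0)\<^sup>2
       + d * (([:x:]\<^sup>2 * g2 + g0)\<^sup>2 + [:0, 2:] * ([:x:]\<^sup>2 * h2 + [:x:] * h1 + h0)\<^sup>2))"

text \<open>At a positive zero \<open>t\<close> of \<open>d\<close> the left-hand side is positive for every \<open>x\<close> unless \<open>e\<close> vanishes at \<open>t\<close>,
  whereas a cubic in \<open>x\<close> has a real zero; so \<open>e\<close> vanishes and a factor \<open>T - t\<close> can be cancelled.\<close>
lemma representation_step:
  assumes r: "representation e f0 f1 d g0 g2 h0 h1 h2" and t: "0 < t" "poly d t = 0"
  obtains e' f0' f1' d' g0' g2' h0' h1' h2' where "representation e' f0' f1' d' g0' g2' h0' h1' h2'"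
    "degree d' + degree e' < degree d + degree e"
proof -
  define L where "L = [:- t, 1:]"
  have L: "L \<noteq> 0" "lead_coeff L = 1" "degree L = 1" by (simp_all add: L_def)
  have split: "poly p t = 0 \<Longrightarrow> \<exists>q. p = L * q" for p using root_split by (simp add: L_def)
  have e0: "e \<noteq> 0" and d0: "0 < lead_coeff d"
    and eq: "\<And>x. e\<^sup>2 * PT x = [:0, 2:] * ([:x:] ^ 3 * e + [:x:] * f1 + f0)\<^sup>2
       + d * (([:x:]\<^sup>2 * g2 + g0)\<^sup>2 + [:0, 2:] * ([:x:]\<^sup>2 * h2 + [:x:] * h1 + h0)\<^sup>2)"
    using r by (simp_all add: representation_def)
  have at_t: "(poly e t)\<^sup>2 * poly (PT x) t = t * 2 * (x ^ 3 * poly e t + x * poly f1 t + poly f0 t)\<^sup>2" for x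
    using arg_cong[OF eq, of "\<lambda>p. poly p t" x] t by simp
  have et: "poly e t = 0"
  proof (rule ccontr)
    assume ne: "poly e t \<noteq> 0"
    then obtain x where "poly e t * x ^ 3 + poly f1 t * x + poly f0 t = 0" by (rule cubic_has_root)
    then have "(poly e t)\<^sup>2 * poly (PT x) t = 0" unfolding at_t by (simp add: mult.commute)
    with ne PT_pos[OF t(1), of x] show False by simp
  qed
  \<comment> \<open>As \<open>e\<close> vanishes at \<open>t\<close>, the square of
    \<open>x * poly f1 t + poly f0 t\<close> is zero for every \<open>x\<close>.\<close>
  have f: "poly f0 t = 0" "poly f1 t = 0" using at_t[of 0] at_t[of 1] et t by simp_all
  obtain e' f0' f1' d' where s: "e = L * e'" "f0 = L * f0'" "f1 = L * f1'" "d = L * d'"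
    using split[OF et] split[OF f(1)] split[OF f(2)] split[OF t(2)] by auto
  have e'0: "e' \<noteq> 0" and de: "degree e = degree e' + 1" using e0 L by (auto simp: s degree_mult_eq)
  have ld: "lead_coeff d' = lead_coeff d" using L by (simp add: s lead_coeff_mult)
  have "d' \<noteq> 0" using d0 by (auto simp: s)
  then have dd: "degree d = degree d' + 1" using L by (simp add: s degree_mult_eq)
  have eq1: "L * (e'\<^sup>2 * PT x) = L * ([:0, 2:] * ([:x:] ^ 3 * e' + [:x:] * f1' + f0')\<^sup>2)
       + d' * (([:x:]\<^sup>2 * g2 + g0)\<^sup>2 + [:0, 2:] * ([:x:]\<^sup>2 * h2 + [:x:] * h1 + h0)\<^sup>2)" for x
  proof -
    define S where "S = ([:x:]\<^sup>2 * g2 + g0)\<^sup>2 + [:0, 2:] * ([:x:]\<^sup>2 * h2 + [:x:] * h1 + h0)\<^sup>2"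
    define F where "F = [:x:] ^ 3 * e' + [:x:] * f1' + f0'"
    have "[:x:] ^ 3 * e + [:x:] * f1 + f0 = L * F" by (simp only: F_def s distrib_left mult.left_commute)
    then have "(L * e')\<^sup>2 * PT x = [:0, 2:] * (L * F)\<^sup>2 + L * d' * S"
      using eq[of x] by (simp only: S_def s)
    then have "L * (L * (e'\<^sup>2 * PT x)) = L * (L * ([:0, 2:] * F\<^sup>2) + d' * S)"
      by (simp only: power2_eq_square distrib_left mult_ac)
    then show ?thesis unfolding F_def S_def using L(1) mult_left_cancel by blast
  qed
  show thesis
  \<comment> \<open>At a multiple zero \<open>d\<close> loses \<open>L\<close> twice. At a simple
    zero the bracket vanishes at \<open>t > 0\<close> for all \<open>x\<close>, so \<open>L\<close>
    divides every coefficient of \<open>g\<close> and \<open>h\<close>; then \<open>d\<close> stays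
    and only \<open>e\<close> drops in degree.\<close>
  proof (cases "poly d' t = 0")
    case True
    then obtain d'' where d'': "d' = L * d''" using split by blast
    have dd': "degree d' = degree d'' + 1" using \<open>d' \<noteq> 0\<close> L by (auto simp: d'' degree_mult_eq)
    show ?thesis
    proof (rule that)
      show "representation e' f0' f1' d'' g0 g2 h0 h1 h2"
        unfolding representation_def
      proof (intro conjI allI)
        show "0 < lead_coeff d''" using d0 ld L by (simp add: d'' lead_coeff_mult)
        fix x
        show "e'\<^sup>2 * PT x = [:0, 2:] * ([:x:] ^ 3 * e' + [:x:] * f1' + f0')\<^sup>2
            + d'' * (([:x:]\<^sup>2 * g2 + g0)\<^sup>2 + [:0, 2:] * ([:x:]\<^sup>2 * h2 + [:x:] * h1 + h0)\<^sup>2)"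
          using eq1[of x] unfolding d'' mult.assoc distrib_left[symmetric] mult_left_cancel[OF L(1)] .
      qed (fact e'0)
      show "degree d'' + degree e' < degree d + degree e" using dd dd' de by simp
    qed
  next
    case False
    have 0: "(x\<^sup>2 * poly g2 t + poly g0 t)\<^sup>2 + 2 * t * (x\<^sup>2 * poly h2 t + x * poly h1 t + poly h0 t)\<^sup>2 = 0" for x
      using arg_cong[OF eq1, of "\<lambda>p. poly p t" x] False by (simp add: L_def mult_ac)
    have z: "x\<^sup>2 * poly g2 t + poly g0 t = 0 \<and> x\<^sup>2 * poly h2 t + x * poly h1 t + poly h0 t = 0" for x
      using 0[of x] t(1) by (simp add: add_nonneg_eq_0_iff)
    have "poly g0 t = 0" "poly g2 t = 0" "poly h0 t = 0" "poly h1 t = 0" "poly h2 t = 0"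
      using z[of 0] z[of 1] z[of "-1"] by auto
    then obtain g0' g2' h0' h1' h2' where s': "g0 = L * g0'" "g2 = L * g2'" "h0 = L * h0'" "h1 = L * h1'" "h2 = L * h2'"
      using split by metis
    show ?thesis
    proof (rule that)
      show "representation e' f0' f1' d g0' g2' h0' h1' h2'"
        unfolding representation_def
      proof (intro conjI allI)
        fix x
        define F where "F = [:x:] ^ 3 * e' + [:x:] * f1' + f0'"
        define G where "G = [:x:]\<^sup>2 * g2' + g0'"
        define H where "H = [:x:]\<^sup>2 * h2' + [:x:] * h1' + h0'"
        have "[:x:]\<^sup>2 * g2 + g0 = L * G" "[:x:]\<^sup>2 * h2 + [:x:] * h1 + h0 = L * H"
          by (simp_all only: G_def H_def s' distrib_left mult.left_commute)
        then have "L * (e'\<^sup>2 * PT x) = L * ([:0, 2:] * F\<^sup>2) + d' * ((L * G)\<^sup>2 + [:0, 2:] * (L * H)\<^sup>2)"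
          using eq1[of x] by (simp only: F_def)
        also have "\<dots> = L * ([:0, 2:] * F\<^sup>2 + d * (G\<^sup>2 + [:0, 2:] * H\<^sup>2))"
          by (simp only: s power2_eq_square distrib_left mult_ac)
        finally show "e'\<^sup>2 * PT x = [:0, 2:] * F\<^sup>2 + d * (G\<^sup>2 + [:0, 2:] * H\<^sup>2)"
          using L(1) mult_left_cancel by blast
      qed (fact e'0 d0)+
      show "degree d + degree e' < degree d + degree e" using de by simp
    qed
  qed
qed

lemma representation_positive:
  assumes "representation e f0 f1 d g0 g2 h0 h1 h2"
  obtains e' f0' f1' d' g0' g2' h0' h1' h2' where "representation e' f0' f1' d' g0' g2' h0' h1' h2'"
    "\<forall>t>0. poly d' t \<noteq> 0"
  using assms
proof (induction "degree d + degree e" arbitrary: e f0 f1 d g0 g2 h0 h1 h2 thesis rule: less_induct)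
  case less
  show ?case
  proof (cases "\<exists>t>0. poly d t = 0")
    case True
    then obtain t where t: "0 < t" "poly d t = 0" by blast
    from representation_step[OF less.prems(2) t] obtain e' f0' f1' d' g0' g2' h0' h1' h2' where
      r: "representation e' f0' f1' d' g0' g2' h0' h1' h2'" "degree d' + degree e' < degree d + degree e" .
    show ?thesis by (rule less.hyps[OF r(2) _ r(1)]) (rule less.prems(1))
  next
    case False
    then show ?thesis by (intro less.prems(1)[OF less.prems(2)]) blast
  qed
qed

text \<open>With \<open>d\<close> a norm form, its product with \<open>g^2 + 2 T h^2\<close> is
  again one. Putting \<open>T = 0\<close> forces the non-\<open>T\<close> square to be divisible by
  \<open>T\<close>, so the whole identity can be divided by \<open>T\<close>.\<close>

lemma representation_QT:
  assumes "representation e f0 f1 d g0 g2 h0 h1 h2"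
  obtains e a0 a1 a2 a3 c0 c1 c2 k0 k1 k2 where "e \<noteq> 0"
    "\<And>x. e\<^sup>2 * QT x = ([:x:] ^ 3 * a3 + [:x:]\<^sup>2 * a2 + [:x:] * a1 + a0)\<^sup>2
       + ([:x:]\<^sup>2 * c2 + [:x:] * c1 + c0)\<^sup>2 + [:0, 1:] * ([:x:]\<^sup>2 * k2 + [:x:] * k1 + k0)\<^sup>2"
proof -
  obtain e f0 f1 d g0 g2 h0 h1 h2 where r: "representation e f0 f1 d g0 g2 h0 h1 h2"
    and pos: "\<forall>t>0. poly d t \<noteq> 0"
    using representation_positive[OF assms] .
  then have e0: "e \<noteq> 0" and "0 < lead_coeff d"
    and eq: "\<And>x. e\<^sup>2 * PT x = [:0, 2:] * ([:x:] ^ 3 * e + [:x:] * f1 + f0)\<^sup>2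
       + d * (([:x:]\<^sup>2 * g2 + g0)\<^sup>2 + [:0, 2:] * ([:x:]\<^sup>2 * h2 + [:x:] * h1 + h0)\<^sup>2)"
    by (simp_all add: representation_def)
  from norm_form_of_pos[OF pos[rule_format] this(2)] obtain a b where d: "d = a\<^sup>2 + [:0, 1:] * b\<^sup>2" by blast
  define s and Y :: "real poly" where "s = [:sqrt 2:]" and "Y = [:0, 1:]"
  have Y2: "[:0, 2:] = Y * s\<^sup>2" and Y0: "Y \<noteq> 0" by (simp_all add: Y_def s_def power2_eq_square)
  have eqY: "Y * (e\<^sup>2 * QT x) = Y * (s * ([:x:] ^ 3 * e + [:x:] * f1 + f0))\<^sup>2
      + (a * ([:x:]\<^sup>2 * g2 + g0) - Y * (b * (s * ([:x:]\<^sup>2 * h2 + [:x:] * h1 + h0))))\<^sup>2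
      + Y * (a * (s * ([:x:]\<^sup>2 * h2 + [:x:] * h1 + h0)) + b * ([:x:]\<^sup>2 * g2 + g0))\<^sup>2" for x
  proof -
    define f g h where "f = [:x:] ^ 3 * e + [:x:] * f1 + f0" and "g = [:x:]\<^sup>2 * g2 + g0"
      and "h = [:x:]\<^sup>2 * h2 + [:x:] * h1 + h0"
    have "Y * (e\<^sup>2 * QT x) = Y * (s * f)\<^sup>2 + (a\<^sup>2 + Y * b\<^sup>2) * (g\<^sup>2 + Y * (s * h)\<^sup>2)"
      using eq[of x] unfolding PT_QT d Y2 f_def[symmetric] g_def[symmetric] h_def[symmetric] Y_def[symmetric]
      by (simp only: power_mult_distrib mult_ac)
    then show ?thesis unfolding norm_form_mult f_def g_def h_def by (simp only: add.assoc)
  qed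
  have "poly a 0 * (x\<^sup>2 * poly g2 0 + poly g0 0) = 0" for x
    using arg_cong[OF eqY, of "\<lambda>p. poly p 0" x] by (simp add: Y_def)
  from this[of 0] this[of 1] have "poly (a * g0) 0 = 0" "poly (a * g2) 0 = 0" by auto
  then obtain k0 k2 where k: "a * g0 = Y * k0" "a * g2 = Y * k2"
    unfolding root_split Y_def by auto
  show thesis
  proof (rule that[OF e0])
    fix x
    have "Y * (e\<^sup>2 * QT x) = Y * ((s * ([:x:] ^ 3 * e + [:x:] * f1 + f0))\<^sup>2
      + (a * (s * ([:x:]\<^sup>2 * h2 + [:x:] * h1 + h0)) + b * ([:x:]\<^sup>2 * g2 + g0))\<^sup>2
      + Y * ([:x:]\<^sup>2 * k2 + k0 - b * (s * ([:x:]\<^sup>2 * h2 + [:x:] * h1 + h0)))\<^sup>2)"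
    proof -
      have "a * ([:x:]\<^sup>2 * g2 + g0) = Y * ([:x:]\<^sup>2 * k2 + k0)"
      proof -
        have "a * (X * g2 + g0) = X * (a * g2) + a * g0" for X by (simp only: distrib_left mult.left_commute)
        also have "X * (a * g2) + a * g0 = Y * (X * k2 + k0)" for X
          unfolding k by (simp only: distrib_left mult.left_commute)
        finally show ?thesis .
      qed
      then show ?thesis unfolding eqY by (simp only: right_diff_distrib[symmetric]) (simp add: power2_eq_square distrib_left mult_ac)
    qed
    then have "e\<^sup>2 * QT x = (s * ([:x:] ^ 3 * e + [:x:] * f1 + f0))\<^sup>2
      + (a * (s * ([:x:]\<^sup>2 * h2 + [:x:] * h1 + h0)) + b * ([:x:]\<^sup>2 * g2 + g0))\<^sup>2
      + Y * ([:x:]\<^sup>2 * k2 + k0 - b * (s * ([:x:]\<^sup>2 * h2 + [:x:] * h1 + h0)))\<^sup>2"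
      using Y0 mult_left_cancel by blast
    moreover have "s * ([:x:] ^ 3 * e + [:x:] * f1 + f0) = [:x:] ^ 3 * (s * e) + [:x:]\<^sup>2 * 0 + [:x:] * (s * f1) + s * f0"
      "a * (s * ([:x:]\<^sup>2 * h2 + [:x:] * h1 + h0)) + b * ([:x:]\<^sup>2 * g2 + g0)
        = [:x:]\<^sup>2 * (a * (s * h2) + b * g2) + [:x:] * (a * (s * h1)) + (a * (s * h0) + b * g0)"
      "[:x:]\<^sup>2 * k2 + k0 - b * (s * ([:x:]\<^sup>2 * h2 + [:x:] * h1 + h0))
        = [:x:]\<^sup>2 * (k2 - b * (s * h2)) + [:x:] * (- b * (s * h1)) + (k0 - b * (s * h0))"
      by (simp_all add: algebra_simps)
    ultimately show "e\<^sup>2 * QT x = ([:x:] ^ 3 * (s * e) + [:x:]\<^sup>2 * 0 + [:x:] * (s * f1) + s * f0)\<^sup>2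
      + ([:x:]\<^sup>2 * (a * (s * h2) + b * g2) + [:x:] * (a * (s * h1)) + (a * (s * h0) + b * g0))\<^sup>2
      + [:0, 1:] * ([:x:]\<^sup>2 * (k2 - b * (s * h2)) + [:x:] * (- b * (s * h1)) + (k0 - b * (s * h0)))\<^sup>2"
      by (simp only: Y_def)
  qed
qed

end

section \<open>Clearing denominators and decompositions of degree one\<close>

lemma eval2_simps:
  "eval2 (p + q) a b = eval2 p a b + eval2 q a b" "eval2 (p * q) a b = eval2 p a b * eval2 q a b"
  "eval2 (p ^ n) a b = eval2 p a b ^ n" "eval2 [:r:] a b = poly r a" "eval2 0 a b = 0"
  "eval2 (pCons r p) a b = poly r a + b * eval2 p a b" "eval2 (smult r p) a b = poly r a * eval2 p a b"
  by (simp_all add: eval2_def)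

lemma eval2_eqI:
  fixes p q :: "real poly poly"
  assumes "\<And>a b. eval2 p a b = eval2 q a b"
  shows "p = q"
proof -
  have "poly (p - q) [:b:] = 0" for b
  proof -
    have "\<forall>a. poly (poly (p - q) [:b:]) a = 0" using assms by (simp add: eval2_def)
    then show ?thesis by (simp only: poly_all_0_iff_0)
  qed
  then have "range (\<lambda>b. [:b:]) \<subseteq> {x. poly (p - q) x = 0}" by auto
  moreover have "infinite (range (\<lambda>b :: real. [:b:]))"
    using finite_imageD[of "\<lambda>b :: real. [:b:]" UNIV] infinite_UNIV_char_0 by (auto simp: inj_def)
  ultimately have "infinite {x. poly (p - q) x = 0}" using finite_subset by blast
  then have "p - q = 0" using poly_roots_finite by blast
  then show ?thesis by simp
qed

definition outer_poly :: "'a::comm_ring_1 poly \<Rightarrow> 'a poly poly" where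
  "outer_poly p = map_poly (\<lambda>c. [:c:]) p"

lemma eval2_outer_poly: "eval2 (outer_poly p) a b = poly p b"
  unfolding outer_poly_def by (induction p) (simp_all add: map_poly_pCons eval2_simps)

text \<open>Cassels--Pfister works in the outer variable, so \<open>x\<close> has to be moved
  outside before it can be applied over the field of rational functions in \<open>y\<close>.\<close>

lemma ex_swap_scale:
  fixes p :: "'a::comm_ring_1 poly poly"
  shows "\<exists>q. \<forall>a b. eval2 q b a = eval2 p (s * a) (s * b)"
proof (induction p)
  case 0
  show ?case by (rule exI[of _ 0]) (simp add: eval2_simps)
next
  case (pCons c p)
  then obtain q where "\<forall>a b. eval2 q b a = eval2 p (s * a) (s * b)" by blast
  then show ?case
    by (intro exI[of _ "outer_poly (pcompose c [:0, s:]) + [:[:0, s:]:] * q"])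
      (simp add: eval2_simps eval2_outer_poly poly_pcompose mult_ac)
qed

lemma fract_quotient:
  obtains a b where "b \<noteq> 0" "x = to_fract a / to_fract b"
  by (cases x) (simp add: Fract_conv_to_fract)

lemma common_denominator:
  obtains s where "s \<noteq> 0" "\<And>x. x \<in> set xs \<Longrightarrow> \<exists>a. to_fract a = to_fract s * x"
proof -
  have "\<exists>s. s \<noteq> 0 \<and> (\<forall>x\<in>set xs. \<exists>a. to_fract a = to_fract s * x)"
  proof (induction xs)
    case (Cons y xs)
    then obtain s where s: "s \<noteq> 0" "\<forall>x\<in>set xs. \<exists>a. to_fract a = to_fract s * x" by blast
    obtain b c where y: "c \<noteq> 0" "y = to_fract b / to_fract c" by (rule fract_quotient)
    have "\<exists>a. to_fract a = to_fract (c * s) * x" if x: "x \<in> set (y # xs)" for x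
    proof (cases "x = y")
      case True
      then have "to_fract (b * s) = to_fract (c * s) * x" using y by simp
      then show ?thesis by blast
    next
      case False
      then obtain a where "to_fract a = to_fract s * x" using s(2) x by auto
      then have "to_fract (c * a) = to_fract (c * s) * x" by simp
      then show ?thesis by blast
    qed
    then show ?case using y(1) s(1) by (intro exI[of _ "c * s"]) simp
  qed (auto intro: exI[of _ 1])
  then show thesis using that by blast
qed

lemma clear_denominators_three_squares:
  fixes p :: "'a::idom"
  assumes "to_fract p = f\<^sup>2 + g\<^sup>2 + h\<^sup>2"
  obtains e u v w where "e \<noteq> 0" "e\<^sup>2 * p = u\<^sup>2 + v\<^sup>2 + w\<^sup>2"
proof -
  obtain e where e: "e \<noteq> 0" and ex: "\<And>x. x \<in> set [f, g, h] \<Longrightarrow> \<exists>a. to_fract a = to_fract e * x"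
    by (rule common_denominator[of "[f, g, h]"], rule that)
  obtain u v w where r: "to_fract u = to_fract e * f" "to_fract v = to_fract e * g" "to_fract w = to_fract e * h"
    using ex[of f] ex[of g] ex[of h] by auto
  have "to_fract (e\<^sup>2 * p) = to_fract (u\<^sup>2 + v\<^sup>2 + w\<^sup>2)"
    using assms by (simp add: r power2_eq_square algebra_simps)
  then show thesis using that[OF e] by (simp only: to_fract_eq_iff)
qed

lemma lead_coeff_nonneg:
  fixes p :: "'a::linordered_idom poly"
  assumes "0 \<le> p" shows "0 \<le> lead_coeff p"
  using assms poly_pos_iff[of p] by (cases "p = 0") (auto simp: le_less)

lemma degree_le_of_add_nonneg:
  fixes p q :: "'a::linordered_idom poly"
  assumes "0 \<le> p" "0 \<le> q"
  shows "degree p \<le> degree (p + q)" "degree q \<le> degree (p + q)"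
  using degree_add_nonneg[OF assms[THEN lead_coeff_nonneg]] .

lemma degree_le_1_eq: "degree p \<le> 1 \<Longrightarrow> p = [:coeff p 0, coeff p 1:]"
  by (intro poly_eqI) (auto simp: coeff_pCons coeff_eq_0 split: nat.split)

lemma degree_le_3_eq: "degree p \<le> 3 \<Longrightarrow> p = [:coeff p 0, coeff p 1, coeff p 2, coeff p 3:]"
  by (intro poly_eqI) (auto simp: coeff_pCons coeff_eq_0 numeral_2_eq_2 numeral_3_eq_3 split: nat.split)

lemma pos_X: "0 < ([:0, 1:] :: 'a::linordered_idom poly)"
  by (simp add: poly_pos_iff)

section \<open>The two applications of Cassels--Pfister\<close>

context real_case
begin

text \<open>Over the rational functions in \<open>y\<close> the three squares become squares of
  polynomials in \<open>x\<close>. Squares cannot cancel in an ordered field, so degree 6 leaves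
  cubics, whose coefficient vectors are the four required.\<close>

lemma sum_of_three_squares_vectors:
  fixes p :: "real poly poly"
  assumes s: "s \<noteq> 0" and p: "\<And>x y. eval2 p (s * x) (s * y) = s ^ 8 * poly (PT x) (y\<^sup>2 + \<theta>)"
    and "to_fract p = f\<^sup>2 + g\<^sup>2 + h\<^sup>2"
  obtains u0 v0 u1 v1 where "dot u0 u0 = to_fract p0" "dot u0 v0 = 0" "2 * dot u0 u1 + dot v0 v0 = to_fract p1"
    "dot u0 v1 + dot u1 v0 = 0" "dot u1 u1 + 2 * dot v0 v1 = to_fract p2" "dot u1 v1 = 0" "dot v1 v1 = to_fract p3"
proof -
  obtain e a b c where e: "e \<noteq> 0" and eq: "e\<^sup>2 * p = a\<^sup>2 + b\<^sup>2 + c\<^sup>2"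
    using assms(3) by (rule clear_denominators_three_squares)
  obtain e' where e': "\<forall>x y. eval2 e' y x = eval2 e (s * x) (s * y)" using ex_swap_scale by blast
  obtain a' where a': "\<forall>x y. eval2 a' y x = eval2 a (s * x) (s * y)" using ex_swap_scale by blast
  obtain b' where b': "\<forall>x y. eval2 b' y x = eval2 b (s * x) (s * y)" using ex_swap_scale by blast
  obtain c' where c': "\<forall>x y. eval2 c' y x = eval2 c (s * x) (s * y)" using ex_swap_scale by blast
  define P where "P = [:p0, 0, p1, 0, p2, 0, p3:]"
  have P: "eval2 P y x = poly (PT x) (y\<^sup>2 + \<theta>)" for x y
  proof -
    define t where "t = y\<^sup>2 + \<theta>"
    have r: "poly rt y = - 2 * t" "poly ra y = (t + 1) / 2 + \<beta>" "poly rb y = t + \<beta>" "poly rn y = \<kappa>\<^sup>2 - t"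
      by (simp_all add: rt_def ra_def rb_def rn_def t_def power2_eq_square field_simps)
    have "eval2 P y x = - poly rt y * (x\<^sup>2 + poly ra y) * ((x\<^sup>2 + poly rb y)\<^sup>2 - poly rn y)"
      unfolding P_def p0_def p1_def p2_def p3_def eval2_simps poly_mult poly_add poly_diff poly_minus poly_power
      by (simp add: power2_eq_square algebra_simps)
    also have "\<dots> = t * (2 * x\<^sup>2 + 1 + 2 * \<beta> + t) * ((x\<^sup>2 + \<beta> + t)\<^sup>2 + (- \<kappa>\<^sup>2 + t))"
    proof -
      have "2 * x\<^sup>2 + 1 + 2 * \<beta> + t = 2 * (x\<^sup>2 + ((t + 1) / 2 + \<beta>))" by (simp add: field_simps)
      moreover have "(x\<^sup>2 + \<beta> + t)\<^sup>2 + (- \<kappa>\<^sup>2 + t) = (x\<^sup>2 + (t + \<beta>))\<^sup>2 - (\<kappa>\<^sup>2 - t)" by (simp add: add_ac)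
      moreover have "- (- 2 * t) * a * b = t * (2 * a) * b" for a b :: real by simp
      ultimately show ?thesis unfolding r by (simp only:)
    qed
    also have "\<dots> = poly (PT x) t"
    proof -
      have "poly [:2 * x\<^sup>2 + 1 + 2 * \<beta>, 1:] t = 2 * x\<^sup>2 + 1 + 2 * \<beta> + t" "poly [:x\<^sup>2 + \<beta>, 1:] t = x\<^sup>2 + \<beta> + t"
        "poly [:- \<kappa>\<^sup>2, 1:] t = - \<kappa>\<^sup>2 + t" "poly [:0, 1:] t = t" by simp_all
      then show ?thesis unfolding PT_def poly_mult poly_add poly_power by simp
    qed
    finally show ?thesis by (simp only: t_def)
  qed
  have "([:[:s ^ 4:]:] * e')\<^sup>2 * P = a'\<^sup>2 + b'\<^sup>2 + c'\<^sup>2"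
  proof (rule eval2_eqI)
    fix y x
    have "eval2 (([:[:s ^ 4:]:] * e')\<^sup>2 * P) y x = (eval2 e (s * x) (s * y))\<^sup>2 * (s ^ 8 * eval2 P y x)"
      by (simp add: eval2_simps e' power_mult_distrib flip: power_mult)
    also have "\<dots> = eval2 (e\<^sup>2 * p) (s * x) (s * y)" unfolding P p[symmetric] by (simp add: eval2_simps)
    also have "\<dots> = eval2 (a'\<^sup>2 + b'\<^sup>2 + c'\<^sup>2) y x" unfolding eq by (simp add: eval2_simps a' b' c')
    finally show "eval2 (([:[:s ^ 4:]:] * e')\<^sup>2 * P) y x = eval2 (a'\<^sup>2 + b'\<^sup>2 + c'\<^sup>2) y x" .
  qed
  from arg_cong[OF this, of fract_poly]
  have eq': "(fract_poly ([:[:s ^ 4:]:] * e'))\<^sup>2 * fract_poly P = (fract_poly a')\<^sup>2 + (fract_poly b')\<^sup>2 + 1 * (fract_poly c')\<^sup>2"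
    by (simp only: power2_eq_square fract_poly_add fract_poly_mult mult_1)
  have nz: "fract_poly ([:[:s ^ 4:]:] * e') \<noteq> 0"
  proof
    assume "fract_poly ([:[:s ^ 4:]:] * e') = 0"
    then have "e' = 0" using s by simp
    have "e = 0"
    proof (rule eval2_eqI)
      fix x y
      have "eval2 e (s * (x / s)) (s * (y / s)) = 0" using e' \<open>e' = 0\<close> by (metis eval2_simps(5))
      then show "eval2 e x y = eval2 0 x y" using s by (simp add: eval2_simps)
    qed
    with e show False by simp
  qed
  have aniso: "u = 0 \<and> v = 0 \<and> w = 0" if "u\<^sup>2 + v\<^sup>2 + 1 * w\<^sup>2 = 0" for u v w :: "real poly fract poly"
    using that by (simp add: add_nonneg_eq_0_iff)
  obtain u v w where uvw: "fract_poly P = u\<^sup>2 + v\<^sup>2 + 1 * w\<^sup>2"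
    using cassels_pfister[OF _ aniso nz eq'] by fastforce
  have P': "fract_poly P = [:to_fract p0, 0, to_fract p1, 0, to_fract p2, 0, to_fract p3:]"
    by (simp add: P_def map_poly_pCons)
  have "p3 \<noteq> 0" by (simp add: p3_def rt_def)
  then have dP: "degree (fract_poly P) = 6" by (simp add: P')
  have sq: "0 \<le> u\<^sup>2" for u :: "real poly fract poly" by simp
  have "degree (u\<^sup>2) \<le> 6" "degree (v\<^sup>2) \<le> 6" "degree (w\<^sup>2) \<le> 6"
    using degree_le_of_add_nonneg(1)[OF sq[of u] add_nonneg_nonneg[OF sq[of v] sq[of w]]]
      degree_le_of_add_nonneg(1)[OF sq[of v] add_nonneg_nonneg[OF sq[of u] sq[of w]]]
      degree_le_of_add_nonneg(1)[OF sq[of w] add_nonneg_nonneg[OF sq[of u] sq[of v]]] dP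
    unfolding uvw by (simp_all add: ac_simps)
  then have d: "degree u \<le> 3" "degree v \<le> 3" "degree w \<le> 3"
    by (cases "u = 0"; cases "v = 0"; cases "w = 0"; simp add: degree_power_eq)+
  obtain u0 u1 u2 u3 where u: "u = [:u0, u1, u2, u3:]" using degree_le_3_eq[OF d(1)] by blast
  obtain v0 v1 v2 v3 where v: "v = [:v0, v1, v2, v3:]" using degree_le_3_eq[OF d(2)] by blast
  obtain w0 w1 w2 w3 where w: "w = [:w0, w1, w2, w3:]" using degree_le_3_eq[OF d(3)] by blast
  show thesis
    by (rule that[of "(u0, v0, w0)" "(u1, v1, w1)" "(u2, v2, w2)" "(u3, v3, w3)"])
      (use uvw[unfolded P' u v w] in \<open>simp_all add: dot_def power2_eq_square algebra_simps\<close>)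
qed

text \<open>With \<open>X = x^2 + \<beta>\<close> these are \<open>2 X + 1\<close> and
  \<open>X^2 - \<kappa>^2\<close>; then \<open>QT\<close> is
  \<open>(T + xa) (T^2 + xa T + xe)\<close>.\<close>

definition xa :: "real poly" where "xa = [:2 * \<beta> + 1, 0, 2:]"
definition xe :: "real poly" where "xe = [:\<beta>\<^sup>2 - \<kappa>\<^sup>2, 0, 2 * \<beta>, 0, 1:]"

text \<open>Cassels--Pfister over the rational functions in \<open>x\<close> with
  \<open>c = T\<close>; degree 3 makes all three forms linear in \<open>T\<close>. The equations
  compare their coefficients.\<close>

lemma QT_linear_forms:
  assumes "representation e f0 f1 d g0 g2 h0 h1 h2"
  obtains u0 u1 v0 v1 w s where "s \<noteq> 0" "u0\<^sup>2 + v0\<^sup>2 = xa * xe * s\<^sup>2"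
    "u1\<^sup>2 + v1\<^sup>2 + 2 * w * s = 2 * xa * s\<^sup>2" "2 * (u0 * u1 + v0 * v1) + w\<^sup>2 = (xa\<^sup>2 + xe) * s\<^sup>2"
proof -
  obtain e a3 a2 a1 a0 c2 c1 c0 k2 k1 k0 where e: "e \<noteq> 0" and
    eq: "\<And>x. e\<^sup>2 * QT x = ([:x:] ^ 3 * a3 + [:x:]\<^sup>2 * a2 + [:x:] * a1 + a0)\<^sup>2
       + ([:x:]\<^sup>2 * c2 + [:x:] * c1 + c0)\<^sup>2 + [:0, 1:] * ([:x:]\<^sup>2 * k2 + [:x:] * k1 + k0)\<^sup>2"
    by (rule representation_QT[OF assms], rule that)
  let ?o = outer_poly
  define x :: "real poly poly" where "x = [:[:0, 1:]:]"
  define Q where "Q = [:xa * xe, xa\<^sup>2 + xe, 2 * xa, 1:]"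
  define a c k where "a = x ^ 3 * ?o a3 + x\<^sup>2 * ?o a2 + x * ?o a1 + ?o a0"
    and "c = x\<^sup>2 * ?o c2 + x * ?o c1 + ?o c0" and "k = x\<^sup>2 * ?o k2 + x * ?o k1 + ?o k0"
  have "(?o e)\<^sup>2 * Q = a\<^sup>2 + c\<^sup>2 + [:0, 1:] * k\<^sup>2"
  proof (rule eval2_eqI)
    fix y t
    have "eval2 Q y t = poly (QT y) t"
      by (simp add: Q_def QT_def xa_def xe_def eval2_simps power2_eq_square algebra_simps)
    moreover have "eval2 a y t = poly ([:y:] ^ 3 * a3 + [:y:]\<^sup>2 * a2 + [:y:] * a1 + a0) t"
      "eval2 c y t = poly ([:y:]\<^sup>2 * c2 + [:y:] * c1 + c0) t"
      "eval2 k y t = poly ([:y:]\<^sup>2 * k2 + [:y:] * k1 + k0) t"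
      by (simp_all add: a_def c_def k_def x_def eval2_simps eval2_outer_poly)
    ultimately show "eval2 ((?o e)\<^sup>2 * Q) y t = eval2 (a\<^sup>2 + c\<^sup>2 + [:0, 1:] * k\<^sup>2) y t"
      using arg_cong[OF eq[of y], of "\<lambda>p. poly p t"]
      by (simp only: eval2_simps eval2_outer_poly poly_mult poly_add poly_power) simp
  qed
  from arg_cong[OF this, of fract_poly]
  have eq': "(fract_poly (?o e))\<^sup>2 * fract_poly Q = (fract_poly a)\<^sup>2 + (fract_poly c)\<^sup>2 + [:0, 1:] * (fract_poly k)\<^sup>2"
    by (simp only: power2_eq_square fract_poly_add fract_poly_mult) (simp add: map_poly_pCons)
  have "?o e \<noteq> 0"
  proof
    assume "?o e = 0"
    then have "poly e t = 0" for t using eval2_outer_poly[of e 0 t] by (simp add: eval2_simps)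
    with e show False using poly_all_0_iff_0 by blast
  qed
  then have nz: "fract_poly (?o e) \<noteq> 0" by simp
  have aniso: "u = 0 \<and> v = 0 \<and> w = 0" if "u\<^sup>2 + v\<^sup>2 + [:0, 1:] * w\<^sup>2 = 0" for u v w :: "real poly fract poly"
  proof -
    have "0 \<le> [:0, 1:] * w\<^sup>2" by (rule mult_nonneg_nonneg[OF less_imp_le[OF pos_X] zero_le_power2])
    then have "u\<^sup>2 + v\<^sup>2 = 0 \<and> [:0, 1:] * w\<^sup>2 = 0"
      using that add_nonneg_eq_0_iff[of "u\<^sup>2 + v\<^sup>2" "[:0, 1:] * w\<^sup>2"] by (simp only: add_nonneg_nonneg zero_le_power2)
    then show ?thesis by (simp add: add_nonneg_eq_0_iff)
  qed
  obtain u v w where uvw: "fract_poly Q = u\<^sup>2 + v\<^sup>2 + [:0, 1:] * w\<^sup>2"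
    using cassels_pfister[OF _ aniso nz eq'] by fastforce
  have Q': "fract_poly Q = [:to_fract (xa * xe), to_fract (xa\<^sup>2 + xe), to_fract (2 * xa), 1:]"
    by (simp add: Q_def map_poly_pCons)
  then have dQ: "degree (fract_poly Q) = 3" by simp
  have sq: "0 \<le> u\<^sup>2" for u :: "real poly fract poly" by simp
  have sqX: "0 \<le> [:0, 1:] * w\<^sup>2" by (rule mult_nonneg_nonneg[OF less_imp_le[OF pos_X] zero_le_power2])
  have "degree (u\<^sup>2) \<le> 3" "degree (v\<^sup>2) \<le> 3" "degree ([:0, 1:] * w\<^sup>2) \<le> 3"
    using degree_le_of_add_nonneg(1)[OF sq[of u] add_nonneg_nonneg[OF sq[of v] sqX]]
      degree_le_of_add_nonneg(1)[OF sq[of v] add_nonneg_nonneg[OF sq[of u] sqX]]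
      degree_le_of_add_nonneg(1)[OF sqX add_nonneg_nonneg[OF sq[of u] sq[of v]]] dQ
    unfolding uvw by (simp_all only: ac_simps)
  then have d: "degree u \<le> 1" "degree v \<le> 1" "degree w \<le> 1"
    by (cases "u = 0"; cases "v = 0"; cases "w = 0"; simp add: degree_power_eq degree_mult_eq)+
  obtain u0 u1 where u: "u = [:u0, u1:]" using degree_le_1_eq[OF d(1)] by blast
  obtain v0 v1 where v: "v = [:v0, v1:]" using degree_le_1_eq[OF d(2)] by blast
  obtain w0 w1 where w: "w = [:w0, w1:]" using degree_le_1_eq[OF d(3)] by blast
  have rel: "u0\<^sup>2 + v0\<^sup>2 = to_fract (xa * xe)" "2 * (u0 * u1 + v0 * v1) + w0\<^sup>2 = to_fract (xa\<^sup>2 + xe)"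
    "u1\<^sup>2 + v1\<^sup>2 + 2 * (w0 * w1) = to_fract (2 * xa)" "w1\<^sup>2 = 1"
    using uvw[unfolded Q' u v w] by (simp_all add: power2_eq_square algebra_simps)
  \<comment> \<open>The leading coefficient \<open>w1\<close> is a sign, so \<open>w0\<close> may be
    replaced by \<open>w0 * w1\<close>; this normalises the last form to
    \<open>w + s T\<close>.\<close>
  have rel2: "2 * (u0 * u1 + v0 * v1) + (w0 * w1)\<^sup>2 = to_fract (xa\<^sup>2 + xe)"
    using rel by (simp add: power_mult_distrib)
  obtain S where S: "S \<noteq> 0"
    and ex: "\<And>x. x \<in> set [u0, u1, v0, v1, w0 * w1] \<Longrightarrow> \<exists>a. to_fract a = to_fract S * x"
    by (rule common_denominator[of "[u0, u1, v0, v1, w0 * w1]"], rule that)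
  obtain U0 U1 V0 V1 W where r: "to_fract U0 = to_fract S * u0" "to_fract U1 = to_fract S * u1"
    "to_fract V0 = to_fract S * v0" "to_fract V1 = to_fract S * v1" "to_fract W = to_fract S * (w0 * w1)"
    using ex[of u0] ex[of u1] ex[of v0] ex[of v1] ex[of "w0 * w1"] by auto
  have "to_fract (U0\<^sup>2 + V0\<^sup>2) = (to_fract S)\<^sup>2 * (u0\<^sup>2 + v0\<^sup>2)"
    "to_fract (U1\<^sup>2 + V1\<^sup>2 + 2 * W * S) = (to_fract S)\<^sup>2 * (u1\<^sup>2 + v1\<^sup>2 + 2 * (w0 * w1))"
    "to_fract (2 * (U0 * U1 + V0 * V1) + W\<^sup>2) = (to_fract S)\<^sup>2 * (2 * (u0 * u1 + v0 * v1) + (w0 * w1)\<^sup>2)"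
    by (simp_all add: r power2_eq_square algebra_simps)
  then have "to_fract (U0\<^sup>2 + V0\<^sup>2) = to_fract (xa * xe * S\<^sup>2)"
    "to_fract (U1\<^sup>2 + V1\<^sup>2 + 2 * W * S) = to_fract (2 * xa * S\<^sup>2)"
    "to_fract (2 * (U0 * U1 + V0 * V1) + W\<^sup>2) = to_fract ((xa\<^sup>2 + xe) * S\<^sup>2)"
    unfolding rel rel2 by (simp_all only: to_fract_mult to_fract_power mult_ac)
  then show thesis using that[OF S] by (simp only: to_fract_eq_iff)
qed

end

section \<open>Complex coefficients and the root in \<open>T\<close>\<close>

lemma derivation_complex:
  assumes "derivation D"
  shows "derivation (\<lambda>z. Complex (D (Re z)) (D (Im z)))"
  unfolding derivation_def
  by (simp add: complex_eq_iff der_add[OF assms] der_diff[OF assms] der_mult[OF assms] algebra_simps)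

lemma map_poly_ring_hom:
  fixes \<phi> :: "'a::comm_ring_1 \<Rightarrow> 'b::comm_ring_1"
  assumes "\<phi> 0 = 0" "\<And>a b. \<phi> (a + b) = \<phi> a + \<phi> b" "\<And>a b. \<phi> (a * b) = \<phi> a * \<phi> b"
  shows "map_poly \<phi> (p + q) = map_poly \<phi> p + map_poly \<phi> q" "map_poly \<phi> (p * q) = map_poly \<phi> p * map_poly \<phi> q"
proof -
  show add: "map_poly \<phi> (p + q) = map_poly \<phi> p + map_poly \<phi> q" for p q
    by (intro poly_eqI) (simp add: coeff_map_poly assms)
  have smult: "map_poly \<phi> (smult c q) = smult (\<phi> c) (map_poly \<phi> q)" for c
    by (intro poly_eqI) (simp add: coeff_map_poly assms)
  show "map_poly \<phi> (p * q) = map_poly \<phi> p * map_poly \<phi> q"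
    by (induction p) (simp_all add: map_poly_pCons assms(1) add smult)
qed

lemma poly_map_cnj: "poly (map_poly cnj p) z = cnj (poly p (cnj z))"
  by (induction p) (simp_all add: map_poly_pCons)

lemmas cnj_hom = map_poly_ring_hom[of cnj, simplified]
  and of_real_hom = map_poly_ring_hom[of complex_of_real, simplified]

lemma cnj_of_real_poly: "map_poly cnj (map_poly complex_of_real p) = map_poly complex_of_real p"
  by (intro poly_eqI) (simp add: coeff_map_poly)

lemma map_poly_cnj_eq_0: "map_poly cnj p = 0 \<longleftrightarrow> p = 0"
  by (auto simp: poly_eq_iff coeff_map_poly)

text \<open>Over \<open>\<complex>(x)\<close> the polynomial \<open>(u0 + u1 T)\<^sup>2 + (v0 + v1 T)\<^sup>2\<close> in \<open>T\<close> has the root \<open>p / q\<close>, and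
  \<open>((T + a) (T\<^sup>2 + a T + e)) s\<^sup>2\<close> is congruent to \<open>T (w + s T)\<^sup>2\<close> modulo it.\<close>
lemma linear_forms_root:
  fixes u0 u1 v0 v1 w s a e i :: "'a::comm_ring_1"
  assumes i: "i\<^sup>2 = - 1" and p: "p = - (u0 + i * v0)" and q: "q = u1 + i * v1"
    and 0: "u0\<^sup>2 + v0\<^sup>2 = a * e * s\<^sup>2" and 1: "2 * (u0 * u1 + v0 * v1) + w\<^sup>2 = (a\<^sup>2 + e) * s\<^sup>2"
    and 2: "u1\<^sup>2 + v1\<^sup>2 + 2 * w * s = 2 * a * s\<^sup>2"
  shows "s\<^sup>2 * ((p + a * q) * (p\<^sup>2 + a * p * q + e * q\<^sup>2)) = p * (w * q + s * p)\<^sup>2"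
proof -
  define x y where "x = u1 * p + u0 * q" and "y = v1 * p + v0 * q"
  have "x + i * y = (u1 + i * v1) * p + (u0 + i * v0) * q" by (simp add: x_def y_def algebra_simps)
  also have "u0 + i * v0 = - p" by (simp add: p)
  finally have "x = - (i * y)" by (simp add: q[symmetric] eq_neg_iff_add_eq_0)
  then have xy: "x\<^sup>2 + y\<^sup>2 = 0" using i by (simp add: power_mult_distrib)
  have "s\<^sup>2 * ((p + a * q) * (p\<^sup>2 + a * p * q + e * q\<^sup>2))
      = s\<^sup>2 * p ^ 3 + (2 * a * s\<^sup>2) * p\<^sup>2 * q + ((a\<^sup>2 + e) * s\<^sup>2) * p * q\<^sup>2 + (a * e * s\<^sup>2) * q ^ 3"
    by (simp add: power2_eq_square power3_eq_cube algebra_simps)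
  also have "\<dots> = p * (w * q + s * p)\<^sup>2 + q * (x\<^sup>2 + y\<^sup>2)"
    unfolding 0[symmetric] 1[symmetric] 2[symmetric] x_def y_def
    by (simp add: power2_eq_square power3_eq_cube algebra_simps)
  finally show ?thesis by (simp add: xy)
qed

lemma linear_forms_norm:
  fixes u0 u1 v0 v1 w s a e i :: "'a::comm_ring_1"
  assumes i: "i\<^sup>2 = - 1" and p: "p = - (u0 + i * v0)" and q: "q = u1 + i * v1"
    and p': "p' = - (u0 - i * v0)" and q': "q' = u1 - i * v1"
    and 0: "u0\<^sup>2 + v0\<^sup>2 = a * e * s\<^sup>2" and 1: "2 * (u0 * u1 + v0 * v1) + w\<^sup>2 = (a\<^sup>2 + e) * s\<^sup>2"
    and 2: "u1\<^sup>2 + v1\<^sup>2 + 2 * w * s = 2 * a * s\<^sup>2"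
  shows "4 * (p * p') * ((p + a * q) * (p' + a * q')) = a\<^sup>2 * e * (q * q')\<^sup>2"
proof -
  have ii: "i * (i * z) = - z" for z using i by (simp add: power2_eq_square flip: mult.assoc)
  have pp: "p * p' = a * e * s\<^sup>2"
    unfolding 0[symmetric] p p' by (simp add: power2_eq_square algebra_simps ii)
  have "q * q' = u1\<^sup>2 + v1\<^sup>2" unfolding q q' by (simp add: power2_eq_square algebra_simps ii)
  also have "\<dots> = 2 * a * s\<^sup>2 - 2 * w * s" using 2 by (simp add: eq_diff_eq)
  finally have qq: "q * q' = 2 * s * (a * s - w)" by (simp add: power2_eq_square algebra_simps)
  have "(p + a * q) * (p' + a * q') = (u0\<^sup>2 + v0\<^sup>2) - a * (2 * (u0 * u1 + v0 * v1)) + a\<^sup>2 * (u1\<^sup>2 + v1\<^sup>2)"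
    unfolding p q p' q' by (simp add: power2_eq_square algebra_simps ii)
  also have "2 * (u0 * u1 + v0 * v1) = (a\<^sup>2 + e) * s\<^sup>2 - w\<^sup>2" using 1 by (simp add: eq_diff_eq)
  also have "u1\<^sup>2 + v1\<^sup>2 = 2 * a * s\<^sup>2 - 2 * w * s" using 2 by (simp add: eq_diff_eq)
  finally have "(p + a * q) * (p' + a * q') = a * (a * s - w)\<^sup>2"
    unfolding 0 by (simp add: power2_eq_square algebra_simps)
  moreover have "4 * (a * e * s\<^sup>2) * (a * z\<^sup>2) = a\<^sup>2 * e * (2 * s * z)\<^sup>2" for z
    by (simp add: power2_eq_square mult_ac)
  ultimately show ?thesis unfolding pp qq by simp
qed

text \<open>The root \<open>p / q\<close> has a square value, so it is constant and becomes a
  function of \<open>X\<close>. The norm relation at a real \<open>X\<close> between 0 and \<kappa>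
  then has a nonnegative left side and a negative right side.\<close>

lemma no_linear_forms:
  fixes D :: "real \<Rightarrow> real" and u0 u1 v0 v1 w s :: "real poly"
  assumes D: "derivation D" "D \<beta> = 1" "D \<kappa> = 0" and \<kappa>: "0 < \<kappa>" "\<kappa> < 1 / 2"
    and a: "a = [:2 * \<beta> + 1, 0, 2:]" and e: "e = [:\<beta>\<^sup>2 - \<kappa>\<^sup>2, 0, 2 * \<beta>, 0, 1:]" and s: "s \<noteq> 0"
    and 0: "u0\<^sup>2 + v0\<^sup>2 = a * e * s\<^sup>2" and 1: "2 * (u0 * u1 + v0 * v1) + w\<^sup>2 = (a\<^sup>2 + e) * s\<^sup>2"
    and 2: "u1\<^sup>2 + v1\<^sup>2 + 2 * w * s = 2 * a * s\<^sup>2"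
  shows False
proof -
  have "derivation (\<lambda>z. Complex (D (Re z)) (D (Im z)))" by (rule derivation_complex) (fact D)
  then interpret complex_case "\<lambda>z. Complex (D (Re z)) (D (Im z))" "complex_of_real \<beta>" "complex_of_real \<kappa>"
  proof unfold_locales
    show "Complex (D (Re (complex_of_real \<beta>))) (D (Im (complex_of_real \<beta>))) = 1"
      "Complex (D (Re (complex_of_real \<kappa>))) (D (Im (complex_of_real \<kappa>))) = 0"
      by (simp_all add: D(2,3) der_0[OF D(1)] complex_eq_iff)
    have "4 * \<kappa>\<^sup>2 < 1" using power_strict_mono[of \<kappa> "1/2" 2] \<kappa> by (simp add: power2_eq_square)
    then show "4 * (complex_of_real \<kappa>)\<^sup>2 \<noteq> 1" by (metis less_irrefl of_real_eq_1_iff of_real_mult of_real_numeral of_real_power)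
  qed
  let ?c = "map_poly complex_of_real" and ?b = "map_poly cnj"
  note hom = of_real_hom
  have sq: "?c (p\<^sup>2) = (?c p)\<^sup>2" for p by (simp add: power2_eq_square hom)
  have two: "?c 2 = 2" unfolding numeral_poly by (simp add: map_poly_pCons)
  define I where "I = [:\<i>:]"
  have I: "I\<^sup>2 = - 1" by (simp add: I_def power2_eq_square one_pCons)
  define p q where "p = - (?c u0 + I * ?c v0)" and "q = ?c u1 + I * ?c v1"
  have rel: "(?c u0)\<^sup>2 + (?c v0)\<^sup>2 = ?c a * ?c e * (?c s)\<^sup>2"
    "2 * (?c u0 * ?c u1 + ?c v0 * ?c v1) + (?c w)\<^sup>2 = ((?c a)\<^sup>2 + ?c e) * (?c s)\<^sup>2"
    "(?c u1)\<^sup>2 + (?c v1)\<^sup>2 + 2 * ?c w * ?c s = 2 * ?c a * (?c s)\<^sup>2"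
    using arg_cong[OF 0, of ?c] arg_cong[OF 1, of ?c] arg_cong[OF 2, of ?c] unfolding hom sq two mult.assoc by simp_all
  have ca: "?c a = ca" by (simp add: a ca_def map_poly_pCons)
  have ce: "?c e = cb\<^sup>2 - cn"
    by (simp add: e cb_def cn_def map_poly_pCons power2_eq_square algebra_simps)
  have acb: "ca = 2 * cb" unfolding mult_2 by (simp add: ca_def cb_def)
  \<comment> \<open>Otherwise \<open>w = a * s\<close>, and the middle equation would force
    \<open>e = 0\<close>.\<close>
  have q0: "q \<noteq> 0"
  proof
    assume "q = 0"
    then have "u1 = 0 \<and> v1 = 0"
      by (simp add: q_def I_def poly_eq_iff coeff_map_poly complex_eq_iff)
    then have "w * s = a * s * s" "w\<^sup>2 = (a\<^sup>2 + e) * s\<^sup>2" using 1 2 by (simp_all add: power2_eq_square mult_ac)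
    then have "w = a * s" "w\<^sup>2 = (a\<^sup>2 + e) * s\<^sup>2" using s by simp_all
    then have "e * s\<^sup>2 = 0" by (simp add: power_mult_distrib distrib_right)
    then have "e = 0" using s by (simp only: mult_eq_0_iff power_eq_0_iff) simp
    then show False by (simp add: e)
  qed
  have "(?c s)\<^sup>2 * ((p + ?c a * q) * (p\<^sup>2 + ?c a * p * q + ?c e * q\<^sup>2)) = p * (?c w * q + ?c s * p)\<^sup>2"
    by (rule linear_forms_root[OF I p_def q_def rel])
  moreover have "p\<^sup>2 + ?c a * p * q + ?c e * q\<^sup>2 = (p + cb * q)\<^sup>2 - cn * q\<^sup>2"
    unfolding ca ce acb by (simp add: power2_eq_square algebra_simps)
  ultimately have sq0: "(p * (?c w * q + ?c s * p))\<^sup>2 = p * (p + ca * q) * ((p + cb * q)\<^sup>2 - cn * q\<^sup>2) * (?c s)\<^sup>2"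
    unfolding ca by (simp add: power_mult_distrib power2_eq_square mult_ac)
  define h where "h = gcd p q"
  have h0: "h \<noteq> 0" using q0 by (simp add: h_def)
  obtain P Q where PQ: "p = P * h" "q = Q * h" "coprime P Q"
    using gcd_coprime_exists[of p q] h0 unfolding h_def by blast
  have Q0: "Q \<noteq> 0" using PQ q0 by auto
  have "(p * (?c w * q + ?c s * p))\<^sup>2 = P * (P + ca * Q) * ((P + cb * Q)\<^sup>2 - cn * Q\<^sup>2) * (?c s * h\<^sup>2)\<^sup>2"
  proof -
    have f: "p + x * q = (P + x * Q) * h" for x by (simp add: PQ(1,2) algebra_simps)
    have "(P * h) * (x * h) * ((y * h)\<^sup>2 - cn * (Q * h)\<^sup>2) * z\<^sup>2 = P * x * (y\<^sup>2 - cn * Q\<^sup>2) * (z * h\<^sup>2)\<^sup>2" for x y z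
      by (simp add: power2_eq_square algebra_simps)
    then have "p * (p + ca * q) * ((p + cb * q)\<^sup>2 - cn * q\<^sup>2) * (?c s)\<^sup>2
        = P * (P + ca * Q) * ((P + cb * Q)\<^sup>2 - cn * Q\<^sup>2) * (?c s * h\<^sup>2)\<^sup>2"
      unfolding f unfolding PQ(1,2) by (simp only:)
    then show ?thesis unfolding sq0 .
  qed
  moreover have "?c s * h\<^sup>2 \<noteq> 0" using s h0 by (simp add: map_poly_eq_0_iff)
  ultimately obtain r where "P * (P + ca * Q) * ((P + cb * Q)\<^sup>2 - cn * Q\<^sup>2) = r\<^sup>2" by (rule square_dvd_square)
  from W_eq_0[OF PQ(3) Q0 this[symmetric]] have "W P Q = 0" .
  from even_fraction[OF PQ(3) Q0 this] obtain g n where n0: "n \<noteq> 0" and gn: "P * n = g * Q"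
    and ev: "even_poly g" "even_poly n" .
  obtain g' where g': "g = pcompose g' [:complex_of_real \<beta>, 0, 1:]" by (rule even_poly_pcompose[OF ev(1)])
  obtain n' where n': "n = pcompose n' [:complex_of_real \<beta>, 0, 1:]" by (rule even_poly_pcompose[OF ev(2)])
  have pn: "p * n = g * q" using arg_cong[OF gn, of "\<lambda>x. h * x"] by (simp add: PQ mult_ac)
  have bI: "?b I = - I" by (simp add: I_def map_poly_pCons)
  have bm: "?b (- x) = - ?b x" "?b (x - y) = ?b x - ?b y" for x y by (intro poly_eqI; simp add: coeff_map_poly)+
  have bp: "?b p = - (?c u0 - I * ?c v0)" and bq: "?b q = ?c u1 - I * ?c v1"
    by (simp_all add: p_def q_def cnj_hom bm bI cnj_of_real_poly)
  have bpn: "?b p * ?b n = ?b g * ?b q" using arg_cong[OF pn, of ?b] by (simp add: cnj_hom)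
  have bq0: "?b q \<noteq> 0" using q0 by (simp add: map_poly_cnj_eq_0)
  have "4 * (p * ?b p) * ((p + ca * q) * (?b p + ca * ?b q)) = ca\<^sup>2 * ?c e * (q * ?b q)\<^sup>2"
    using linear_forms_norm[OF I p_def q_def bp bq rel] by (simp only: ca)
  then have "4 * ((p * n) * (?b p * ?b n)) * ((p * n + ca * n * q) * (?b p * ?b n + ca * ?b n * ?b q))
      = ca\<^sup>2 * ?c e * (q * ?b q)\<^sup>2 * (n * ?b n)\<^sup>2"
    by (simp add: power2_eq_square ring_distribs mult_ac) algebra
  then have "(4 * (g * ?b g) * ((g + ca * n) * (?b g + ca * ?b n))) * (q * ?b q)\<^sup>2 = (ca\<^sup>2 * ?c e * (n * ?b n)\<^sup>2) * (q * ?b q)\<^sup>2"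
    unfolding pn bpn by (simp add: power2_eq_square algebra_simps)
  then have key: "4 * (g * ?b g) * ((g + ca * n) * (?b g + ca * ?b n)) = ca\<^sup>2 * ?c e * (n * ?b n)\<^sup>2"
    using q0 bq0 by simp
  have "n' \<noteq> 0" using n0 n' by auto
  have "finite {X. poly n' (complex_of_real X) = 0}"
  proof -
    have "finite {z. poly n' z = 0}" by (rule poly_roots_finite) fact
    then have "finite (complex_of_real -` {z. poly n' z = 0})" by (rule finite_vimageI) (simp add: inj_def)
    then show ?thesis by (simp add: vimage_def)
  qed
  \<comment> \<open>The denominator has finitely many zeros, so some \<open>X\<close> in the
    interval avoids them.\<close>
  then have "\<not> {0<..<\<kappa>} \<subseteq> {X. poly n' (complex_of_real X) = 0}"
    using finite_subset infinite_Ioo[OF \<kappa>(1)] by blast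
  then obtain X where X: "X \<in> {0<..<\<kappa>}" "poly n' (complex_of_real X) \<noteq> 0" by blast
  then have X: "0 < X" "X < \<kappa>" "poly n' (complex_of_real X) \<noteq> 0" by simp_all
  \<comment> \<open>\<open>X - \<beta>\<close> may be negative and \<open>x\<close> imaginary. Only
    \<open>x^2\<close> enters, and it is real, so conjugating \<open>g\<close> and \<open>n\<close>
    conjugates their values at \<open>x\<close>.\<close>
  define x where "x = csqrt (complex_of_real (X - \<beta>))"
  have x2: "x\<^sup>2 = complex_of_real (X - \<beta>)" by (simp add: x_def)
  then have cx2: "(cnj x)\<^sup>2 = complex_of_real (X - \<beta>)" by (metis complex_cnj_complex_of_real complex_cnj_power)
  let ?G = "poly g' (complex_of_real X)" and ?N = "poly n' (complex_of_real X)"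
  have ev: "poly g x = ?G" "poly n x = ?N" "poly (?b g) x = cnj ?G" "poly (?b n) x = cnj ?N"
    using x2 cx2 by (simp_all add: g' n' poly_map_cnj poly_pcompose power2_eq_square)
  have "poly ca x = complex_of_real (2 * X + 1)"
  proof -
    have "poly ca x = 2 * (complex_of_real \<beta> + x\<^sup>2) + 1" by (simp add: ca_def power2_eq_square algebra_simps)
    then show ?thesis by (simp add: x2)
  qed
  moreover have "poly (?c e) x = complex_of_real (X\<^sup>2 - \<kappa>\<^sup>2)"
  proof -
    have "poly (?c e) x = (complex_of_real \<beta> + x\<^sup>2)\<^sup>2 - (complex_of_real \<kappa>)\<^sup>2"
      by (simp add: e map_poly_pCons power2_eq_square algebra_simps)
    then show ?thesis by (simp add: x2)
  qed
  ultimately have "4 * (?G * cnj ?G) * ((?G + of_real (2 * X + 1) * ?N) * cnj (?G + of_real (2 * X + 1) * ?N))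
      = (of_real (2 * X + 1))\<^sup>2 * of_real (X\<^sup>2 - \<kappa>\<^sup>2) * (?N * cnj ?N)\<^sup>2"
    using arg_cong[OF key, of "\<lambda>p. poly p x"] ev by simp
  then have "complex_of_real (4 * (norm ?G)\<^sup>2 * (norm (?G + of_real (2 * X + 1) * ?N))\<^sup>2)
      = complex_of_real ((2 * X + 1)\<^sup>2 * (X\<^sup>2 - \<kappa>\<^sup>2) * ((norm ?N)\<^sup>2)\<^sup>2)"
    unfolding complex_norm_square[symmetric]
    by (simp only: of_real_mult of_real_power of_real_numeral mult.assoc)
  then have eq: "4 * (norm ?G)\<^sup>2 * (norm (?G + of_real (2 * X + 1) * ?N))\<^sup>2 = (2 * X + 1)\<^sup>2 * (X\<^sup>2 - \<kappa>\<^sup>2) * ((norm ?N)\<^sup>2)\<^sup>2"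
    by (simp only: of_real_eq_iff)
  have "X\<^sup>2 < \<kappa>\<^sup>2" using X power_strict_mono[of X \<kappa> 2] by simp
  then have "(2 * X + 1)\<^sup>2 * (X\<^sup>2 - \<kappa>\<^sup>2) * ((norm ?N)\<^sup>2)\<^sup>2 < 0"
    using X by (intro mult_neg_pos mult_pos_neg) simp_all
  moreover have "0 \<le> 4 * (norm ?G)\<^sup>2 * (norm (?G + of_real (2 * X + 1) * ?N))\<^sup>2" by simp
  ultimately show False using eq by linarith
qed

section \<open>Normalisation of the parameters\<close>

lemma alg_indep_nonzero:
  assumes "rat_alg_indep3 a b c"
  shows "a \<noteq> 0" "c \<noteq> 0"
proof -
  have z: "p = 0" if "eval3 (map_poly (map_poly (map_poly of_rat)) p) a b c = 0" for p
    using assms that unfolding rat_alg_indep3_def by blast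
  show "a \<noteq> 0" using z[of "[:[:[:0, 1:]:]:]"] by (auto simp: eval3_def eval2_def map_poly_pCons)
  show "c \<noteq> 0" using z[of "[:0, 1:]"] by (auto simp: eval3_def eval2_def map_poly_pCons)
qed

context
  fixes \<eta> \<omega> \<rho> :: real
  assumes indep: "rat_alg_indep3 \<eta> \<omega> \<rho>" and \<omega>: "\<omega> > 1 + \<bar>\<eta>\<bar>" and \<omega>2: "\<omega>\<^sup>2 - \<eta>\<^sup>2 > 2 * \<omega>"
    and b1: "b1 \<eta> \<omega> \<rho> > 1 + (\<omega>\<^sup>2 - \<eta>\<^sup>2) / 2"
begin

text \<open>Scaling \<open>x\<close> and \<open>y\<close> by \<open>sqrt gap\<close> turns
  \<open>y^2 + 1\<close> into \<open>gap (y^2 + \<theta>)\<close>; \<kappa> and \<beta> are the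
  matching rescalings of \<omega> and \<open>b1 - 1\<close>.\<close>

definition "gap = \<omega>\<^sup>2 - \<eta>\<^sup>2"
definition "\<theta> = 1 / gap"
definition "\<kappa> = \<omega> / gap"
definition "\<beta> = (b1 \<eta> \<omega> \<rho> - 1) / gap"

lemma gap_pos: "gap > 0" and kappa: "0 < \<kappa>" "\<kappa> < 1 / 2" and beta: "1 / 2 < \<beta>"
proof -
  show g: "gap > 0" using \<omega> \<omega>2 by (simp add: gap_def)
  show "0 < \<kappa>" using g \<omega> by (simp add: \<kappa>_def)
  show "\<kappa> < 1 / 2" using g \<omega>2 by (simp add: \<kappa>_def gap_def divide_less_eq)
  have "gap < 2 * (b1 \<eta> \<omega> \<rho> - 1)" using b1 by (simp add: gap_def field_simps)
  then show "1 / 2 < \<beta>" using g by (simp add: \<beta>_def less_divide_eq)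
qed

lemma gap_relations: "gap * \<theta> = 1" "gap * \<kappa> = \<omega>" "gap * \<beta> = b1 \<eta> \<omega> \<rho> - 1"
  "gap * b1 \<eta> \<omega> \<rho> = \<rho>\<^sup>2 - \<eta>\<^sup>2 - gap\<^sup>2 / 4"
proof -
  show "gap * \<theta> = 1" "gap * \<kappa> = \<omega>" "gap * \<beta> = b1 \<eta> \<omega> \<rho> - 1"
    using gap_pos by (simp_all add: \<theta>_def \<kappa>_def \<beta>_def)
  have "b1 \<eta> \<omega> \<rho> = (\<rho>\<^sup>2 - \<eta>\<^sup>2) / gap - gap / 4" by (simp add: b1_def gap_def)
  then show "gap * b1 \<eta> \<omega> \<rho> = \<rho>\<^sup>2 - \<eta>\<^sup>2 - gap\<^sup>2 / 4"
    using gap_pos by (simp add: right_diff_distrib power2_eq_square)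
qed

lemma der_relations:
  assumes D: "derivation D"
  shows "D gap = 2 * \<omega> * D \<omega> - 2 * \<eta> * D \<eta>" "gap * D \<theta> + D gap * \<theta> = 0" "gap * D \<kappa> + D gap * \<kappa> = D \<omega>"
    "gap * D \<beta> + D gap * \<beta> = D (b1 \<eta> \<omega> \<rho>)"
    "gap * D (b1 \<eta> \<omega> \<rho>) + D gap * b1 \<eta> \<omega> \<rho> = 2 * \<rho> * D \<rho> - 2 * \<eta> * D \<eta> - gap * D gap / 2"
proof -
  note d = der_mult[OF D] der_diff[OF D] der_power2[OF D] der_1[OF D]
  have q: "D (x / 4) = D x / 4" for x
    using der_mult[OF D, of 4 "x / 4"] der_numeral[OF D] by simp
  show "D gap = 2 * \<omega> * D \<omega> - 2 * \<eta> * D \<eta>" by (simp add: gap_def d)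
  show "gap * D \<theta> + D gap * \<theta> = 0" "gap * D \<kappa> + D gap * \<kappa> = D \<omega>" "gap * D \<beta> + D gap * \<beta> = D (b1 \<eta> \<omega> \<rho>)"
    "gap * D (b1 \<eta> \<omega> \<rho>) + D gap * b1 \<eta> \<omega> \<rho> = 2 * \<rho> * D \<rho> - 2 * \<eta> * D \<eta> - gap * D gap / 2"
    using gap_relations[THEN arg_cong, of D] by (simp_all add: d q)
qed

lemma derivation_theta:
  obtains D where "derivation D" "D \<theta> = 1" "D \<kappa> = 0" "D \<beta> = 0"
proof -
  let ?b = "b1 \<eta> \<omega> \<rho>"
  \<comment> \<open>Solved backwards: \<open>D \<theta> = 1\<close> needs
    \<open>D gap = - gap^2\<close>; constancy of \<kappa> and \<beta> then fixes
    \<open>D \<omega>\<close> and the derivative of \<open>b1\<close>, and the relations for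
    \<open>gap\<close> and \<open>b1\<close> determine \<open>D \<eta>\<close> and
    \<open>D \<rho>\<close>.\<close>
  obtain D where D: "derivation D" and v: "D \<eta> = (gap\<^sup>2 - 2 * gap * \<omega>\<^sup>2) / (2 * \<eta>)" "D \<omega> = - gap * \<omega>"
    "D \<rho> = (- gap\<^sup>2 * (?b - 1) - gap\<^sup>2 * ?b + (gap\<^sup>2 - 2 * gap * \<omega>\<^sup>2) - gap ^ 3 / 2) / (2 * \<rho>)"
    by (rule ex_derivation_real[OF indep])
  note r = der_relations[OF D]
  have ne: "\<eta> \<noteq> 0" "\<rho> \<noteq> 0" "gap \<noteq> 0" using alg_indep_nonzero[OF indep] gap_pos by auto
  have e: "2 * \<eta> * D \<eta> = gap\<^sup>2 - 2 * gap * \<omega>\<^sup>2" using ne by (simp add: v)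
  have g: "D gap = - gap\<^sup>2" unfolding r(1) e v(2) by (simp add: power2_eq_square)
  have "gap * D \<theta> = gap * 1" using r(2) gap_relations(1) by (simp add: g power2_eq_square algebra_simps)
  then have 1: "D \<theta> = 1" using ne by simp
  have "gap * D \<kappa> = D \<omega> - D gap * \<kappa>" using r(3) by simp
  also have "\<dots> = - gap * \<omega> + gap * (gap * \<kappa>)" by (simp add: g v power2_eq_square)
  also have "\<dots> = 0" by (simp add: gap_relations(2))
  finally have "gap * D \<kappa> = 0" .
  then have 2: "D \<kappa> = 0" using ne by simp
  have "2 * \<rho> * D \<rho> = - gap\<^sup>2 * (?b - 1) - gap\<^sup>2 * ?b + (gap\<^sup>2 - 2 * gap * \<omega>\<^sup>2) - gap ^ 3 / 2"
    unfolding v(3) using ne by simp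
  then have "gap * D ?b = gap * (- gap * (?b - 1))"
    using r(5) unfolding e g by (simp add: power2_eq_square power3_eq_cube algebra_simps)
  then have "D ?b = - gap * (?b - 1)" unfolding mult_left_cancel[OF ne(3)] .
  then have "gap * D \<beta> = 0" using r(4) unfolding g gap_relations(3)[symmetric] by (simp add: power2_eq_square)
  then have 3: "D \<beta> = 0" using ne by simp
  show thesis by (rule that[OF D 1 2 3])
qed

lemma derivation_beta:
  obtains D where "derivation D" "D \<beta> = 1" "D \<kappa> = 0"
proof -
  let ?b = "b1 \<eta> \<omega> \<rho>"
  \<comment> \<open>Moving only \<rho> keeps \<open>gap\<close> and \<kappa> fixed; this value makes
    the derivative of \<open>b1\<close> equal to \<open>gap\<close>.\<close>
  obtain D where D: "derivation D" and v: "D \<eta> = 0" "D \<omega> = 0" "D \<rho> = gap\<^sup>2 / (2 * \<rho>)"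
    by (rule ex_derivation_real[OF indep])
  note r = der_relations[OF D]
  have ne: "\<rho> \<noteq> 0" "gap \<noteq> 0" using alg_indep_nonzero[OF indep] gap_pos by auto
  have g: "D gap = 0" unfolding r(1) v by simp
  have 2: "D \<kappa> = 0" using r(3) ne by (simp add: g v)
  have "gap * D ?b = gap * gap" using r(5) ne unfolding g v by (simp add: power2_eq_square)
  then have "D ?b = gap" using ne by simp
  then have 1: "D \<beta> = 1" using r(4) ne by (simp add: g)
  show thesis by (rule that[OF D 1 2])
qed

section \<open>Positivity and the final contradiction\<close>

lemma P_sq_positive: "positive_poly2 (P_sq \<eta> \<omega> \<rho>)"
  unfolding positive_poly2_def
proof (intro allI)
  fix x y :: real
  define b where "b = b1 \<eta> \<omega> \<rho>"
  have b: "2 * b > 2 + gap" using b1 by (simp add: b_def gap_def field_simps)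
  \<comment> \<open>Hence \<open>b\<close> exceeds \<open>gap / 2\<close>, which exceeds the
    absolute value of \<eta>; this makes the term from \<open>B\<close> nonnegative.\<close>
  have g: "gap > 2 * \<bar>\<eta>\<bar>" using \<omega>2 \<omega> by (simp add: gap_def)
  have "\<eta>\<^sup>2 \<le> (x\<^sup>2 + b)\<^sup>2"
  proof -
    have "\<bar>\<eta>\<bar> \<le> x\<^sup>2 + b" using b g zero_le_power2[of x] by linarith
    then have "\<bar>\<eta>\<bar>\<^sup>2 \<le> (x\<^sup>2 + b)\<^sup>2" by (intro power_mono) simp_all
    then show ?thesis by simp
  qed
  moreover have C: "0 \<le> 2 * (x\<^sup>2 + b) + gap - 1" 
    unfolding distrib_left using b gap_pos zero_le_power2[of x] by linarith
  moreover have "0 \<le> y ^ 4" by (simp add: zero_le_even_power)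
  ultimately have "0 \<le> (y\<^sup>2 + 1) * (y\<^sup>2 + (2 * (x\<^sup>2 + b) + gap - 1))
      * (y ^ 4 + (1 + (2 * (x\<^sup>2 + b) + gap - 1)) * y\<^sup>2 + ((x\<^sup>2 + b)\<^sup>2 - \<eta>\<^sup>2))"
    by (intro mult_nonneg_nonneg add_nonneg_nonneg) simp_all
  then show "0 \<le> eval2 (P_sq \<eta> \<omega> \<rho>) x y"
    by (simp add: eval2_P_sq Let_def b_def gap_def algebra_simps)
qed

lemma P_sq_not_sum: "\<not> sum_of_three_squares (to_fract (P_sq \<eta> \<omega> \<rho>) :: real poly poly fract)"
proof
  assume "sum_of_three_squares (to_fract (P_sq \<eta> \<omega> \<rho>) :: real poly poly fract)"
  then obtain f g h where sum: "to_fract (P_sq \<eta> \<omega> \<rho>) = f\<^sup>2 + g\<^sup>2 + h\<^sup>2"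
    unfolding sum_of_three_squares_def by blast
  obtain D where D: "derivation D" "D \<theta> = 1" "D \<kappa> = 0" "D \<beta> = 0" by (rule derivation_theta)
  interpret real_case D \<theta> \<kappa> \<beta>
    by unfold_locales (fact D kappa beta)+
  have s: "sqrt gap \<noteq> 0" "(sqrt gap)\<^sup>2 = gap" using gap_pos by simp_all
  have scale: "eval2 (P_sq \<eta> \<omega> \<rho>) (sqrt gap * x) (sqrt gap * y) = sqrt gap ^ 8 * poly (PT x) (y\<^sup>2 + \<theta>)" for x y
  proof -
    define b t where "b = b1 \<eta> \<omega> \<rho>" and "t = y\<^sup>2 + \<theta>"
    have r: "b = gap * \<beta> + 1" using gap_relations by (simp add: b_def)
    have g2: "gap\<^sup>2 * \<theta> = gap" using gap_relations(1) by (simp add: power2_eq_square)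
    have \<eta>: "\<eta>\<^sup>2 = gap\<^sup>2 * \<kappa>\<^sup>2 - gap" using gap_def gap_relations(2) by (simp flip: power_mult_distrib)
    have sx: "(sqrt gap * z)\<^sup>2 = gap * z\<^sup>2" "(sqrt gap * z) ^ 4 = gap\<^sup>2 * z ^ 4" for z
    proof -
      show "(sqrt gap * z)\<^sup>2 = gap * z\<^sup>2" by (simp add: power_mult_distrib s)
      have "sqrt gap ^ 4 = ((sqrt gap)\<^sup>2)\<^sup>2" by (simp flip: power_mult)
      then show "(sqrt gap * z) ^ 4 = gap\<^sup>2 * z ^ 4" by (simp add: power_mult_distrib s)
    qed
    have s8: "sqrt gap ^ 8 = gap * gap * gap\<^sup>2"
    proof -
      have "sqrt gap ^ 8 = ((sqrt gap)\<^sup>2) ^ 4" by (simp flip: power_mult)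
      then show ?thesis by (simp add: s power2_eq_square power4_eq_xxxx)
    qed
    have 1: "gap * y\<^sup>2 + 1 = gap * t" using gap_relations(1) by (simp add: t_def distrib_left)
    have 2: "gap * y\<^sup>2 + (2 * (gap * x\<^sup>2 + b) + gap - 1) = gap * (2 * x\<^sup>2 + 1 + 2 * \<beta> + t)"
      using gap_relations(1) by (simp add: t_def r algebra_simps)
    have 3: "gap\<^sup>2 * y ^ 4 + (1 + (2 * (gap * x\<^sup>2 + b) + gap - 1)) * (gap * y\<^sup>2) + ((gap * x\<^sup>2 + b)\<^sup>2 - \<eta>\<^sup>2)
        = gap\<^sup>2 * ((x\<^sup>2 + \<beta> + t)\<^sup>2 + (- \<kappa>\<^sup>2 + t))"
    proof -
      have "gap\<^sup>2 * ((x\<^sup>2 + \<beta> + t)\<^sup>2 + (- \<kappa>\<^sup>2 + t))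
          = (gap * x\<^sup>2 + gap * \<beta> + gap * y\<^sup>2 + gap * \<theta>)\<^sup>2 - gap\<^sup>2 * \<kappa>\<^sup>2 + gap\<^sup>2 * y\<^sup>2 + gap\<^sup>2 * \<theta>"
        by (simp add: t_def power2_eq_square algebra_simps)
      also have "\<dots> = (gap * x\<^sup>2 + gap * \<beta> + gap * y\<^sup>2 + 1)\<^sup>2 - gap\<^sup>2 * \<kappa>\<^sup>2 + gap\<^sup>2 * y\<^sup>2 + gap"
        unfolding gap_relations(1) g2 ..
      also have "\<dots> = gap\<^sup>2 * y ^ 4 + (1 + (2 * (gap * x\<^sup>2 + b) + gap - 1)) * (gap * y\<^sup>2) + ((gap * x\<^sup>2 + b)\<^sup>2 - \<eta>\<^sup>2)"
        unfolding \<eta> r by (simp add: power2_eq_square power4_eq_xxxx algebra_simps)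
      finally show ?thesis by simp
    qed
    have "eval2 (P_sq \<eta> \<omega> \<rho>) (sqrt gap * x) (sqrt gap * y)
        = (gap * y\<^sup>2 + 1) * (gap * y\<^sup>2 + (2 * (gap * x\<^sup>2 + b) + gap - 1))
          * (gap\<^sup>2 * y ^ 4 + (1 + (2 * (gap * x\<^sup>2 + b) + gap - 1)) * (gap * y\<^sup>2) + ((gap * x\<^sup>2 + b)\<^sup>2 - \<eta>\<^sup>2))"
      unfolding eval2_P_sq Let_def sx b_def[symmetric] gap_def[symmetric] by (simp add: gap_def add_diff_eq)
    also have "\<dots> = sqrt gap ^ 8 * (t * (2 * x\<^sup>2 + 1 + 2 * \<beta> + t) * ((x\<^sup>2 + \<beta> + t)\<^sup>2 + (- \<kappa>\<^sup>2 + t)))"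
      unfolding 1 2 3 s8 by (simp only: mult_ac)
    also have "\<dots> = sqrt gap ^ 8 * poly (PT x) t" by (simp add: PT_def algebra_simps)
    finally show ?thesis by (simp only: t_def)
  qed
  obtain \<delta> where \<delta>: "derivation \<delta>" "\<And>p. \<delta> (to_fract p) = to_fract (del p)" by (rule del_extension, rule that)
  obtain u0 v0 u1 v1 where vec: "dot u0 u0 = to_fract p0" "dot u0 v0 = 0" "2 * dot u0 u1 + dot v0 v0 = to_fract p1"
    "dot u0 v1 + dot u1 v0 = 0" "dot u1 u1 + 2 * dot v0 v1 = to_fract p2" "dot u1 v1 = 0" "dot v1 v1 = to_fract p3"
    by (rule sum_of_three_squares_vectors[OF s(1) scale sum])
  obtain e f0 f1 d g0 g2 h0 h1 h2 where rep: "representation e f0 f1 d g0 g2 h0 h1 h2"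
    by (rule constant_form_polys[OF \<delta> vec], rule that, unfold representation_def, intro conjI allI)
  obtain u0 u1 v0 v1 w s where lin: "s \<noteq> 0" "u0\<^sup>2 + v0\<^sup>2 = xa * xe * s\<^sup>2"
    "u1\<^sup>2 + v1\<^sup>2 + 2 * w * s = 2 * xa * s\<^sup>2" "2 * (u0 * u1 + v0 * v1) + w\<^sup>2 = (xa\<^sup>2 + xe) * s\<^sup>2"
    by (rule QT_linear_forms[OF rep])
  \<comment> \<open>The variable is now \<open>x\<close>, so a second derivation is required, for
    which \<open>X = x^2 + \<beta>\<close> plays the part of \<open>T\<close>.\<close>
  obtain D' where D': "derivation D'" "D' \<beta> = 1" "D' \<kappa> = 0" by (rule derivation_beta)
  show False
    by (rule no_linear_forms[OF D' kappa xa_def xe_def lin(1,2,4,3)])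
qed

end

theorem corollary2p6:
  fixes \<eta> \<omega> \<rho> :: real
  assumes "rat_alg_indep3 \<eta> \<omega> \<rho>"
    and "\<omega> > 1 + \<bar>\<eta>\<bar>"
    and "\<omega>\<^sup>2 - \<eta>\<^sup>2 > 2 * \<omega>"
    and "b1 \<eta> \<omega> \<rho> > 1 + (\<omega>\<^sup>2 - \<eta>\<^sup>2) / 2"
  shows "positive_poly2 (P_sq \<eta> \<omega> \<rho>) \<and>
         \<not> sum_of_three_squares (to_fract (P_sq \<eta> \<omega> \<rho>) :: real poly poly fract)"
  using P_sq_positive[OF assms] P_sq_not_sum[OF assms] by blast

end
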